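(* Let $\beta_{\pm}=(1\pm\sqrt5)/2$ and $\beta=\beta_-$. Let $i,j,k,p,q$ denote indices with $\{i,j,k\}=\{1,2,3\}$ and $\{p,q\}=\{4,5\}$. The monodromy action of $g_{45}$ on the set $\mathcal{L}(X_{\mathbb{1}})$ of 27 lines on the Clebsch surface $X_{\mathbb{1}}$ is as follows. (1) There are fifteen lines on $X_{\mathbb{1}}$ fixed by $g_{45}$. These are: (a) three of the form $\mathbb{P}(e_{ij},e_{45})$, namely $L_{12,45}, L_{13,45}, L_{23,45}$; (b) six of the form $\mathbb{P}(e_{ij},e_{kp})$, namely $L_{12,34}, L_{12,35}, L_{13,24}, L_{13,25}, L_{23,14}, L_{23,15}$; (c) six of the form $\mathbb{P}(e_{ip}+\beta_+e_{kj},\; e_{kq}+\beta_+e_{ij})=\mathbb{P}(e_{ji}+\beta e_{kq},\; e_{kp}+\beta e_{jq})$, namely $L_{21435}, L_{12435}, L_{24135}, L_{13425}, L_{14235}, L_{14325}$. (2) There are six pairs of lines on $X_{\mathbb{1}}$ that are exchanged pairwise by $g_{45}$. For each permutation $[i,j,k]=\bigl(\begin{smallmatrix}1&2&3\\ i&j&k\end{smallmatrix}\bigr)\in S_3$ one has a pair $$L_{i4,k5}=\mathbb{P}(e_{i4},e_{k5}),\qquad L_{ijk45}=\mathbb{P}(e_{i4}+\beta e_{kj},\; e_{k5}+\beta e_{ij}).$$ These twelve lines form a double-six configuration. For each pair, $L_{i4,k5}$ and $L_{ijk45}$ are on opposite sides of the double-six. The three lines $\{L_{ijk45} : [i,j,k]\in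 A_3\}$ are on one side of the double-six and the three lines $\{L_{ijk45} : [i,j,k]\in S_3\setminus A_3\}$ are on the other side.
   Context: **Surfaces.** Let $\mathbb{P}^3_0=\{[x_1:\dots:x_5]\in\mathbb{P}^4_{\mathbb{C}} : x_1+\dots+x_5=0\}\cong\mathbb{P}^3_{\mathbb{C}}$. For $\lambda=[\lambda_1:\dots:\lambda_5]\in\mathbb{P}^4$ let $X_\lambda\subset\mathbb{P}^3_0$ be the cubic surface $\lambda_1x_1^3+\dots+\lambda_5x_5^3=0$. The Clebsch surface is $X_{\mathbb{1}}$ with $\mathbb{1}=[1:1:1:1:1]$. It is smooth and $\mathcal{L}(X_{\mathbb{1}})$ denotes its set of 27 lines. **Names of lines.** Let $e_1,\dots,e_5$ be the standard basis of $\mathbb{C}^5$, $e_{ij}=e_i-e_j$, and let $\mathbb{P}(x,y)$ denote the projectivization of $\mathbb{C}x+\mathbb{C}y$. The 27 lines on $X_{\mathbb{1}}$ are: - $L_{ij,kl}=\mathbb{P}(e_{ij},e_{kl})$ for each unordered pair of disjoint two-element subsets $\{i,j\},\{k,l\}$ of $\{1,\dots,5\}$ (15 lines); - $L_{abcde}=\mathbb{P}(e_{ca}+\beta e_{ed},\; e_{eb}+\beta e_{cd})$ for $\{a,b,c,d,e\}=\{1,2,3,4,5\}$, where $\beta=(1-\sqrt5)/2$. (Equivalently, $L_{abcde}$ is the projectivization of the row span of the $2\times5$ matrix whose columns in positions $a,b,c,d,e$ are respectively $(1,0)^T,(0,1)^T,(-1,-\beta)^T,(\beta,\beta)^T,(-\beta,-1)^T$.)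 The line $L_{abcde}$ depends on $(a,b,c,d,e)$ only up to cyclic rotation and reversal, giving 12 lines. **The loop $g_{45}$.** For $w\in\mathbb{C}$ let $X_w=X_\lambda$ with $\lambda=[1:1:1:1-3w:1-3w]$. So $X_0=X_{\mathbb{1}}$, and at $w_*=5/27$ the surface $X_{w_*}$ is singular with a single ordinary double point. Fix a sufficiently small real $\epsilon>0$ and $t_0<0<2\pi<t_3$. Let $w:[t_0,t_3]\to\mathbb{C}$ be the continuous path consisting of: the straight segment from $0$ to $w_*-\epsilon$ for $t\in[t_0,0]$; then the counterclockwise circle $w(t)=w_*-\epsilon e^{it}$ for $t\in[0,2\pi]$; then the first segment traversed in reverse, from $w_*-\epsilon$ back to $0$, for $t\in[2\pi,t_3]$. All surfaces $X_{w(t)}$ are smooth. The element $g_{45}$ of the orbifold fundamental group of the moduli space of smooth complex cubic surfaces, based at $X_{\mathbb{1}}$, is the class of the loop $t\mapsto X_{w(t)}$. **Monodromy action.** For a line $\ell\in\mathcal{L}(X_{\mathbb{1}})$ there is a unique continuous path of lines $\ell(t)\subset X_{w(t)}$, $t\in[t_0,t_3]$, with $\ell(t_0)=\ell$. The monodromy action of $g_{45}$ sends $\ell$ to $\ell(t_3)\in\mathcal{L}(X_{\mathbb{1}})$. **Double-six.** Twelve lines in $\mathbb{P}^3$ form a double-six if they can be arranged into two sextuples (the two sides) $a_1,\dots,a_6$ and $b_1,\dots,b_6$ such that the lines within each sextuple are pairwise disjoint and $a_i$ meets $b_j$ iff $i\ne j$. $S_3$ is the symmetric group on $\{1,2,3\}$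 and $A_3$ its alternating subgroup. *)

theory Defs
  imports "HOL-Analysis.Analysis" "HOL-Combinatorics.Permutations"
begin

text \<open>
  Coordinates of \<open>\<complex>\<^sup>5\<close> are indexed by the numeral type \<open>5\<close>, whose elements are \<open>1, 2, 3, 4, 5\<close>
  (arithmetic in this type is modulo 5, so the literal \<open>5\<close> denotes the same element as \<open>0\<close>;
  the five literals are pairwise distinct).

  A projective subvariety of \<open>\<P>\<^sup>4\<close> is represented by its affine cone in \<open>\<complex>\<^sup>5\<close> (including the origin),
  and a projective line by the corresponding 2-dimensional complex linear subspace.  The constants
  \<open>vec.subspace\<close>, \<open>vec.span\<close>, \<open>vec.dim\<close> are the notions over the scalar field \<open>\<complex>\<close> (and not over \<open>\<real>\<close>).
\<close>

type_synonym cvec = "complex ^ 5"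
type_synonym line = "cvec set"

definition proj_lines :: "line set" where
  "proj_lines = {V. vec.subspace V \<and> vec.dim V = 2}"

text \<open>The projectivization \<open>\<P>(x,y)\<close> of \<open>\<complex>x + \<complex>y\<close>.\<close>

definition pspan :: "cvec \<Rightarrow> cvec \<Rightarrow> line" where
  "pspan x y = vec.span {x, y}"

text \<open>The cubic surface \<open>X\<^sub>\<lambda>\<close> in \<open>\<P>\<^sup>3\<^sub>0\<close>.\<close>

definition cubic_surface :: "cvec \<Rightarrow> cvec set" where
  "cubic_surface l = {x. (\<Sum>i\<in>UNIV. x $ i) = 0 \<and> (\<Sum>i\<in>UNIV. l $ i * (x $ i) ^ 3) = 0}"

definition clebsch :: "cvec set" where
  "clebsch = cubic_surface (\<chi> i. 1)"

definition lines_on :: "cvec set \<Rightarrow> line set" where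
  "lines_on S = {V \<in> proj_lines. V \<subseteq> S}"

definition ediff :: "5 \<Rightarrow> 5 \<Rightarrow> cvec" where
  "ediff i j = axis i 1 - axis j 1"

definition beta_plus :: complex where
  "beta_plus = of_real ((1 + sqrt 5) / 2)"

definition beta_minus :: complex where
  "beta_minus = of_real ((1 - sqrt 5) / 2)"

text \<open>The lines \<open>L\<^sub>i\<^sub>j\<^sub>,\<^sub>k\<^sub>l\<close> and \<open>L\<^sub>a\<^sub>b\<^sub>c\<^sub>d\<^sub>e\<close>.\<close>

definition line4 :: "5 \<Rightarrow> 5 \<Rightarrow> 5 \<Rightarrow> 5 \<Rightarrow> line" where
  "line4 i j k l = pspan (ediff i j) (ediff k l)"

definition line5 :: "5 \<Rightarrow> 5 \<Rightarrow> 5 \<Rightarrow> 5 \<Rightarrow> 5 \<Rightarrow> line" where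
  "line5 a b c d e = pspan (ediff c a + beta_minus *s ediff e d) (ediff e b + beta_minus *s ediff c d)"

text \<open>
  The Grassmannian topology on the set of projective lines: the quotient topology induced by
  the map \<open>(x, y) \<mapsto> \<P>(x,y)\<close> from the space of linearly independent pairs.
\<close>

definition frames :: "(cvec \<times> cvec) set" where
  "frames = {(x, y). x \<noteq> y \<and> vec.independent {x, y}}"

definition line_topology :: "line topology" where
  "line_topology = topology (\<lambda>U. U \<subseteq> proj_lines \<and>
     openin (top_of_set frames) {f \<in> frames. pspan (fst f) (snd f) \<in> U})"

lemma openin_line_topology:
  "openin line_topology U \<longleftrightarrow> U \<subseteq> proj_lines \<and>
     openin (top_of_set frames) {f \<in> frames. pspan (fst f) (snd f) \<in> U}"
proof -
  let ?p = "\<lambda>U. {f \<in> frames. pspan (fst f) (snd f) \<in> U}"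
  have int: "?p (S \<inter> T) = ?p S \<inter> ?p T" for S T by auto
  have un: "?p (\<Union>K) = (\<Union>S\<in>K. ?p S)" for K by auto
  have "istopology (\<lambda>U. U \<subseteq> proj_lines \<and> openin (top_of_set frames) (?p U))"
    unfolding istopology_def int un
    by (intro conjI allI impI openin_Int openin_Union) auto
  then show ?thesis
    unfolding line_topology_def by (simp add: topology_inverse')
qed

text \<open>
  For a family \<open>X\<close> of surfaces over \<open>[a,b]\<close>: \<open>line_path X a b l c\<close> says that \<open>c\<close> is a continuous path of
  lines \<open>c t \<subseteq> X t\<close> starting at \<open>l\<close>; \<open>monodromy X a b l\<close> is the endpoint of the unique such path.
  Paths are made \<open>extensional\<close> so that they are determined by their values on \<open>[a,b]\<close>.
\<close>

definition line_path :: "(real \<Rightarrow> cvec set) \<Rightarrow> real \<Rightarrow> real \<Rightarrow> line \<Rightarrow> (real \<Rightarrow> line) \<Rightarrow> bool" where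
  "line_path X a b l c \<longleftrightarrow>
     c \<in> extensional {a..b} \<and>
     continuous_map (top_of_set {a..b}) line_topology c \<and>
     (\<forall>t\<in>{a..b}. c t \<in> lines_on (X t)) \<and> c a = l"

definition monodromy :: "(real \<Rightarrow> cvec set) \<Rightarrow> real \<Rightarrow> real \<Rightarrow> line \<Rightarrow> line" where
  "monodromy X a b l = (THE c. line_path X a b l c) b"

definition surface_w :: "complex \<Rightarrow> cvec set" where
  "surface_w w = cubic_surface (\<chi> i. if i = 4 \<or> i = 5 then 1 - 3 * w else 1)"

definition w_star :: complex where
  "w_star = 5 / 27"

text \<open>The loop in the \<open>w\<close>-plane defining \<open>g\<^sub>4\<^sub>5\<close>; both segments are parametrized affinely.\<close>

definition g45_loop :: "real \<Rightarrow> real \<Rightarrow> real \<Rightarrow> real \<Rightarrow> complex" where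
  "g45_loop \<epsilon> t0 t3 t =
     (if t \<le> 0 then of_real ((t - t0) / (0 - t0)) * (w_star - of_real \<epsilon>)
      else if t \<le> 2 * pi then w_star - of_real \<epsilon> * exp (\<i> * of_real t)
      else of_real ((t3 - t) / (t3 - 2 * pi)) * (w_star - of_real \<epsilon>))"

definition g45 :: "real \<Rightarrow> real \<Rightarrow> real \<Rightarrow> line \<Rightarrow> line" where
  "g45 \<epsilon> t0 t3 = monodromy (\<lambda>t. surface_w (g45_loop \<epsilon> t0 t3 t)) t0 t3"

text \<open>Two projective lines meet iff the corresponding linear subspaces share a nonzero vector.\<close>

definition meets :: "line \<Rightarrow> line \<Rightarrow> bool" where
  "meets V W \<longleftrightarrow> V \<inter> W \<noteq> {0}"

text \<open>\<open>A\<close> and \<open>B\<close> are the two sides of a double-six.\<close>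

definition double_six_sides :: "line set \<Rightarrow> line set \<Rightarrow> bool" where
  "double_six_sides A B \<longleftrightarrow>
     A \<union> B \<subseteq> proj_lines \<and> card (A \<union> B) = 12 \<and>
     (\<exists>a b :: nat \<Rightarrow> line.
        bij_betw a {1..6} A \<and> bij_betw b {1..6} B \<and>
        (\<forall>i\<in>{1..6}. \<forall>j\<in>{1..6}. i \<noteq> j \<longrightarrow> \<not> meets (a i) (a j) \<and> \<not> meets (b i) (b j)) \<and>
        (\<forall>i\<in>{1..6}. \<forall>j\<in>{1..6}. meets (a i) (b j) \<longleftrightarrow> i \<noteq> j))"

definition double_six :: "line set \<Rightarrow> bool" where
  "double_six D \<longleftrightarrow> (\<exists>A B. double_six_sides A B \<and> D = A \<union> B)"

end

theory Submission
  imports Defs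
begin

text \<open>
  Put \<open>s = x\<^sub>4 + x\<^sub>5\<close> and \<open>\<mu> = 1 - 3 * w\<close>.  The plane \<open>s = 0\<close> cuts \<open>X\<^sub>w\<close> in the three lines \<open>s = x\<^sub>j = 0\<close>
  (\<open>j = 1, 2, 3\<close>), since a sum of three cubes of numbers adding up to \<open>0\<close> is three times their product.
  Any other line of \<open>X\<^sub>w\<close> meets this plane in one point, which lies on one of the three lines; hence it
  lies in a plane \<open>x\<^sub>j = c * s\<close>.  In that plane the residual conic of the cubic is diagonal in \<open>s\<close>,
  \<open>x\<^sub>k - x\<^sub>i\<close>, \<open>x\<^sub>4 - x\<^sub>5\<close>, and so the remaining lines are
  \<open>x\<^sub>j = c * s\<close>, \<open>x\<^sub>4 - x\<^sub>5 = v * (x\<^sub>k - x\<^sub>i) + e * s\<close>,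
  where \<open>\<mu> * v\<^sup>2 = 1 + c\<close>, \<open>v * e = 0\<close> and \<open>c\<^sup>3 - c\<^sup>2 - c - w + \<mu> * e\<^sup>2 = 0\<close> (\<open>lines_on_surface_w\<close>).  If \<open>e \<noteq> 0\<close>
  then \<open>c = -1\<close>, which gives six lines; if \<open>e = 0\<close> then \<open>c\<close> is one of the three roots of
  \<open>c\<^sup>3 - c\<^sup>2 - c = w\<close> and \<open>v\<close> one of two square roots, which gives eighteen.
  
  So the monodromy is that of the roots of a cubic together with some square roots.  Two roots of the cubic
  collide at \<open>w = 5/27\<close>.  With \<open>w = 5/27 - d\<^sup>2\<close> the formula for the cosine of a triple angle gives all
  the roots as single-valued functions of \<open>d\<close>: they are \<open>c = 8/3 * C\<^sup>2 - 1\<close> for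
  \<open>C = cos (\<phi> + n * \<pi>/3)\<close>, \<open>n = 0, 1, -1\<close>, where \<open>sin (3 * \<phi>) = sqrt (27/32) * d\<close>.  As \<open>1 + c\<close> is then a
  square and \<open>\<mu>\<close> stays in the right half-plane, \<open>v\<close> and \<open>e\<close> are single-valued too.  The loop takes \<open>d\<close> to
  \<open>-d\<close>, hence \<open>\<phi>\<close> to \<open>-\<phi>\<close>, which exchanges \<open>n = 1\<close> with \<open>n = -1\<close> and fixes everything else
  (\<open>branch_minus_base_root\<close>, \<open>g45_eq\<close>).
  
  These formulas give 27 continuous paths of lines which are distinct at every time and exhaust the lines
  of the surface.  A continuous path of lines therefore coincides with one of them: the sets of times of
  coincidence are closed and disjoint and cover an interval (\<open>monodromy_eq\<close>).
  
  At \<open>w = 0\<close> the roots are \<open>0\<close>, \<open>\<beta>\<^sub>-\<close>, \<open>\<beta>\<^sub>+\<close> with \<open>v = \<plusminus>1, \<plusminus>\<beta>\<^sub>-, \<plusminus>\<beta>\<^sub>+\<close>, and comparison of equations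
  identifies the lines with the named ones.  Two of the twelve exchanged lines with the same \<open>j\<close> meet iff
  they have the same \<open>c\<close>; with different \<open>j\<close> they meet iff their signs differ
  (\<open>meets_swapped_line\<close>).  So the two signs are the sides of a double-six, and enough pairs of these lines
  meet to make the sides unique.  The sign of a line with \<open>c = 0\<close> is the parity of
  the permutation, and its partner with \<open>c = \<beta>\<^sub>-\<close> has the opposite sign.
\<close>


section \<open>Coordinates\<close>

lemma UNIV_5: "(UNIV :: 5 set) = {1, 2, 3, 4, 5}"
proof -
  have "card {1, 2, 3, 4, 5 :: 5} = card (UNIV :: 5 set)" by simp
  then show ?thesis by (metis card_subset_eq finite subset_UNIV)
qed

lemma cvec_eq_iff:
  "(x :: cvec) = y \<longleftrightarrow> x $ 1 = y $ 1 \<and> x $ 2 = y $ 2 \<and> x $ 3 = y $ 3 \<and> x $ 4 = y $ 4 \<and> x $ 5 = y $ 5"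
proof -
  have "(\<forall>i. P i) \<longleftrightarrow> (\<forall>i\<in>{1, 2, 3, 4, 5}. P i)" for P :: "5 \<Rightarrow> bool"
    unfolding UNIV_5[symmetric] by blast
  then show ?thesis by (simp add: vec_eq_iff)
qed

lemma sum_5: "(\<Sum>i\<in>(UNIV :: 5 set). f i) = f 1 + f 2 + f 3 + f 4 + (f 5 :: complex)"
  unfolding UNIV_5 by (simp add: add.assoc)

lemma ediff_nth: "ediff a b $ n = (if n = a then 1 else 0) - (if n = b then 1 else 0)"
  by (simp add: ediff_def axis_def)

section \<open>Lines and their frames\<close>

lemma pspan_eq: "pspan x y = {a *s x + b *s y | a b. True}"
proof -
  have "z \<in> vec.span {x, y} \<longleftrightarrow> (\<exists>a b. z = a *s x + b *s y)" for z
    by (simp add: vec.span_breakdown_eq) (metis add_diff_cancel_left' diff_add_cancel)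
  then show ?thesis by (auto simp: pspan_def)
qed

lemma framesI:
  assumes "\<And>a b. a *s x + b *s y = 0 \<Longrightarrow> a = 0 \<and> b = 0"
  shows "(x, y) \<in> frames"
proof -
  have ne: "x \<noteq> y" using assms[of 1 "-1"] by (auto simp: vec_eq_iff)
  have "y \<noteq> 0" using assms[of 0 1] by auto
  moreover have "x \<notin> vec.span {y}"
  proof
    assume "x \<in> vec.span {y}"
    then obtain k where "x = k *s y" by (auto simp: vec.span_breakdown_eq)
    then show False using assms[of 1 "-k"] by (auto simp: vec_eq_iff)
  qed
  ultimately have "vec.independent {x, y}"
    using ne by (auto simp: vec.independent_insert)
  with ne show ?thesis by (simp add: frames_def)
qed

lemma framesD:
  assumes "(x, y) \<in> frames" "a *s x + b *s y = 0"
  shows "a = 0 \<and> b = 0"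
proof -
  have ind: "vec.independent {x, y}" "x \<noteq> y" using assms by (auto simp: frames_def)
  then have x: "x \<notin> vec.span {y}" "y \<noteq> 0"
    by (auto simp: vec.independent_insert)
  have "a = 0"
  proof (rule ccontr)
    assume a: "a \<noteq> 0"
    have "x = (- b / a) *s y"
    proof -
      have "a * x $ n + b * y $ n = 0" for n
        using arg_cong[OF assms(2), of "\<lambda>v. v $ n"] by simp
      then show ?thesis using a by (simp add: vec_eq_iff field_simps add_eq_0_iff)
    qed
    then show False using x by (metis vec.span_base vec.span_scale singletonI)
  qed
  then show ?thesis using assms(2) x by (simp)
qed

lemma pspan_in_proj_lines: "(x, y) \<in> frames \<Longrightarrow> pspan x y \<in> proj_lines"
  using vec.dim_span_eq_card_independent[of "{x, y}"]
  by (auto simp: frames_def pspan_def proj_lines_def simp del: vec.dim_span)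

lemma proj_lines_frame:
  assumes "V \<in> proj_lines"
  obtains x y where "(x, y) \<in> frames" "V = pspan x y"
proof -
  obtain B where B: "B \<subseteq> V" "vec.independent B" "V \<subseteq> vec.span B" "card B = vec.dim V"
    using vec.basis_exists by blast
  then obtain x y where xy: "B = {x, y}" "x \<noteq> y"
    using assms by (auto simp: proj_lines_def card_2_iff)
  have "V = vec.span B"
    using B assms vec.span_minimal[of B V] by (auto simp: proj_lines_def)
  with that[of x y] B xy show ?thesis by (auto simp: frames_def pspan_def)
qed

lemma proj_lines_eqI:
  assumes "V \<in> proj_lines" "W \<in> proj_lines" "V \<subseteq> W"
  shows "V = W"
  using assms vec.subspace_dim_equal[of V W] by (auto simp: proj_lines_def)

lemma pspan_eqI:
  assumes "W \<in> proj_lines" "x \<in> W" "y \<in> W" "(x, y) \<in> frames"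
  shows "pspan x y = W"
proof (rule proj_lines_eqI)
  show "pspan x y \<subseteq> W"
    using assms vec.span_minimal[of "{x, y}" W] by (auto simp: pspan_def proj_lines_def)
qed (use assms pspan_in_proj_lines in auto)

lemma proj_lines_smult_add:
  assumes "V \<in> proj_lines" "x \<in> V" "y \<in> V"
  shows "a *s x + b *s y \<in> V"
  using assms by (auto simp: proj_lines_def intro: vec.subspace_add vec.subspace_scale)

section \<open>Continuous paths of lines\<close>

lemma topspace_line_topology: "topspace line_topology = proj_lines"
proof -
  have "{f \<in> frames. pspan (fst f) (snd f) \<in> proj_lines} = frames"
    using pspan_in_proj_lines by force
  then have "openin line_topology proj_lines"
    by (simp add: openin_line_topology)
  then show ?thesis
    by (metis (no_types, lifting) openin_line_topology openin_subset openin_topspace subset_antisym)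
qed

lemma continuous_map_pspan:
  assumes "continuous_on S x" "continuous_on S y" "\<And>t. t \<in> S \<Longrightarrow> (x t, y t) \<in> frames"
  shows "continuous_map (top_of_set S) line_topology (\<lambda>t. pspan (x t) (y t))"
proof -
  have 1: "continuous_map (top_of_set frames) line_topology (\<lambda>f. pspan (fst f) (snd f))"
    unfolding continuous_map topspace_line_topology
    using pspan_in_proj_lines by (auto simp: openin_line_topology)
  have 2: "continuous_map (top_of_set S) (top_of_set frames) (\<lambda>t. (x t, y t))"
    using assms by (auto intro!: continuous_intros)
  show ?thesis using continuous_map_compose[OF 2 1] by (simp add: o_def)
qed

text \<open>
  In terms of a frame \<open>(x, y)\<close>, the line hits \<open>B\<close> iff some combination \<open>a x + b y\<close> with constant
  coefficients lies in \<open>B\<close>; for each pair \<open>(a, b)\<close> this is an open condition on the frame.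
\<close>

lemma openin_lines_hitting:
  assumes "open B"
  shows "openin line_topology {V \<in> proj_lines. V \<inter> B \<noteq> {}}"
proof -
  have "{f \<in> frames. pspan (fst f) (snd f) \<in> {V \<in> proj_lines. V \<inter> B \<noteq> {}}} =
      frames \<inter> (\<Union>a. \<Union>b. (\<lambda>f. a *s fst f + b *s snd f) -` B)"
    using pspan_in_proj_lines by (fastforce simp: pspan_eq)
  moreover have cont: "continuous_on UNIV (\<lambda>f :: cvec \<times> cvec. a *s fst f + b *s snd f)" for a b
    unfolding vector_scalar_mult_def by (intro continuous_intros)
  moreover have "open ((\<lambda>f :: cvec \<times> cvec. a *s fst f + b *s snd f) -` B)" for a b
    by (intro open_vimage assms cont)
  ultimately have "openin (top_of_set frames)
      {f \<in> frames. pspan (fst f) (snd f) \<in> {V \<in> proj_lines. V \<inter> B \<noteq> {}}}"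
    by (metis (no_types, lifting) open_UN openin_open_Int)
  then show ?thesis by (simp add: openin_line_topology)
qed

text \<open>
  A vector of \<open>c t\<close> at which \<open>H t\<close> does not vanish has a neighbourhood \<open>B\<close> on which \<open>H t'\<close> has no zero
  for all \<open>t'\<close> near \<open>t\<close>, and the nearby lines \<open>c t'\<close> still hit \<open>B\<close>.  This replaces a Hausdorff property
  of the Grassmannian: it is enough for comparing a path with lines given by equations.
\<close>

lemma closedin_line_in_zero_set:
  fixes H :: "real \<Rightarrow> cvec \<Rightarrow> 'b :: {t2_space, zero}"
  assumes c: "continuous_map (top_of_set S) line_topology c"
    and H: "continuous_on (S \<times> UNIV) (\<lambda>(t, v). H t v)"
  shows "closedin (top_of_set S) {t \<in> S. \<forall>v\<in>c t. H t v = 0}"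
proof -
  have "openin (top_of_set S) {t \<in> S. \<exists>v\<in>c t. H t v \<noteq> 0}"
  proof (subst openin_subopen, clarify)
    fix t v assume t: "t \<in> S" "v \<in> c t" "H t v \<noteq> 0"
    have "openin (top_of_set (S \<times> UNIV)) ((S \<times> UNIV) \<inter> (\<lambda>(t, v). H t v) -` (- {0}))"
      using H by (rule continuous_openin_preimage_gen) auto
    then obtain G where G: "open G"
        "(S \<times> UNIV) \<inter> (\<lambda>(t, v). H t v) -` (- {0}) = (S \<times> UNIV) \<inter> G"
      by (auto simp: openin_open)
    have "(t, v) \<in> (S \<times> UNIV) \<inter> (\<lambda>(t, v). H t v) -` (- {0})" using t by simp
    then have "(t, v) \<in> G" using G(2) by blast
    then obtain A B where AB: "open A" "open B" "t \<in> A" "v \<in> B" "A \<times> B \<subseteq> G"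
      using open_prod_elim[OF G(1)] by (metis mem_Sigma_iff)
    define N where "N = S \<inter> A"
    have NB: "openin (top_of_set S) N" "open B" "t \<in> N" "v \<in> B"
        "N \<times> B \<subseteq> (S \<times> UNIV) \<inter> (\<lambda>(t, v). H t v) -` (- {0})"
      using AB t unfolding G(2) N_def by auto
    define M where "M = N \<inter> {t \<in> S. c t \<in> {V \<in> proj_lines. V \<inter> B \<noteq> {}}}"
    have "openin (top_of_set S) {t \<in> S. c t \<in> {V \<in> proj_lines. V \<inter> B \<noteq> {}}}"
      using openin_continuous_map_preimage[OF c openin_lines_hitting[OF NB(2)]] by simp
    then have "openin (top_of_set S) M"
      unfolding M_def using NB(1) by (rule openin_Int[rotated])
    moreover have "t \<in> M"
      using NB t continuous_map_image_subset_topspace[OF c]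
      by (auto simp: M_def topspace_line_topology)
    moreover have "M \<subseteq> {t \<in> S. \<exists>v\<in>c t. H t v \<noteq> 0}"
      using NB(5) by (fastforce simp: M_def)
    ultimately show "\<exists>T. openin (top_of_set S) T \<and> t \<in> T \<and> T \<subseteq> {t \<in> S. \<exists>v\<in>c t. H t v \<noteq> 0}"
      by blast
  qed
  moreover have "S - {t \<in> S. \<forall>v\<in>c t. H t v = 0} = {t \<in> S. \<exists>v\<in>c t. H t v \<noteq> 0}"
    by auto
  ultimately show ?thesis by (auto simp: closedin_def)
qed

text \<open>
  Suppose that the lines of all surfaces of a family are given by finitely many continuous paths, distinct
  at every time, each cut out by equations \<open>H\<close> that depend continuously on time.  The sets of times at
  which another path of lines agrees with each of them are closed, disjoint and cover the
  interval, so by connectedness only one of them is nonempty.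
\<close>

lemma monodromy_eq:
  fixes c :: "'i \<Rightarrow> real \<Rightarrow> line" and H :: "'i \<Rightarrow> real \<Rightarrow> cvec \<Rightarrow> 'b :: {t2_space, zero}"
  assumes "a \<le> b" "finite I"
    and lines: "\<And>t. t \<in> {a..b} \<Longrightarrow> lines_on (X t) = (\<lambda>i. c i t) ` I"
    and inj: "\<And>t. t \<in> {a..b} \<Longrightarrow> inj_on (\<lambda>i. c i t) I"
    and cont: "\<And>i. i \<in> I \<Longrightarrow> continuous_map (top_of_set {a..b}) line_topology (c i)"
    and H: "\<And>i. i \<in> I \<Longrightarrow> continuous_on ({a..b} \<times> UNIV) (\<lambda>(t, v). H i t v)"
    and cH: "\<And>i t. i \<in> I \<Longrightarrow> t \<in> {a..b} \<Longrightarrow> c i t = {v. H i t v = 0}"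
    and "k \<in> I"
  shows "monodromy X a b (c k a) = c k b"
proof -
  define p where "p = restrict (c k) {a..b}"
  have p: "line_path X a b (c k a) p"
    unfolding line_path_def
  proof (intro conjI ballI)
    show "continuous_map (top_of_set {a..b}) line_topology p"
      using cont[OF \<open>k \<in> I\<close>] by (rule continuous_map_eq) (simp add: p_def)
  qed (use lines \<open>k \<in> I\<close> \<open>a \<le> b\<close> in \<open>auto simp: p_def\<close>)
  have "q = p" if q: "line_path X a b (c k a) q" for q
  proof -
    have qc: "continuous_map (top_of_set {a..b}) line_topology q"
      and ql: "\<And>t. t \<in> {a..b} \<Longrightarrow> q t \<in> lines_on (X t)" and qa: "q a = c k a"
      and ext: "q \<in> extensional {a..b}"
      using q by (auto simp: line_path_def)
    define F where "F i = {t \<in> {a..b}. \<forall>v\<in>q t. H i t v = 0}" for i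
    have F: "t \<in> F i \<longleftrightarrow> q t = c i t" if "t \<in> {a..b}" "i \<in> I" for t i
    proof
      assume "t \<in> F i"
      then have "q t \<subseteq> c i t" using cH[OF that(2,1)] by (auto simp: F_def)
      moreover have "q t \<in> proj_lines" "c i t \<in> proj_lines"
        using ql[OF that(1)] lines[OF that(1)] that(2) by (auto simp: lines_on_def)
      ultimately show "q t = c i t" using proj_lines_eqI by blast
    qed (use cH[OF that(2,1)] that in \<open>auto simp: F_def\<close>)
    have closed: "closedin (top_of_set {a..b}) (F i)" if "i \<in> I" for i
      unfolding F_def using qc H[OF that] by (rule closedin_line_in_zero_set)
    have "closedin (top_of_set {a..b}) (\<Union>i\<in>I - {k}. F i)"
      using closed \<open>finite I\<close> by (intro closedin_Union) auto
    moreover have "{a..b} \<subseteq> F k \<union> (\<Union>i\<in>I - {k}. F i)"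
    proof
      fix t assume t: "t \<in> {a..b}"
      then obtain i where "i \<in> I" "q t = c i t" using ql lines by blast
      then show "t \<in> F k \<union> (\<Union>i\<in>I - {k}. F i)" using F t by auto
    qed
    moreover have "F k \<inter> (\<Union>i\<in>I - {k}. F i) = {}"
    proof (safe, goal_cases)
      case (1 t i)
      then have t: "t \<in> {a..b}" by (simp add: F_def)
      with 1 F \<open>k \<in> I\<close> have "c k t = c i t" by metis
      then show ?case using inj[OF t] 1 \<open>k \<in> I\<close> by (auto dest: inj_onD)
    qed
    moreover have "F k \<noteq> {}" using F[of a k] qa \<open>a \<le> b\<close> \<open>k \<in> I\<close> by auto
    ultimately have "(\<Union>i\<in>I - {k}. F i) = {}"
      using connected_Icc[of a b] closed[OF \<open>k \<in> I\<close>] unfolding connected_closedin by metis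
    then have "\<And>t. t \<in> {a..b} \<Longrightarrow> q t = c k t"
      using \<open>{a..b} \<subseteq> F k \<union> (\<Union>i\<in>I - {k}. F i)\<close> F \<open>k \<in> I\<close> by blast
    then show ?thesis
      using ext by (auto simp: p_def fun_eq_iff extensional_def restrict_def)
  qed
  with p have "(THE c'. line_path X a b (c k a) c') = p" by blast
  then show ?thesis using \<open>a \<le> b\<close> by (simp add: monodromy_def p_def)
qed

section \<open>The lines on the surfaces of the pencil\<close>

abbreviation (input) triple :: "5 \<Rightarrow> 5 \<Rightarrow> 5 \<Rightarrow> bool" where
  "triple i j k \<equiv> {i, j, k} = {1, 2, 3}"

lemma triple_cases:
  assumes "triple i j k"
  obtains "i = 1" "j = 2" "k = 3" | "i = 2" "j = 3" "k = 1" | "i = 3" "j = 1" "k = 2"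
    | "i = 3" "j = 2" "k = 1" | "i = 1" "j = 3" "k = 2" | "i = 2" "j = 1" "k = 3"
proof -
  have "card {i, j, k} = 3" unfolding assms by simp
  then have ne: "i \<noteq> j" "i \<noteq> k" "j \<noteq> k" by (auto simp: card_insert_if split: if_splits)
  have "i \<in> {1, 2, 3}" "j \<in> {1, 2, 3}" "k \<in> {1, 2, 3}" using assms by blast+
  then have "i = 1 \<or> i = 2 \<or> i = 3" "j = 1 \<or> j = 2 \<or> j = 3" "k = 1 \<or> k = 2 \<or> k = 3"
    by simp_all
  then show ?thesis using ne that by (elim disjE) simp_all
qed

lemma triple_sum:
  assumes "triple i j k"
  shows "f 1 + f 2 + f 3 = f i + f j + (f k :: complex)"
  using assms by (cases rule: triple_cases) simp_all

definition plane_line :: "5 \<Rightarrow> line" where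
  "plane_line j = {x. x $ 1 + x $ 2 + x $ 3 = 0 \<and> x $ 4 + x $ 5 = 0 \<and> x $ j = 0}"

text \<open>
  A line that crosses the plane \<open>x\<^sub>4 + x\<^sub>5 = 0\<close> in a point of \<open>plane_line j\<close>, when \<open>{i, j, k} = {1, 2, 3}\<close>.
  The two points \<open>cross_dir\<close> and \<open>cross_pt\<close> below are its intersections with \<open>x\<^sub>4 + x\<^sub>5 = 0\<close> and with
  \<open>x\<^sub>i = x\<^sub>k\<close>, so that a cross line determines its parameters.
\<close>

definition cross_line :: "5 \<Rightarrow> 5 \<Rightarrow> 5 \<Rightarrow> complex \<Rightarrow> complex \<Rightarrow> complex \<Rightarrow> line" where
  "cross_line i j k c v e = {x. x $ 1 + x $ 2 + x $ 3 + x $ 4 + x $ 5 = 0 \<and> x $ j = c * (x $ 4 + x $ 5)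
     \<and> x $ 4 - x $ 5 = v * (x $ k - x $ i) + e * (x $ 4 + x $ 5)}"

definition cross_dir :: "5 \<Rightarrow> 5 \<Rightarrow> complex \<Rightarrow> cvec" where
  "cross_dir i k v = (\<chi> n. if n = k then 1 else if n = i then - 1 else if n = 4 then v
     else if n = 5 then - v else 0)"

definition cross_pt :: "5 \<Rightarrow> complex \<Rightarrow> complex \<Rightarrow> cvec" where
  "cross_pt j c e = (\<chi> n. if n = j then c else if n = 4 then (1 + e) / 2 else if n = 5 then (1 - e) / 2
     else - (1 + c) / 2)"

lemma cross_line_swap: "cross_line i j k c v e = cross_line k j i c (- v) e"
  by (auto simp: cross_line_def algebra_simps)

lemma cross_frame:
  assumes "triple i j k"
  shows "(cross_dir i k v, cross_pt j c e) \<in> frames"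
proof (rule framesI)
  fix a b assume *: "a *s cross_dir i k v + b *s cross_pt j c e = 0"
  have h: "b = 0" if "a * v + b * ((1 + e) / 2) = 0" "b * ((1 - e) / 2) - a * v = 0"
  proof -
    have "b = (a * v + b * ((1 + e) / 2)) + (b * ((1 - e) / 2) - a * v)"
      by (simp add: field_simps)
    with that show ?thesis by simp
  qed
  from assms * h show "a = 0 \<and> b = 0"
    by (cases rule: triple_cases) (auto simp: cvec_eq_iff cross_dir_def cross_pt_def)
qed

lemma cross_dir_in: "triple i j k \<Longrightarrow> cross_dir i k v \<in> cross_line i j k c v e"
  by (erule triple_cases) (auto simp: cross_line_def cross_dir_def algebra_simps)

lemma cross_pt_in: "triple i j k \<Longrightarrow> cross_pt j c e \<in> cross_line i j k c v e"
  by (erule triple_cases) (auto simp: cross_line_def cross_pt_def field_simps)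

lemma cross_line_eq_pspan:
  assumes "triple i j k"
  shows "cross_line i j k c v e = pspan (cross_dir i k v) (cross_pt j c e)"
proof
  show "pspan (cross_dir i k v) (cross_pt j c e) \<subseteq> cross_line i j k c v e"
  proof -
    have "a *s x + b *s y \<in> cross_line i j k c v e"
      if "x \<in> cross_line i j k c v e" "y \<in> cross_line i j k c v e" for a b x y
    proof -
      have "a * (x $ 1 + x $ 2 + x $ 3 + x $ 4 + x $ 5) + b * (y $ 1 + y $ 2 + y $ 3 + y $ 4 + y $ 5) = 0"
        using that by (simp add: cross_line_def)
      moreover have "a * (x $ 4 - x $ 5) + b * (y $ 4 - y $ 5) =
          a * (v * (x $ k - x $ i) + e * (x $ 4 + x $ 5)) + b * (v * (y $ k - y $ i) + e * (y $ 4 + y $ 5))"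
        using that by (simp add: cross_line_def)
      ultimately show ?thesis using that by (simp add: cross_line_def algebra_simps)
    qed
    then show ?thesis
      using cross_dir_in[OF assms] cross_pt_in[OF assms] by (auto simp: pspan_eq)
  qed
  show "cross_line i j k c v e \<subseteq> pspan (cross_dir i k v) (cross_pt j c e)"
  proof
    fix x assume x: "x \<in> cross_line i j k c v e"
    have 2: "x $ j = c * (x $ 4 + x $ 5)" using x by (auto simp: cross_line_def)
    have "x $ i + x $ j + x $ k + x $ 4 + x $ 5 = 0"
      using x triple_sum[OF assms, of "\<lambda>n. x $ n"] unfolding cross_line_def mem_Collect_eq by metis
    with 2 have 3: "x $ k = - x $ i - (1 + c) * (x $ 4 + x $ 5)" by algebra
    define s d where "s = x $ 4 + x $ 5" and "d = x $ k - x $ i"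
    have half: "a = (s + t) / 2 \<and> b = (s - t) / 2" if "a + b = s" "a - b = t" for a b s t :: complex
      using that by auto
    have "x $ 4 - x $ 5 = v * d + e * s" using x by (simp add: cross_line_def s_def d_def)
    note h45 = half[OF s_def[symmetric] this]
    have "x $ k + x $ i = - (1 + c) * s" unfolding s_def using 3 by algebra
    note hki = half[OF this d_def[symmetric]]
    have comp: "x $ 4 = (d * v) / 2 + s * ((1 + e) / 2)" "x $ 5 = s * ((1 - e) / 2) - (d * v) / 2"
      "x $ j = s * c" "x $ k = d / 2 + s * (- 1 - c) / 2" "x $ i = - d / 2 + s * (- 1 - c) / 2"
      unfolding conjunct1[OF h45] conjunct2[OF h45] conjunct1[OF hki] conjunct2[OF hki] 2 s_def[symmetric]
      by (simp_all add: field_simps)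
    have "x = (d / 2) *s cross_dir i k v + s *s cross_pt j c e"
      using assms comp
      by (cases rule: triple_cases) (auto simp: cvec_eq_iff cross_dir_def cross_pt_def)
    then show "x \<in> pspan (cross_dir i k v) (cross_pt j c e)"
      by (auto simp: pspan_eq)
  qed
qed

lemma cross_line_in_proj_lines: "triple i j k \<Longrightarrow> cross_line i j k c v e \<in> proj_lines"
  by (simp add: cross_line_eq_pspan pspan_in_proj_lines cross_frame)

text \<open>
  The cyclic order of \<open>1, 2, 3\<close>.  Exchanging \<open>i\<close> and \<open>k\<close> in a cross line only changes the sign of \<open>v\<close>; choosing
  \<open>(i, j, k)\<close> in cyclic order makes the parameters of a line unique.
\<close>

definition prv :: "5 \<Rightarrow> 5" where
  "prv j = (if j = 1 then 3 else if j = 2 then 1 else 2)"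
definition nxt :: "5 \<Rightarrow> 5" where
  "nxt j = (if j = 1 then 2 else if j = 2 then 3 else 1)"

lemma triple_cyc: "j \<in> {1, 2, 3} \<Longrightarrow> triple (prv j) j (nxt j)"
  by (auto simp: prv_def nxt_def)

lemma plane_line_in_proj_lines:
  assumes "j \<in> {1, 2, 3}" shows "plane_line j \<in> proj_lines"
proof -
  define i k where "i = prv j" and "k = nxt j"
  have t: "triple i j k" using triple_cyc[OF assms] by (simp add: i_def k_def)
  have "(ediff k i, ediff 4 5) \<in> frames"
    using t by (intro framesI, cases rule: triple_cases) (auto simp: cvec_eq_iff ediff_nth)
  moreover have "plane_line j = pspan (ediff k i) (ediff 4 5)"
  proof -
    have "x \<in> plane_line j \<longleftrightarrow> x = x $ k *s ediff k i + x $ 4 *s ediff 4 5" for x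
      using t by (cases rule: triple_cases) (auto simp: cvec_eq_iff ediff_nth plane_line_def eq_neg_iff_add_eq_0 add.commute)
    moreover have "a *s ediff k i + b *s ediff 4 5 \<in> plane_line j" for a b
      using t by (cases rule: triple_cases) (auto simp: ediff_nth plane_line_def)
    ultimately show ?thesis unfolding pspan_eq by blast
  qed
  ultimately show ?thesis by (simp add: pspan_in_proj_lines)
qed

definition cyc_line :: "5 \<Rightarrow> complex \<Rightarrow> complex \<Rightarrow> complex \<Rightarrow> line" where
  "cyc_line j = cross_line (prv j) j (nxt j)"

text \<open>
  The point in the plane \<open>x\<^sub>4 + x\<^sub>5 = 0\<close> determines \<open>j\<close> and \<open>v\<close>, and the point with \<open>x\<^sub>i = x\<^sub>k\<close> then determines
  \<open>c\<close> and \<open>e\<close>.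
\<close>

lemma cyc_line_eq_iff:
  assumes "j \<in> {1, 2, 3}" "j' \<in> {1, 2, 3}"
  shows "cyc_line j c v e = cyc_line j' c' v' e' \<longleftrightarrow> j = j' \<and> c = c' \<and> v = v' \<and> e = e'"
proof
  assume eq: "cyc_line j c v e = cyc_line j' c' v' e'"
  have p: "cross_dir (prv j) (nxt j) v \<in> cyc_line j' c' v' e'"
    and q: "cross_pt j c e \<in> cyc_line j' c' v' e'"
    unfolding eq[symmetric] unfolding cyc_line_def
    by (rule cross_dir_in cross_pt_in, rule triple_cyc, rule assms)+
  have j: "j = j'"
    using p assms by (auto simp: cyc_line_def cross_line_def cross_dir_def prv_def nxt_def)
  have "v = v'"
    using p assms unfolding j by (auto simp: cyc_line_def cross_line_def cross_dir_def prv_def nxt_def)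
  moreover have "c = c' \<and> e = e'"
    using q assms unfolding j
    by (auto simp: cyc_line_def cross_line_def cross_pt_def prv_def nxt_def field_simps)
  ultimately show "j = j' \<and> c = c' \<and> v = v' \<and> e = e'" using j by simp
qed auto

lemma plane_line_eq_iff:
  assumes "j \<in> {1, 2, 3}" "j' \<in> {1, 2, 3}"
  shows "plane_line j = plane_line j' \<longleftrightarrow> j = j'"
proof
  assume "plane_line j = plane_line j'"
  moreover have "ediff (prv j) (nxt j) \<in> plane_line j"
    using assms(1) by (auto simp: plane_line_def ediff_nth prv_def nxt_def)
  ultimately show "j = j'"
    using assms by (auto simp: plane_line_def ediff_nth prv_def nxt_def)
qed auto

lemma cyc_line_neq_plane_line:
  assumes "j \<in> {1, 2, 3}"
  shows "cyc_line j c v e \<noteq> plane_line j'"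
proof
  assume "cyc_line j c v e = plane_line j'"
  then have "cross_pt j c e \<in> plane_line j'"
    using cross_pt_in[OF triple_cyc[OF assms]] unfolding cyc_line_def by metis
  then show False using assms by (auto simp: plane_line_def cross_pt_def add_divide_distrib[symmetric])
qed

definition cross_params :: "complex \<Rightarrow> (complex \<times> complex \<times> complex) set" where
  "cross_params w = {(c, v, e). (1 - 3 * w) * v\<^sup>2 = 1 + c \<and> v * e = 0 \<and>
     c ^ 3 - c\<^sup>2 - c - w + (1 - 3 * w) * e\<^sup>2 = 0}"

lemma mem_surface_w:
  "x \<in> surface_w w \<longleftrightarrow> x $ 1 + x $ 2 + x $ 3 + x $ 4 + x $ 5 = 0 \<and>
     x $ 1 ^ 3 + x $ 2 ^ 3 + x $ 3 ^ 3 + (1 - 3 * w) * (x $ 4 ^ 3 + x $ 5 ^ 3) = 0"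
  by (simp add: surface_w_def cubic_surface_def sum_5 algebra_simps)

lemma surface_w_0: "surface_w 0 = clebsch"
  by (auto simp: set_eq_iff mem_surface_w clebsch_def cubic_surface_def sum_5 algebra_simps)

text \<open>
  The right-hand side is, up to the factor \<open>3/4\<close>, the cubic form restricted to the line; the term in \<open>a\<^sup>3\<close> is
  absent because the point \<open>cross_dir\<close> lies on the surface.  Its three coefficients are the equations in
  \<open>cross_params\<close>.
\<close>

lemma cross_point_on_surface_iff:
  assumes "triple i j k"
  shows "a *s cross_dir i k v + b *s cross_pt j c e \<in> surface_w w \<longleftrightarrow>
    4 * a\<^sup>2 * b * ((1 - 3 * w) * v\<^sup>2 - (1 + c)) + 4 * a * b\<^sup>2 * ((1 - 3 * w) * (v * e)) +
      b ^ 3 * (c ^ 3 - c\<^sup>2 - c - w + (1 - 3 * w) * e\<^sup>2) = 0"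
    (is "?x \<in> _ \<longleftrightarrow> ?R = 0")
proof -
  have 1: "?x $ 1 + ?x $ 2 + ?x $ 3 + ?x $ 4 + ?x $ 5 = 0"
    using assms by (cases rule: triple_cases) (simp_all add: cross_dir_def cross_pt_def field_simps)
  have 2: "?x $ 1 ^ 3 + ?x $ 2 ^ 3 + ?x $ 3 ^ 3 + (1 - 3 * w) * (?x $ 4 ^ 3 + ?x $ 5 ^ 3) = 3 / 4 * ?R"
    using assms by (cases rule: triple_cases)
      (simp_all add: cross_dir_def cross_pt_def power2_eq_square power3_eq_cube field_simps)
  have "(3 / 4 :: complex) * ?R = 0 \<longleftrightarrow> ?R = 0" by (simp only: mult_eq_0_iff) simp
  then show ?thesis unfolding mem_surface_w 2 using 1 by blast
qed

lemma cross_line_subset_surface_iff: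
  assumes "triple i j k" "w \<noteq> 1 / 3"
  shows "cross_line i j k c v e \<subseteq> surface_w w \<longleftrightarrow> (c, v, e) \<in> cross_params w"
proof -
  define A B C where "A = (1 - 3 * w) * v\<^sup>2 - (1 + c)" and "B = (1 - 3 * w) * (v * e)"
    and "C = c ^ 3 - c\<^sup>2 - c - w + (1 - 3 * w) * e\<^sup>2"
  have "cross_line i j k c v e \<subseteq> surface_w w \<longleftrightarrow>
      (\<forall>a b. 4 * a\<^sup>2 * b * A + 4 * a * b\<^sup>2 * B + b ^ 3 * C = 0)"
    unfolding cross_line_eq_pspan[OF assms(1)] pspan_eq A_def B_def C_def
      cross_point_on_surface_iff[OF assms(1), symmetric] by blast
  also have "\<dots> \<longleftrightarrow> A = 0 \<and> B = 0 \<and> C = 0"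
  proof
    assume *: "\<forall>a b. 4 * a\<^sup>2 * b * A + 4 * a * b\<^sup>2 * B + b ^ 3 * C = 0"
    have C: "C = 0" using *[rule_format, of 0 1] by simp
    have "4 * (A + B) = 0" using *[rule_format, of 1 1] C by (simp add: algebra_simps)
    moreover have "4 * (A - B) = 0" using *[rule_format, of "-1" 1] C by (simp add: algebra_simps)
    ultimately have "A + B = 0" "A - B = 0" by (simp_all only: mult_eq_0_iff) simp_all
    then show "A = 0 \<and> B = 0 \<and> C = 0" using C by auto
  qed simp
  also have "\<dots> \<longleftrightarrow> (c, v, e) \<in> cross_params w"
    using assms(2) by (auto simp: A_def B_def C_def cross_params_def field_simps)
  finally show ?thesis .
qed

lemma sum_cubes_of_sum_0: "(a :: complex) + b + c = 0 \<Longrightarrow> a ^ 3 + b ^ 3 + c ^ 3 = 3 * (a * b * c)"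
  by algebra

lemma plane_line_subset_surface:
  assumes "j \<in> {1, 2, 3}"
  shows "plane_line j \<subseteq> surface_w w"
proof
  fix x assume x: "x \<in> plane_line j"
  then have "x $ 5 = - x $ 4" by (simp add: plane_line_def add_eq_0_iff)
  moreover have "x $ 1 ^ 3 + x $ 2 ^ 3 + x $ 3 ^ 3 = 3 * (x $ 1 * x $ 2 * x $ 3)"
    using x by (intro sum_cubes_of_sum_0) (simp add: plane_line_def)
  moreover have "x $ 1 * x $ 2 * x $ 3 = 0" using x assms by (auto simp: plane_line_def)
  ultimately show "x \<in> surface_w w" using x by (auto simp: mem_surface_w plane_line_def)
qed

lemma exists_point_in_plane:
  assumes "V \<in> proj_lines"
  obtains p where "p \<in> V" "p \<noteq> 0" "p $ 4 + p $ 5 = 0"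
proof -
  obtain x y where f: "(x, y) \<in> frames" "V = pspan x y" using proj_lines_frame[OF assms] .
  define p where "p = (if x $ 4 + x $ 5 = 0 then 1 *s x + 0 *s y
    else (- (y $ 4 + y $ 5) / (x $ 4 + x $ 5)) *s x + 1 *s y)"
  have "x \<in> V" "y \<in> V" by (auto simp: f(2) pspan_def intro: vec.span_base)
  then have "p \<in> V" unfolding p_def using proj_lines_smult_add[OF assms] by (simp only: split: if_split) blast
  moreover have "p \<noteq> 0"
    unfolding p_def
    using framesD[OF f(1), of 1 0] framesD[OF f(1), of "- (y $ 4 + y $ 5) / (x $ 4 + x $ 5)" 1]
    by (metis zero_neq_one)
  moreover have "p $ 4 + p $ 5 = 0"
  proof (cases "x $ 4 + x $ 5 = 0")
    case False
    define t where "t = - (y $ 4 + y $ 5) / (x $ 4 + x $ 5)"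
    have "t * (x $ 4 + x $ 5) = - (y $ 4 + y $ 5)" unfolding t_def using False by simp
    moreover have "p = t *s x + y" using False by (simp add: p_def t_def)
    ultimately show ?thesis by (simp add: algebra_simps)
  qed (simp add: p_def)
  ultimately show ?thesis using that by blast
qed

text \<open>
  In the plane \<open>x\<^sub>4 + x\<^sub>5 = 0\<close> the cubic form is \<open>3 x\<^sub>1 x\<^sub>2 x\<^sub>3\<close>.  If it vanishes on the line spanned by \<open>x\<close> and
  \<open>y\<close>, then each of the four points \<open>x, y, x + y, x - y\<close> has a vanishing coordinate among the first three, so
  some coordinate vanishes at two of them.
\<close>

lemma lines_in_plane:
  assumes V: "V \<in> proj_lines" "V \<subseteq> surface_w w" and s: "\<And>x. x \<in> V \<Longrightarrow> x $ 4 + x $ 5 = 0"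
  shows "\<exists>j\<in>{1, 2, 3}. V = plane_line j"
proof -
  obtain x y where f: "(x, y) \<in> frames" "V = pspan x y" using proj_lines_frame[OF V(1)] .
  have eq: "z $ 1 + z $ 2 + z $ 3 = 0 \<and> z $ 1 * z $ 2 * z $ 3 = 0" if "z \<in> V" for z
  proof -
    have 5: "z $ 5 = - z $ 4" using s[OF that] by (simp add: add_eq_0_iff)
    have "z \<in> surface_w w" using V that by blast
    then have 1: "z $ 1 + z $ 2 + z $ 3 = 0" "z $ 1 ^ 3 + z $ 2 ^ 3 + z $ 3 ^ 3 = 0"
      using 5 by (auto simp: mem_surface_w)
    then have "3 * (z $ 1 * z $ 2 * z $ 3) = 0" using sum_cubes_of_sum_0 by metis
    with 1 show ?thesis by simp
  qed
  have xy: "x \<in> V" "y \<in> V" by (auto simp: f(2) pspan_def intro: vec.span_base)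
  have "x $ 1 = 0 \<or> x $ 2 = 0 \<or> x $ 3 = 0" "y $ 1 = 0 \<or> y $ 2 = 0 \<or> y $ 3 = 0"
    "x $ 1 + y $ 1 = 0 \<or> x $ 2 + y $ 2 = 0 \<or> x $ 3 + y $ 3 = 0"
    "x $ 1 - y $ 1 = 0 \<or> x $ 2 - y $ 2 = 0 \<or> x $ 3 - y $ 3 = 0"
    using eq[OF xy(1)] eq[OF xy(2)] eq[OF proj_lines_smult_add[OF V(1) xy, of 1 1]]
      eq[OF proj_lines_smult_add[OF V(1) xy, of 1 "-1"]] by simp_all
  then have "(x $ 1 = 0 \<and> y $ 1 = 0) \<or> (x $ 2 = 0 \<and> y $ 2 = 0) \<or> (x $ 3 = 0 \<and> y $ 3 = 0)"
    by (elim disjE) auto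
  then obtain j where j: "j \<in> {1, 2, 3}" "x $ j = 0" "y $ j = 0" by auto
  have "V \<subseteq> plane_line j"
    using eq s j unfolding plane_line_def by (auto simp: f(2) pspan_eq)
  then show ?thesis using proj_lines_eqI[OF V(1) plane_line_in_proj_lines] j by blast
qed

text \<open>
  The classification.  A line \<open>V\<close> outside the plane \<open>x\<^sub>4 + x\<^sub>5 = 0\<close> meets it in a point \<open>p0\<close> of some \<open>plane_line j\<close>.
  Its coordinate \<open>k\<close> does not vanish: at the point with \<open>x\<^sub>1 = x\<^sub>2 = x\<^sub>3 = 0\<close> common to the three lines, the
  tangent plane of the surface is \<open>x\<^sub>4 + x\<^sub>5 = 0\<close>.  So \<open>p0\<close> can be scaled to \<open>cross_dir\<close>, and a
  second point of \<open>V\<close>, corrected by a multiple of \<open>p0\<close>, becomes \<open>cross_pt\<close>.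
\<close>

lemma lines_on_surface_w:
  assumes w: "w \<noteq> 1 / 3"
  shows "lines_on (surface_w w) =
    plane_line ` {1, 2, 3} \<union> (\<lambda>(j, c, v, e). cyc_line j c v e) ` ({1, 2, 3} \<times> cross_params w)"
    (is "_ = ?A \<union> ?B")
proof
  show "?A \<union> ?B \<subseteq> lines_on (surface_w w)"
  proof (rule Un_least; rule subsetI)
    fix V assume "V \<in> ?A"
    then show "V \<in> lines_on (surface_w w)"
      using plane_line_subset_surface plane_line_in_proj_lines by (auto simp only: lines_on_def)
  next
    fix V assume "V \<in> ?B"
    then obtain j c v e where *: "V = cyc_line j c v e" "j \<in> {1, 2, 3}" "(c, v, e) \<in> cross_params w"
      by force
    then show "V \<in> lines_on (surface_w w)"
      using cross_line_subset_surface_iff[OF triple_cyc w] cross_line_in_proj_lines[OF triple_cyc]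
      by (simp only: lines_on_def cyc_line_def mem_Collect_eq)
  qed
  show "lines_on (surface_w w) \<subseteq> ?A \<union> ?B"
  proof
    fix V assume V: "V \<in> lines_on (surface_w w)"
    then have pV: "V \<in> proj_lines" and VX: "V \<subseteq> surface_w w" by (auto simp: lines_on_def)
    show "V \<in> ?A \<union> ?B"
    proof (cases "\<forall>x\<in>V. x $ 4 + x $ 5 = 0")
      case True
      then show ?thesis using lines_in_plane[OF pV VX] by blast
    next
      case False
      then obtain q0 where q0: "q0 \<in> V" "q0 $ 4 + q0 $ 5 \<noteq> 0" by blast
      obtain p0 where p0: "p0 \<in> V" "p0 \<noteq> 0" "p0 $ 4 + p0 $ 5 = 0"
        using exists_point_in_plane[OF pV] .
      have X: "x $ 1 + x $ 2 + x $ 3 + x $ 4 + x $ 5 = 0"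
          "x $ 1 ^ 3 + x $ 2 ^ 3 + x $ 3 ^ 3 + (1 - 3 * w) * (x $ 4 ^ 3 + x $ 5 ^ 3) = 0"
        if "x \<in> V" for x
        using VX that by (auto simp: mem_surface_w)
      have p5: "p0 $ 5 = - p0 $ 4" using p0(3) by (simp add: add_eq_0_iff)
      have s0: "p0 $ 1 + p0 $ 2 + p0 $ 3 = 0" "p0 $ 1 ^ 3 + p0 $ 2 ^ 3 + p0 $ 3 ^ 3 = 0"
        using X[OF p0(1)] p5 by (auto simp: add.assoc)
      then have "3 * (p0 $ 1 * p0 $ 2 * p0 $ 3) = 0" using sum_cubes_of_sum_0 by metis
      then obtain j where j: "j \<in> {1, 2, 3}" "p0 $ j = 0" by auto
      define i k where "i = prv j" and "k = nxt j"
      have t: "triple i j k" using triple_cyc[OF j(1)] by (simp add: i_def k_def)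
      have pi: "p0 $ i = - p0 $ k"
        using t s0(1) j(2) by (cases rule: triple_cases) (simp_all add: eq_neg_iff_add_eq_0 add.commute)
      have pk: "p0 $ k \<noteq> 0"
      proof
        assume k0: "p0 $ k = 0"
        \<comment> \<open>The cubic form on \<open>q0 + m * p0\<close>; its second difference isolates the coefficient of \<open>m\<^sup>2\<close>.\<close>
        define f where "f m = (q0 $ 1 ^ 3 + q0 $ 2 ^ 3 + q0 $ 3 ^ 3) +
          (1 - 3 * w) * ((q0 $ 4 + m * p0 $ 4) ^ 3 + (q0 $ 5 - m * p0 $ 4) ^ 3)" for m
        have "f m = 0" for m
        proof -
          have "p0 $ 1 = 0" "p0 $ 2 = 0" "p0 $ 3 = 0"
            using t k0 pi j(2) by (cases rule: triple_cases, simp_all)+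
          then show ?thesis
            using X(2)[OF proj_lines_smult_add[OF pV q0(1) p0(1), of 1 m]] p5 by (simp add: f_def)
        qed
        then have "f 1 + f (- 1) - 2 * f 0 = 0" by simp
        moreover have "f 1 + f (- 1) - 2 * f 0 = 6 * (1 - 3 * w) * (p0 $ 4)\<^sup>2 * (q0 $ 4 + q0 $ 5)"
          by (simp add: f_def power2_eq_square power3_eq_cube algebra_simps)
        moreover have "1 - 3 * w \<noteq> 0" using w by (auto simp: field_simps)
        ultimately have "p0 $ 4 = 0" using q0(2) by (simp only: mult_eq_0_iff) simp
        then have "p0 = 0"
          using k0 pi j(2) p5 by - (rule triple_cases[OF t], simp_all add: cvec_eq_iff)
        with p0(2) show False by simp
      qed
      \<comment> \<open>Scaled so that coordinate \<open>k\<close> of \<open>p0\<close> and \<open>x\<^sub>4 + x\<^sub>5\<close> of \<open>q\<close> become \<open>1\<close>; the multiple of \<open>p0\<close> makes \<open>q $ i = q $ k\<close>.\<close>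
      define v where "v = p0 $ 4 / p0 $ k"
      define s where "s = q0 $ 4 + q0 $ 5"
      define d where "d = (q0 $ k - q0 $ i) / 2"
      define q where "q = (1 / s) *s q0 + (- d / (s * p0 $ k)) *s p0"
      define c e where "c = q $ j" and "e = q $ 4 - q $ 5"
      have qV: "q \<in> V" unfolding q_def by (rule proj_lines_smult_add[OF pV q0(1) p0(1)])
      have p: "cross_dir i k v = (1 / p0 $ k) *s p0 + 0 *s p0"
        using t j(2) pi p5 pk
        by (cases rule: triple_cases) (simp_all add: cvec_eq_iff cross_dir_def v_def)
      then have pV': "cross_dir i k v \<in> V"
        using proj_lines_smult_add[OF pV p0(1) p0(1)] by metis
      have q45: "q $ 4 + q $ 5 = 1"
      proof -
        have "q $ 4 + q $ 5 = (q0 $ 4 + q0 $ 5) / s - d / (s * p0 $ k) * (p0 $ 4 + p0 $ 5)"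
          by (simp add: q_def algebra_simps add_divide_distrib)
        then show ?thesis using p0(3) q0(2) by (simp add: s_def)
      qed
      have qik: "q $ i = q $ k"
        using pk q0(2) by (simp add: q_def pi d_def s_def[symmetric] field_simps)
      have "q $ i + q $ j + q $ k + (q $ 4 + q $ 5) = 0"
        using X(1)[OF qV] triple_sum[OF t, of "\<lambda>n. q $ n"] by algebra
      then have "q $ k = - (1 + c) / 2"
        unfolding q45 qik c_def[symmetric] by (simp add: field_simps) algebra
      moreover have "q $ 4 = (1 + e) / 2" "q $ 5 = (1 - e) / 2"
        using q45 unfolding e_def by algebra+
      ultimately have q': "q = cross_pt j c e"
        using qik c_def by - (rule triple_cases[OF t], simp_all add: cvec_eq_iff cross_pt_def)
      have eq: "cyc_line j c v e = V"
        unfolding cyc_line_def i_def[symmetric] k_def[symmetric] cross_line_eq_pspan[OF t]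
        using pspan_eqI[OF pV pV' qV] cross_frame[OF t] q' by simp
      then have "(c, v, e) \<in> cross_params w"
        using cross_line_subset_surface_iff[OF t w, of c v e] VX by (simp add: cyc_line_def i_def k_def)
      then show ?thesis using eq j(1) by force
    qed
  qed
qed

section \<open>Following the roots of the cubic\<close>

text \<open>
  The constant for which \<open>c = 8/3 * cos\<^sup>2 \<phi> - 1\<close> and \<open>sin (3 * \<phi>) = kappa * d\<close> imply
  \<open>c\<^sup>3 - c\<^sup>2 - c = 5/27 - d\<^sup>2\<close>.
\<close>

definition kappa :: real where "kappa = sqrt (27 / 32)"

definition cosroot :: "int \<Rightarrow> complex \<Rightarrow> complex" where
  "cosroot n d = cos (Arcsin (of_real kappa * d) / 3 + of_int n * of_real (pi / 3))"

text \<open>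
  The eight solutions of the equations \<open>cross_params (5/27 - d\<^sup>2)\<close>, as functions of \<open>d\<close>.  The first index is
  the root of the cubic, where the value \<open>2\<close> stands for the solutions with \<open>c = -1\<close>, and the second is the sign of
  the square root.
\<close>

definition branch :: "complex \<Rightarrow> int \<times> complex \<Rightarrow> complex \<times> complex \<times> complex" where
  "branch d = (\<lambda>(n, s). if n = 2 then (- 1, 0, s * csqrt (1 + (5 / 27 - d\<^sup>2)) / csqrt (1 - 3 * (5 / 27 - d\<^sup>2)))
     else (8 / 3 * (cosroot n d)\<^sup>2 - 1,
           s * (of_real (sqrt (8 / 3)) * cosroot n d) / csqrt (1 - 3 * (5 / 27 - d\<^sup>2)), 0))"

definition branch_indices :: "(int \<times> complex) set" where
  "branch_indices = {0, 1, - 1, 2} \<times> {1, - 1}"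

text \<open>
  On this set the functions \<open>branch\<close> are continuous and have distinct values.  The three conditions say
  that \<open>w = 5/27 - d\<^sup>2\<close> is not the critical value, that \<open>Arcsin\<close> is applied inside the unit disc (and \<open>w \<noteq> -1\<close>),
  and that \<open>1 - 3 * w\<close> has positive real part.
\<close>

definition admissible :: "complex set" where
  "admissible = {d. d \<noteq> 0 \<and> (norm d)\<^sup>2 \<le> 5 / 27 \<and> Re (5 / 27 - d\<^sup>2) < 1 / 3}"

lemma sin_treble: "sin (3 * x) = 3 * sin x - 4 * sin x ^ 3" for x :: complex
proof -
  have "sin (3 * x) = sin (2 * x + x)" by simp
  also have "\<dots> = 2 * sin x * (cos x)\<^sup>2 + (1 - 2 * (sin x)\<^sup>2) * sin x"
    by (simp only: sin_add sin_double cos_double_sin) (simp add: power2_eq_square)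
  also have "\<dots> = 3 * sin x - 4 * sin x ^ 3"
    using cos_squared_eq[of x] by algebra
  finally show ?thesis .
qed

lemma kappa_sq: "(of_real kappa :: complex)\<^sup>2 = 27 / 32"
proof -
  have "(of_real kappa :: complex)\<^sup>2 = of_real (kappa\<^sup>2)" by simp
  also have "kappa\<^sup>2 = 27 / 32" by (simp add: kappa_def)
  finally show ?thesis by simp
qed

lemma admissibleD:
  assumes "d \<in> admissible"
  defines "w \<equiv> 5 / 27 - d\<^sup>2"
  shows "d \<noteq> 0" "norm (of_real kappa * d) < 1" "0 < Re (1 - 3 * w)" "0 < Re (1 + w)"
    "w \<noteq> 1 / 3" "1 - 3 * w \<noteq> 0" "1 + w \<noteq> 0"
proof -
  have n: "d \<noteq> 0" "(norm d)\<^sup>2 \<le> 5 / 27" and r: "Re w < 1 / 3" using assms by (auto simp: admissible_def)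
  show "d \<noteq> 0" by fact
  have "(norm (of_real kappa * d))\<^sup>2 = 27 / 32 * (norm d)\<^sup>2"
    by (simp add: norm_mult power_mult_distrib kappa_def)
  then have "(norm (of_real kappa * d))\<^sup>2 < 1\<^sup>2" using n(2) by simp
  then show "norm (of_real kappa * d) < 1" by (rule power2_less_imp_less) simp
  show 1: "0 < Re (1 - 3 * w)" using r by simp
  have "Re (d\<^sup>2) \<le> (norm d)\<^sup>2" using complex_Re_le_cmod[of "d\<^sup>2"] by (simp add: norm_power)
  then show 2: "0 < Re (1 + w)" using n(2) by (simp add: w_def)
  show 3: "1 - 3 * w \<noteq> 0" "1 + w \<noteq> 0" using 1 2 by (metis less_irrefl zero_complex.sel(1))+
  show "w \<noteq> 1 / 3" using 3(1) by fastforce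
qed

text \<open>
  The three numbers \<open>cosroot n d\<close> in terms of \<open>x = cos \<phi>\<close>, \<open>y = sin \<phi>\<close> and \<open>\<sigma> = sqrt 3\<close>.  All that is needed about them
  then follows from polynomial identities modulo \<open>x\<^sup>2 + y\<^sup>2 = 1\<close>, \<open>\<sigma>\<^sup>2 = 3\<close>; here \<open>S = sin (3 * \<phi>)\<close>.
\<close>

lemma cosroot_coords:
  assumes "d \<in> admissible"
  obtains x y \<sigma> S :: complex where "x\<^sup>2 + y\<^sup>2 = 1" "\<sigma>\<^sup>2 = 3" "S = 3 * y - 4 * y ^ 3" "S\<^sup>2 = 27 / 32 * d\<^sup>2"
    "S \<noteq> 0" "S\<^sup>2 \<noteq> 1" "cosroot 0 d = x" "cosroot 1 d = (x - \<sigma> * y) / 2" "cosroot (- 1) d = (x + \<sigma> * y) / 2"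
proof -
  define \<phi> where "\<phi> = Arcsin (of_real kappa * d) / 3"
  define S where "S = of_real kappa * d"
  have c: "cos (of_real (pi / 3)) = (1 / 2 :: complex)" "sin (of_real (pi / 3)) = (of_real (sqrt 3) / 2 :: complex)"
    unfolding cos_of_real sin_of_real cos_60 sin_60 by simp_all
  show ?thesis
  proof (rule that[of "cos \<phi>" "sin \<phi>" "of_real (sqrt 3)" S])
    show "(cos \<phi>)\<^sup>2 + (sin \<phi>)\<^sup>2 = 1" by (simp add: sin_cos_squared_add3[symmetric] power2_eq_square)
    show "(of_real (sqrt 3) :: complex)\<^sup>2 = 3" by (simp flip: of_real_power)
    show "S = 3 * sin \<phi> - 4 * sin \<phi> ^ 3"
      unfolding sin_treble[symmetric] by (simp add: \<phi>_def S_def)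
    show "S\<^sup>2 = 27 / 32 * d\<^sup>2" by (simp only: S_def power_mult_distrib kappa_sq)
    show "S \<noteq> 0" using admissibleD(1)[OF assms] by (simp add: S_def kappa_def)
    have "norm (S\<^sup>2) < 1" using admissibleD(2)[OF assms] by (simp add: S_def norm_power abs_square_less_1)
    then show "S\<^sup>2 \<noteq> 1" by auto
    show "cosroot 0 d = cos \<phi>" by (simp add: cosroot_def \<phi>_def)
    show "cosroot 1 d = (cos \<phi> - of_real (sqrt 3) * sin \<phi>) / 2"
      unfolding cosroot_def \<phi>_def[symmetric] by (simp only: of_int_1 mult_1 cos_add c) (simp add: field_simps)
    show "cosroot (- 1) d = (cos \<phi> + of_real (sqrt 3) * sin \<phi>) / 2"
      unfolding cosroot_def \<phi>_def[symmetric]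
      by (simp only: of_int_minus of_int_1 mult_1 mult_minus_left cos_add cos_minus sin_minus c) (simp add: field_simps)
  qed
qed

text \<open>
  Since \<open>cos\<^sup>2 (3 * \<psi>) = z * (4 * z - 3)\<^sup>2\<close> for \<open>z = cos\<^sup>2 \<psi>\<close>, and the angles \<open>\<psi> = \<phi> + n * \<pi>/3\<close> all have the same
  \<open>cos\<^sup>2 (3 * \<psi>) = 1 - S\<^sup>2\<close>, the squares of the three cosines are the roots of the cubic on the right.
\<close>

lemma cosroot_factorization:
  assumes "d \<in> admissible"
  shows "16 * ((z - (cosroot 0 d)\<^sup>2) * (z - (cosroot 1 d)\<^sup>2) * (z - (cosroot (- 1) d)\<^sup>2)) =
    z * (4 * z - 3)\<^sup>2 - (1 - 27 / 32 * d\<^sup>2)"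
proof -
  obtain x y \<sigma> S where *: "x\<^sup>2 + y\<^sup>2 = 1" "\<sigma>\<^sup>2 = 3" "S = 3 * y - 4 * y ^ 3" "S\<^sup>2 = 27 / 32 * d\<^sup>2"
    and c: "cosroot 0 d = x" "cosroot 1 d = (x - \<sigma> * y) / 2" "cosroot (- 1) d = (x + \<sigma> * y) / 2"
    using cosroot_coords[OF assms] by metis
  have "16 * ((z - x\<^sup>2) * (z - ((x - \<sigma> * y) / 2)\<^sup>2) * (z - ((x + \<sigma> * y) / 2)\<^sup>2)) =
      (z - x\<^sup>2) * (4 * z - (x - \<sigma> * y)\<^sup>2) * (4 * z - (x + \<sigma> * y)\<^sup>2)"
    by (simp add: power_divide field_simps)
  also have "\<dots> = z * (4 * z - 3)\<^sup>2 - (1 - S\<^sup>2)" using *(1-3) by algebra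
  finally show ?thesis unfolding c *(4) .
qed

lemma cosroot_nonzero:
  assumes "d \<in> admissible" "n \<in> {0, 1, - 1}"
  shows "cosroot n d \<noteq> 0"
proof
  assume "cosroot n d = 0"
  then have "1 - 27 / 32 * d\<^sup>2 = 0"
    using cosroot_factorization[OF assms(1), of 0] assms(2) by auto
  moreover obtain S where "S\<^sup>2 = 27 / 32 * d\<^sup>2" "S\<^sup>2 \<noteq> 1" using cosroot_coords[OF assms(1)] by metis
  ultimately show False by simp
qed

text \<open>
  A coincidence of two of the squares forces \<open>S = 0\<close> or \<open>S\<^sup>2 = 1\<close>.  The comparison with \<open>n = 0\<close> is done for both
  signs of \<open>n\<close> at once, with \<open>\<tau> = \<plusminus>\<sigma>\<close>.
\<close>

lemma cosroot_sq_inj: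
  assumes "d \<in> admissible"
  shows "inj_on (\<lambda>n. (cosroot n d)\<^sup>2) {0, 1, - 1}"
proof -
  obtain x y \<sigma> S where *: "x\<^sup>2 + y\<^sup>2 = 1" "\<sigma>\<^sup>2 = 3" "S = 3 * y - 4 * y ^ 3" "S \<noteq> 0" "S\<^sup>2 \<noteq> 1"
    and c: "cosroot 0 d = x" "cosroot 1 d = (x - \<sigma> * y) / 2" "cosroot (- 1) d = (x + \<sigma> * y) / 2"
    using cosroot_coords[OF assms] by metis
  have \<sigma>0: "\<sigma> \<noteq> 0" using *(2) by auto
  have x0: "x * y \<noteq> 0"
  proof
    assume "x * y = 0"
    then have "S * (1 - S\<^sup>2) = 0" using *(1,3) by algebra
    then show False using *(4,5) by simp
  qed
  have pm: "x\<^sup>2 \<noteq> ((x - \<tau> * y) / 2)\<^sup>2" if \<tau>: "\<tau>\<^sup>2 = 3" for \<tau>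
  proof
    assume "x\<^sup>2 = ((x - \<tau> * y) / 2)\<^sup>2"
    then have "4 * x\<^sup>2 = (x - \<tau> * y)\<^sup>2" by (simp add: power_divide mult.commute)
    \<comment> \<open>The difference of the squares factors, because \<open>\<tau>\<^sup>2 = 3\<close>.\<close>
    then have "\<tau> * ((\<tau> * x - y) * (x + \<tau> * y)) = 0" using \<tau> by algebra
    moreover have "\<tau> \<noteq> 0" using \<tau> by auto
    ultimately have "\<tau> * x = y \<or> x = - \<tau> * y" by (auto simp: eq_neg_iff_add_eq_0)
    then show False
    proof
      assume h: "\<tau> * x = y"
      then have "y\<^sup>2 = 3 * x\<^sup>2" using \<tau> by (auto simp: power_mult_distrib)
      then have "4 * y\<^sup>2 = 3" using *(1) by algebra
      moreover have "S = y * (3 - 4 * y\<^sup>2)" using *(3) by algebra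
      ultimately have "S = 0" by simp
      then show False using *(4) by simp
    next
      assume "x = - \<tau> * y"
      then have "S\<^sup>2 = 1" using *(1,3) \<tau> by algebra
      then show False using *(5) by simp
    qed
  qed
  have 1: "x\<^sup>2 \<noteq> ((x - \<sigma> * y) / 2)\<^sup>2" using pm[of \<sigma>] *(2) by simp
  have 2: "x\<^sup>2 \<noteq> ((x + \<sigma> * y) / 2)\<^sup>2" using pm[of "- \<sigma>"] *(2) by simp
  have 3: "((x - \<sigma> * y) / 2)\<^sup>2 \<noteq> ((x + \<sigma> * y) / 2)\<^sup>2"
  proof
    assume "((x - \<sigma> * y) / 2)\<^sup>2 = ((x + \<sigma> * y) / 2)\<^sup>2"
    then have "(x - \<sigma> * y)\<^sup>2 = (x + \<sigma> * y)\<^sup>2" by (simp add: power_divide)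
    then have "4 * \<sigma> * (x * y) = 0" by algebra
    then show False using x0 \<sigma>0 by simp
  qed
  show ?thesis unfolding inj_on_def using 1 2 3 by (auto simp: c dest: sym)
qed

lemma square_eq_signs: "a\<^sup>2 = b\<^sup>2 \<longleftrightarrow> (\<exists>s\<in>{1, - 1}. a = s * (b :: complex))"
  by (auto simp: power2_eq_iff)

text \<open>
  If \<open>v = 0\<close> then \<open>c = -1\<close> and \<open>e\<close> is a square root of \<open>(1 + w) / (1 - 3 * w)\<close>.  Otherwise \<open>e = 0\<close>, \<open>c\<close> is a root of
  the cubic, and \<open>v\<close> is a square root of \<open>(1 + c) / (1 - 3 * w)\<close>, where \<open>1 + c\<close> is the square of a multiple of \<open>cosroot\<close>.
\<close>

lemma cross_params_eq_branches:
  assumes "d \<in> admissible"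
  shows "cross_params (5 / 27 - d\<^sup>2) = branch d ` branch_indices"
proof -
  define w where "w = 5 / 27 - d\<^sup>2"
  define m where "m = csqrt (1 - 3 * w)"
  define q :: complex where "q = of_real (sqrt (8 / 3))"
  have m: "m\<^sup>2 = 1 - 3 * w" "m \<noteq> 0" using admissibleD(6)[OF assms] by (auto simp: m_def w_def)
  have q: "q\<^sup>2 = 8 / 3" "q \<noteq> 0" by (auto simp: q_def simp flip: of_real_power)
  have br: "branch d (n, s) = (if n = 2 then (- 1, 0, s * csqrt (1 + w) / m)
      else (8 / 3 * (cosroot n d)\<^sup>2 - 1, s * (q * cosroot n d) / m, 0))" for n s
    by (simp add: branch_def w_def m_def q_def)
  have cub: "c ^ 3 - c\<^sup>2 - c - w = 0 \<longleftrightarrow> (\<exists>n\<in>{0, 1, - 1}. c = 8 / 3 * (cosroot n d)\<^sup>2 - 1)" for c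
  proof -
    \<comment> \<open>The value of \<open>cos\<^sup>2\<close> that belongs to the root \<open>c\<close>.\<close>
    define z where "z = 3 / 8 * (c + 1)"
    have cz: "c = 8 / 3 * z - 1" by (simp add: z_def distrib_left)
    have "c ^ 3 - c\<^sup>2 - c - w = 32 / 27 * (z * (4 * z - 3)\<^sup>2 - (1 - 27 / 32 * d\<^sup>2))"
      unfolding cz w_def by (simp add: field_simps power2_eq_square power3_eq_cube)
    also have "\<dots> = 32 / 27 * (16 * ((z - (cosroot 0 d)\<^sup>2) * (z - (cosroot 1 d)\<^sup>2) * (z - (cosroot (- 1) d)\<^sup>2)))"
      by (simp only: cosroot_factorization[OF assms])
    also have "\<dots> = 0 \<longleftrightarrow> (\<exists>n\<in>{0, 1, - 1}. z = (cosroot n d)\<^sup>2)" by auto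
    also have "\<dots> \<longleftrightarrow> (\<exists>n\<in>{0, 1, - 1}. c = 8 / 3 * (cosroot n d)\<^sup>2 - 1)" unfolding cz by auto
    finally show ?thesis .
  qed
  have "(c, v, e) \<in> cross_params w \<longleftrightarrow> (c, v, e) \<in> branch d ` branch_indices" for c v e
  proof (cases "v = 0")
    case True
    have "(c, v, e) \<in> cross_params w \<longleftrightarrow> c = - 1 \<and> (m * e)\<^sup>2 = (csqrt (1 + w))\<^sup>2"
      unfolding cross_params_def m(1)[symmetric] using True
      by (auto simp: power_mult_distrib add_eq_0_iff algebra_simps)
    also have "\<dots> \<longleftrightarrow> c = - 1 \<and> (\<exists>s\<in>{1, - 1}. e = s * csqrt (1 + w) / m)"
      unfolding square_eq_signs using m(2) by (auto simp: field_simps)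
    also have "\<dots> \<longleftrightarrow> (c, v, e) \<in> branch d ` branch_indices"
    proof
      assume "c = - 1 \<and> (\<exists>s\<in>{1, - 1}. e = s * csqrt (1 + w) / m)"
      then obtain s where s: "s \<in> {1, - 1}" "c = - 1" "e = s * csqrt (1 + w) / m" by blast
      then have "(c, v, e) = branch d (2, s)" using True by (simp add: br)
      moreover have "(2, s) \<in> branch_indices" using s(1) by (simp add: branch_indices_def)
      ultimately show "(c, v, e) \<in> branch d ` branch_indices" by blast
    next
      assume "(c, v, e) \<in> branch d ` branch_indices"
      then obtain n s where ns: "n \<in> {0, 1, - 1, 2}" "s \<in> {1, - 1}" "(c, v, e) = branch d (n, s)"
        unfolding branch_indices_def by blast
      have "n = 2"
      proof (rule ccontr)
        assume "n \<noteq> 2"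
        then have "cosroot n d \<noteq> 0" "v = s * (q * cosroot n d) / m"
          using cosroot_nonzero[OF assms, of n] ns by (auto simp: br)
        then show False using True m(2) q(2) ns(2) by auto
      qed
      then show "c = - 1 \<and> (\<exists>s\<in>{1, - 1}. e = s * csqrt (1 + w) / m)"
        using ns(2,3) by (auto simp: br)
    qed
    finally show ?thesis .
  next
    case False
    have "(c, v, e) \<in> cross_params w \<longleftrightarrow> e = 0 \<and> c ^ 3 - c\<^sup>2 - c - w = 0 \<and> m\<^sup>2 * v\<^sup>2 = 1 + c"
      unfolding cross_params_def m(1)[symmetric] using False by auto
    also have "\<dots> \<longleftrightarrow> (\<exists>n\<in>{0, 1, - 1}. e = 0 \<and> c = 8 / 3 * (cosroot n d)\<^sup>2 - 1 \<and> m\<^sup>2 * v\<^sup>2 = 1 + c)"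
      unfolding cub by blast
    also have "\<dots> \<longleftrightarrow> (\<exists>n\<in>{0, 1, - 1}. e = 0 \<and> c = 8 / 3 * (cosroot n d)\<^sup>2 - 1 \<and> (m * v)\<^sup>2 = (q * cosroot n d)\<^sup>2)"
      by (auto simp: power_mult_distrib q(1))
    also have "\<dots> \<longleftrightarrow> (\<exists>n\<in>{0, 1, - 1}. \<exists>s\<in>{1, - 1}. (c, v, e) = branch d (n, s))"
      unfolding square_eq_signs using m(2) by (auto simp: br field_simps)
    also have "\<dots> \<longleftrightarrow> (c, v, e) \<in> branch d ` branch_indices"
      unfolding branch_indices_def image_iff using False by (auto simp: br)
    finally show ?thesis .
  qed
  then show ?thesis unfolding w_def by auto
qed

lemma branch_inj:
  assumes "d \<in> admissible"
  shows "inj_on (branch d) branch_indices"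
proof (rule inj_onI)
  fix a b assume ab: "a \<in> branch_indices" "b \<in> branch_indices" "branch d a = branch d b"
  obtain n s n' s' where [simp]: "a = (n, s)" "b = (n', s')" by (cases a, cases b)
  have n: "n \<in> {0, 1, - 1, 2}" "n' \<in> {0, 1, - 1, 2}" using ab by (auto simp: branch_indices_def)
  have nz: "csqrt (1 + (5 / 27 - d\<^sup>2)) \<noteq> 0" "csqrt (1 - 3 * (5 / 27 - d\<^sup>2)) \<noteq> 0"
    using admissibleD[OF assms] by simp_all
  have c: "cosroot k d \<noteq> 0" if "k \<in> {0, 1, - 1, 2}" "k \<noteq> 2" for k
    using cosroot_nonzero[OF assms] that by auto
  show "a = b"
  proof (cases "n = 2 \<or> n' = 2")
    case True
    then show ?thesis using ab(3) nz c n by (auto simp: branch_def split: if_splits)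
  next
    case False
    then have "n = n'" using ab(3) n by (auto simp: branch_def dest: inj_onD[OF cosroot_sq_inj[OF assms]])
    then show ?thesis using False ab(3) nz c n by (auto simp: branch_def)
  qed
qed

lemma continuous_on_branch:
  "continuous_on admissible (\<lambda>d. branch d a)"
proof -
  obtain n s where [simp]: "a = (n, s)" by (cases a)
  have sq: "continuous_on admissible (\<lambda>d. csqrt (f d))"
    if "continuous_on admissible f" "\<And>d. d \<in> admissible \<Longrightarrow> 0 < Re (f d)" for f
    by (rule continuous_on_compose2[OF continuous_on_csqrt that(1)])
      (use that(2) in \<open>force simp: complex_nonpos_Reals_iff\<close>)
  have "continuous_on admissible (\<lambda>d. csqrt (1 + (5 / 27 - d\<^sup>2)))" "continuous_on admissible (\<lambda>d. csqrt (1 - 3 * (5 / 27 - d\<^sup>2)))"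
    by (intro sq continuous_intros; use admissibleD in blast)+
  moreover have "continuous_on admissible (cosroot k)" for k
  proof -
    have A: "continuous_on {z. norm z < 1} Arcsin"
    proof (rule continuous_on_Arcsin)
      show "\<bar>Re z\<bar> < 1" if "z \<in> {z. norm z < 1}" for z
        using that abs_Re_le_cmod[of z] by simp
    qed
    have "continuous_on admissible (\<lambda>d. Arcsin (of_real kappa * d))"
      by (rule continuous_on_compose2[OF A]) (use admissibleD in \<open>auto intro!: continuous_intros\<close>)
    then show ?thesis unfolding cosroot_def by (intro continuous_intros) auto
  qed
  ultimately show ?thesis
    using admissibleD by (cases "n = 2") (auto simp: branch_def intro!: continuous_intros)
qed

definition branch_line :: "5 \<Rightarrow> complex \<times> complex \<times> complex \<Rightarrow> line" where
  "branch_line j = (\<lambda>(c, v, e). cyc_line j c v e)"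

text \<open>
  Every line is followed by keeping its branch.  The index \<open>None\<close> stands for the lines that do not move.
\<close>

lemma monodromy_along_branches:
  fixes \<delta> :: "real \<Rightarrow> complex"
  assumes "a \<le> b" and \<delta>: "continuous_on {a..b} \<delta>" "\<And>t. t \<in> {a..b} \<Longrightarrow> \<delta> t \<in> admissible"
    and X: "\<And>t. t \<in> {a..b} \<Longrightarrow> X t = surface_w (5 / 27 - (\<delta> t)\<^sup>2)"
    and j: "j \<in> {1, 2, 3}"
  shows "monodromy X a b (plane_line j) = plane_line j"
    and "i \<in> branch_indices \<Longrightarrow> monodromy X a b (branch_line j (branch (\<delta> a) i)) = branch_line j (branch (\<delta> b) i)"
proof -
  define I where "I = {1, 2, 3 :: 5} \<times> (insert None (Some ` branch_indices))"
  define c where "c = (\<lambda>(j, i) t. case i of None \<Rightarrow> plane_line j | Some i \<Rightarrow> branch_line j (branch (\<delta> t) i))"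
  define H :: "5 \<times> (int \<times> complex) option \<Rightarrow> real \<Rightarrow> cvec \<Rightarrow> complex \<times> complex \<times> complex"
    where "H = (\<lambda>(j, i) t x. case i of
      None \<Rightarrow> (x $ 1 + x $ 2 + x $ 3, x $ 4 + x $ 5, x $ j)
    | Some i \<Rightarrow> (x $ 1 + x $ 2 + x $ 3 + x $ 4 + x $ 5,
        x $ j - fst (branch (\<delta> t) i) * (x $ 4 + x $ 5),
        x $ 4 - x $ 5 - (fst (snd (branch (\<delta> t) i)) * (x $ nxt j - x $ prv j)
          + snd (snd (branch (\<delta> t) i)) * (x $ 4 + x $ 5))))"
  have br: "continuous_on {a..b} (\<lambda>t. branch (\<delta> t) i)" for i
    using \<delta> by (intro continuous_on_compose2[OF continuous_on_branch]) auto
  have main: "monodromy X a b (c k a) = c k b" if "k \<in> I" for k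
  proof (rule monodromy_eq[where c = c and I = I and H = H])
    show "finite I" by (simp add: I_def branch_indices_def)
    fix t assume t: "t \<in> {a..b}"
    have "lines_on (X t) = plane_line ` {1, 2, 3} \<union>
        (\<lambda>(j, p). branch_line j p) ` ({1, 2, 3} \<times> branch (\<delta> t) ` branch_indices)"
      unfolding X[OF t] lines_on_surface_w[OF admissibleD(5)[OF \<delta>(2)[OF t]]]
        cross_params_eq_branches[OF \<delta>(2)[OF t]] branch_line_def by (simp add: case_prod_unfold)
    also have "\<dots> = (\<lambda>i. c i t) ` I"
    proof -
      have "I = ({1, 2, 3} \<times> {None}) \<union> ({1, 2, 3} \<times> Some ` branch_indices)" by (auto simp: I_def)
      moreover have "(\<lambda>i. c i t) ` ({1, 2, 3} \<times> {None}) = plane_line ` {1, 2, 3}"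
        by (force simp: c_def)
      moreover have "(\<lambda>i. c i t) ` ({1, 2, 3} \<times> Some ` branch_indices) =
          (\<lambda>(j, p). branch_line j p) ` ({1, 2, 3} \<times> branch (\<delta> t) ` branch_indices)"
        by (force simp: c_def)
      ultimately show ?thesis by (simp only: image_Un)
    qed
    finally show "lines_on (X t) = (\<lambda>i. c i t) ` I" .
    show "inj_on (\<lambda>i. c i t) I"
    proof (rule inj_onI, clarify)
      fix j i j' i' assume *: "(j, i) \<in> I" "(j', i') \<in> I" "c (j, i) t = c (j', i') t"
      have jj: "j \<in> {1, 2, 3}" "j' \<in> {1, 2, 3}" using *(1,2) by (auto simp: I_def)
      have neq: "branch_line k p \<noteq> plane_line k'" if "k \<in> {1, 2, 3}" for k k' p
        using cyc_line_neq_plane_line[OF that] by (simp add: branch_line_def case_prod_unfold)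
      have eq: "j = j' \<and> p = p'" if "branch_line j p = branch_line j' p'" for p p'
        using that cyc_line_eq_iff[OF jj] by (auto simp: branch_line_def case_prod_unfold prod_eq_iff)
      show "j = j' \<and> i = i'"
      proof (cases i; cases i')
        assume "i = None" "i' = None"
        then show ?thesis using *(3) plane_line_eq_iff[OF jj] by (simp add: c_def)
      next
        fix r assume "i = None" "i' = Some r"
        then show ?thesis using *(3) neq[OF jj(2)] by (simp add: c_def) metis
      next
        fix r assume "i = Some r" "i' = None"
        then show ?thesis using *(3) neq[OF jj(1)] by (simp add: c_def)
      next
        fix r r' assume r: "i = Some r" "i' = Some r'"
        then have "r \<in> branch_indices" "r' \<in> branch_indices" using *(1,2) by (auto simp: I_def)
        moreover have "j = j' \<and> branch (\<delta> t) r = branch (\<delta> t) r'"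
          using *(3) by (intro eq) (simp add: c_def r)
        ultimately show ?thesis using inj_onD[OF branch_inj[OF \<delta>(2)[OF t]]] r by blast
      qed
    qed
  next
    fix k t assume "k \<in> I" and t: "t \<in> {a..b}"
    then show "c k t = {x. H k t x = 0}"
      by (auto simp: c_def H_def I_def plane_line_def branch_line_def cyc_line_def cross_line_def
        case_prod_unfold zero_prod_def)
  next
    fix k assume k: "k \<in> I"
    then obtain j i where ji: "k = (j, i)" "j \<in> {1, 2, 3}" by (auto simp: I_def)
    show "continuous_map (top_of_set {a..b}) line_topology (c k)"
    proof (cases i)
      case None
      then have "c k = (\<lambda>t. plane_line j)" by (simp add: c_def ji)
      then show ?thesis using plane_line_in_proj_lines[OF ji(2)]
        by (simp add: topspace_line_topology)
    next
      case (Some r)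
      let ?p = "\<lambda>t. cross_dir (prv j) (nxt j) (fst (snd (branch (\<delta> t) r)))"
      let ?q = "\<lambda>t. cross_pt j (fst (branch (\<delta> t) r)) (snd (snd (branch (\<delta> t) r)))"
      have eq: "c k = (\<lambda>t. pspan (?p t) (?q t))"
        by (simp add: c_def ji Some branch_line_def case_prod_unfold cyc_line_def
            cross_line_eq_pspan[OF triple_cyc[OF ji(2)]])
      have "continuous_on {a..b} ?p"
        unfolding cross_dir_def
      proof (intro continuous_on_vec_lambda)
        show "continuous_on {a..b} (\<lambda>t. if n = nxt j then 1 else if n = prv j then - 1
            else if n = 4 then fst (snd (branch (\<delta> t) r))
            else if n = 5 then - fst (snd (branch (\<delta> t) r)) else 0)" for n
          by (cases "n = nxt j"; cases "n = prv j"; cases "n = 4"; cases "n = 5")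
            (simp_all add: continuous_intros br)
      qed
      moreover have "continuous_on {a..b} ?q"
        unfolding cross_pt_def
      proof (intro continuous_on_vec_lambda)
        show "continuous_on {a..b} (\<lambda>t. if n = j then fst (branch (\<delta> t) r)
            else if n = 4 then (1 + snd (snd (branch (\<delta> t) r))) / 2
            else if n = 5 then (1 - snd (snd (branch (\<delta> t) r))) / 2
            else - (1 + fst (branch (\<delta> t) r)) / 2)" for n
          by (cases "n = j"; cases "n = 4"; cases "n = 5") (simp_all add: continuous_intros br)
      qed
      ultimately show ?thesis
        unfolding eq by (intro continuous_map_pspan cross_frame triple_cyc ji(2))
    qed
    have br': "continuous_on ({a..b} \<times> UNIV) (\<lambda>p :: real \<times> cvec. branch (\<delta> (fst p)) r)" for r
      by (rule continuous_on_compose2[OF br[of r]]) (auto intro!: continuous_intros)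
    show "continuous_on ({a..b} \<times> UNIV) (\<lambda>(t, x). H k t x)"
      unfolding case_prod_unfold H_def ji(1) by (cases i) (auto intro!: continuous_intros br')
  qed (use assms that in auto)
  show "monodromy X a b (plane_line j) = plane_line j"
    using main[of "(j, None)"] j by (simp add: I_def c_def)
  show "monodromy X a b (branch_line j (branch (\<delta> a) i)) = branch_line j (branch (\<delta> b) i)"
    if "i \<in> branch_indices"
  proof -
    have "(j, Some i) \<in> I" using j that unfolding I_def by blast
    from main[OF this] show ?thesis by (simp add: c_def)
  qed
qed


section \<open>The loop\<close>

text \<open>
  A square root of \<open>5/27\<close>, that is, a value of \<open>d\<close> over the Clebsch surface.
\<close>

definition base_root :: complex where "base_root = of_real (sqrt (5 / 27))"

lemma base_root_sq: "5 / 27 - base_root\<^sup>2 = 0" "5 / 27 - (- base_root)\<^sup>2 = 0"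
  by (simp_all add: base_root_def flip: of_real_power)

lemma kappa_base_root: "of_real kappa * base_root = of_real (sqrt (5 / 32))"
  by (simp add: kappa_def base_root_def real_sqrt_mult[symmetric] flip: of_real_mult)

definition phi_base :: real where "phi_base = arcsin (sqrt (5 / 32)) / 3"

text \<open>
  As \<open>Arcsin\<close> is odd on the real interval \<open>[-1, 1]\<close>, a change of the sign of \<open>d\<close> changes the sign of \<open>\<phi>\<close>, and the
  cosine is even.
\<close>

lemma cosroot_base_root:
  "cosroot n base_root = of_real (cos (phi_base + of_int n * (pi / 3)))"
  "cosroot n (- base_root) = cosroot (- n) base_root"
proof -
  have le: "sqrt (5 / 32) \<le> 1" "- 1 \<le> sqrt (5 / 32)" by (simp, rule order_trans[of _ "0 :: real"]) simp_all
  have 1: "Arcsin (of_real kappa * base_root) = of_real (arcsin (sqrt (5 / 32)))"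
    unfolding kappa_base_root using le by (subst of_real_arcsin) auto
  have "Arcsin (of_real kappa * (- base_root)) = Arcsin (of_real (- sqrt (5 / 32)))"
    using kappa_base_root by simp
  also have "\<dots> = of_real (arcsin (- sqrt (5 / 32)))" using le by (subst of_real_arcsin) auto
  also have "\<dots> = - of_real (arcsin (sqrt (5 / 32)))" using le by (subst arcsin_minus) auto
  finally have 2: "Arcsin (of_real kappa * (- base_root)) = - of_real (arcsin (sqrt (5 / 32)))" .
  show "cosroot n base_root = of_real (cos (phi_base + of_int n * (pi / 3)))"
    unfolding cosroot_def 1 phi_base_def by (simp flip: cos_of_real)
  have "cosroot n (- base_root) = cos (- (of_real (arcsin (sqrt (5 / 32))) / 3 + of_int (- n) * of_real (pi / 3)))"
    unfolding cosroot_def 2 by (simp add: algebra_simps)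
  also have "\<dots> = cosroot (- n) base_root" unfolding cos_minus cosroot_def 1 ..
  finally show "cosroot n (- base_root) = cosroot (- n) base_root" .
qed

lemma base_root_admissible: "base_root \<in> admissible"
  by (auto simp: admissible_def base_root_sq) (auto simp: base_root_def)

definition golden :: real where "golden = (1 + sqrt 5) / 2"

lemma golden: "golden\<^sup>2 = golden + 1" "1 < golden" "golden < 2"
proof -
  show "golden\<^sup>2 = golden + 1" by (simp add: golden_def power2_eq_square field_simps)
  have "1 < sqrt 5" "sqrt 5 < 3" by (simp_all add: real_less_lsqrt)
  then show "1 < golden" "golden < 2" by (simp_all add: golden_def)
qed

text \<open>
  At \<open>w = 0\<close> one has \<open>c = g\<^sup>2 - 1\<close> and \<open>c * (c\<^sup>2 - c - 1) = 0\<close>, so that each \<open>g\<close>, being positive, is \<open>1\<close>, the golden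
  ratio or its inverse.  Because \<open>0 < \<phi> < \<pi>/6\<close> and the cosine decreases, the order of the three values tells
  which is which.
\<close>

lemma scaled_cos_values:
  defines "g n \<equiv> sqrt (8 / 3) * cos (phi_base + of_int n * (pi / 3))"
  shows "g 0 = golden" "g (- 1) = 1" "g 1 = golden - 1"
proof -
  have p: "0 < phi_base" "phi_base < pi / 6"
  proof -
    have "sqrt (5 / 32) < 1" "0 < sqrt (5 / 32)" by simp_all
    then have "arcsin 0 < arcsin (sqrt (5 / 32))" "arcsin (sqrt (5 / 32)) < arcsin 1"
      by (intro arcsin_less_arcsin; linarith)+
    then show "0 < phi_base" "phi_base < pi / 6" by (simp_all add: phi_base_def)
  qed
  have c1: "cos (phi_base + of_int (- 1) * (pi / 3)) = cos (pi / 3 - phi_base)"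
    using cos_minus[of "pi / 3 - phi_base"] by simp
  have g: "g (- 1) < g 0" "g 1 < g (- 1)" "0 < g 1"
  proof -
    have "cos (pi / 3 - phi_base) < cos phi_base" "cos (phi_base + pi / 3) < cos (pi / 3 - phi_base)"
      using p by (intro cos_monotone_0_pi; simp)+
    moreover have "0 < cos (phi_base + pi / 3)" using p by (intro cos_gt_zero_pi) auto
    ultimately show "g (- 1) < g 0" "g 1 < g (- 1)" "0 < g 1"
      unfolding g_def c1 by (simp_all)
  qed
  have val: "g n \<in> {golden, 1, golden - 1}" if n: "n \<in> {0, 1, - 1}" for n
  proof -
    define c where "c = (g n)\<^sup>2 - 1"
    have q2: "(complex_of_real (sqrt (8 / 3)))\<^sup>2 = 8 / 3" by (simp flip: of_real_power)
    have bc: "branch base_root (n, 1) = (of_real c, of_real (g n), 0)"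
      using n unfolding branch_def base_root_sq c_def g_def cosroot_base_root(1)
      by (auto simp: power_mult_distrib q2)
    have "(n, 1) \<in> branch_indices" using n by (auto simp: branch_indices_def)
    then have "branch base_root (n, 1) \<in> cross_params (5 / 27 - base_root\<^sup>2)"
      unfolding cross_params_eq_branches[OF base_root_admissible] by blast
    then have "complex_of_real (c ^ 3 - c\<^sup>2 - c) = 0"
      unfolding base_root_sq bc cross_params_def by simp
    then have "c ^ 3 - c\<^sup>2 - c = 0" by (simp only: of_real_eq_0_iff)
    then have "(g n - 1) * (g n + 1) * ((g n - golden) * (g n + (golden - 1))) * ((g n + golden) * (g n - (golden - 1))) = 0"
      using golden(1) unfolding c_def by algebra
    moreover have "0 < g n" using g n by auto
    ultimately show ?thesis using golden(2) by auto
  qed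
  show "g 0 = golden" "g (- 1) = 1" "g 1 = golden - 1"
    using val[of 0] val[of 1] val[of "- 1"] g golden by auto
qed

lemma branch_base_root:
  assumes "n \<in> {0, 1, - 1}"
  shows "branch base_root (n, s) = (let v = s * of_real (if n = 0 then golden else if n = 1 then golden - 1 else 1)
     in ((if n = 0 then of_real golden else if n = 1 then - of_real (golden - 1) else 0), v, 0))"
proof -
  define g where "g n = sqrt (8 / 3) * cos (phi_base + of_int n * (pi / 3))" for n
  have q2: "(complex_of_real (sqrt (8 / 3)))\<^sup>2 = 8 / 3" by (simp flip: of_real_power)
  have "branch base_root (n, s) = (of_real ((g n)\<^sup>2 - 1), s * of_real (g n), 0)"
    using assms unfolding branch_def base_root_sq g_def cosroot_base_root(1)
    by (auto simp: power_mult_distrib q2)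
  moreover have "g 0 = golden" "g (- 1) = 1" "g 1 = golden - 1"
    using scaled_cos_values by (simp_all add: g_def)
  moreover have cb: "(complex_of_real golden)\<^sup>2 = of_real golden + 1"
    unfolding of_real_power[symmetric] golden(1) by simp
  moreover have "(complex_of_real golden - 1)\<^sup>2 = 2 - of_real golden" using cb by algebra
  ultimately show ?thesis using assms by (auto simp: Let_def)
qed

lemma branch_base_root_2: "branch base_root (2, s) = (- 1, 0, s)"
  unfolding branch_def base_root_sq by simp

lemma branch_minus_base_root:
  "branch (- base_root) (n, s) = branch base_root (if n = 2 then 2 else - n, s)" if "n \<in> {0, 1, - 1, 2}"
  using that unfolding branch_def base_root_sq cosroot_base_root(2) by auto

text \<open>
  The loop lifts to \<open>d = sqrt \<rho> * exp (\<i> * \<theta> / 2)\<close>: the modulus \<open>\<rho>\<close> of \<open>5/27 - w\<close> shrinks to \<open>\<epsilon>\<close> on the first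
  segment and grows back on the last, and the angle \<open>\<theta>\<close> runs from \<open>0\<close> to \<open>2 * \<pi>\<close> on the circle.  So \<open>d\<close> ends at
  the negative of its initial value.  The bound \<open>\<epsilon> < 4/27\<close> keeps the circle in the half-plane
  \<open>Re w < 1/3\<close>, as \<open>5/27 + 4/27 = 1/3\<close>.
\<close>

lemma g45_eq:
  assumes \<epsilon>: "0 < \<epsilon>" "\<epsilon> < 4 / 27" and t: "t0 < 0" "2 * pi < t3" and j: "j \<in> {1, 2, 3}"
  shows "g45 \<epsilon> t0 t3 (plane_line j) = plane_line j"
    and "i \<in> branch_indices \<Longrightarrow> g45 \<epsilon> t0 t3 (branch_line j (branch base_root i)) = branch_line j (branch (- base_root) i)"
proof -
  \<comment> \<open>The fraction of the segment covered: the two quotients are the affine parameters of the first and last pieces, and each is at least \<open>1\<close> outside its piece.\<close>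
  define \<tau> where "\<tau> s = min 1 (min ((s - t0) / (0 - t0)) ((t3 - s) / (t3 - 2 * pi)))" for s
  define \<rho> where "\<rho> s = 5 / 27 - \<tau> s * (5 / 27 - \<epsilon>)" for s
  define \<theta> where "\<theta> s = max 0 (min s (2 * pi))" for s
  define \<delta> :: "real \<Rightarrow> complex" where "\<delta> s = of_real (sqrt (\<rho> s)) * exp (\<i> * of_real (\<theta> s / 2))" for s
  have \<tau>: "0 \<le> \<tau> s" "\<tau> s \<le> 1" if "s \<in> {t0..t3}" for s
  proof -
    have "0 \<le> (s - t0) / (0 - t0)" "0 \<le> (t3 - s) / (t3 - 2 * pi)"
      using that t by (intro divide_nonneg_nonneg; simp)+
    then show "0 \<le> \<tau> s" "\<tau> s \<le> 1" by (simp_all add: \<tau>_def)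
  qed
  have \<rho>: "\<epsilon> \<le> \<rho> s" "\<rho> s \<le> 5 / 27" if "s \<in> {t0..t3}" for s
  proof -
    show "\<rho> s \<le> 5 / 27" unfolding \<rho>_def using \<tau>[OF that] \<epsilon> by simp
    have "\<tau> s * (5 / 27 - \<epsilon>) \<le> 1 * (5 / 27 - \<epsilon>)" using \<tau>[OF that] \<epsilon> by (intro mult_right_mono) auto
    then show "\<epsilon> \<le> \<rho> s" by (simp add: \<rho>_def)
  qed
  have sq: "(\<delta> s)\<^sup>2 = of_real (\<rho> s) * exp (\<i> * of_real (\<theta> s))" if "s \<in> {t0..t3}" for s
  proof -
    have "(\<delta> s)\<^sup>2 = of_real ((sqrt (\<rho> s))\<^sup>2) * (exp (\<i> * of_real (\<theta> s / 2)))\<^sup>2"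
      by (simp add: \<delta>_def power_mult_distrib)
    also have "(sqrt (\<rho> s))\<^sup>2 = \<rho> s" using \<rho>(1)[OF that] \<epsilon> by simp
    also have "(exp (\<i> * complex_of_real (\<theta> s / 2)))\<^sup>2 = exp (\<i> * of_real (\<theta> s))"
      by (simp flip: exp_double)
    finally show ?thesis .
  qed
  have mid: "\<rho> s = \<epsilon>" if "0 \<le> s" "s \<le> 2 * pi" for s
  proof -
    have "1 \<le> (s - t0) / (0 - t0)" "1 \<le> (t3 - s) / (t3 - 2 * pi)" using that t by (auto simp: field_simps)
    then show ?thesis by (simp add: \<rho>_def \<tau>_def)
  qed
  have loop: "g45_loop \<epsilon> t0 t3 s = 5 / 27 - (\<delta> s)\<^sup>2" if s: "s \<in> {t0..t3}" for s
  proof -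
    consider "s \<le> 0" | "0 < s" "s \<le> 2 * pi" | "2 * pi < s" by linarith
    then show ?thesis
    proof cases
      case 1
      have "(s - t0) / (0 - t0) \<le> 1" "1 \<le> (t3 - s) / (t3 - 2 * pi)" using 1 t pi_gt_zero by (auto simp: field_simps simp del: pi_gt_zero)
      then have "\<tau> s = (s - t0) / (0 - t0)" "\<theta> s = 0" using 1 by (auto simp: \<tau>_def \<theta>_def)
      then show ?thesis unfolding sq[OF s] using 1 by (simp add: g45_loop_def w_star_def \<rho>_def)
    next
      case 2
      then have "\<theta> s = s" by (simp add: \<theta>_def)
      then show ?thesis unfolding sq[OF s] using 2 mid[of s] by (simp add: g45_loop_def w_star_def)
    next
      case 3
      have "1 \<le> (s - t0) / (0 - t0)" "(t3 - s) / (t3 - 2 * pi) \<le> 1" using 3 t pi_gt_zero by (auto simp: field_simps simp del: pi_gt_zero)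
      then have "\<tau> s = (t3 - s) / (t3 - 2 * pi)" "\<theta> s = 2 * pi" using 3 by (auto simp: \<tau>_def \<theta>_def)
      moreover have "exp (\<i> * complex_of_real (2 * pi)) = 1" using exp_two_pi_i by (simp add: ac_simps)
      moreover have "\<not> s \<le> 0" using 3 pi_gt_zero by linarith
      ultimately show ?thesis unfolding sq[OF s] using 3 by (simp add: g45_loop_def w_star_def \<rho>_def)
    qed
  qed
  have admissible: "\<delta> s \<in> admissible" if s: "s \<in> {t0..t3}" for s
    unfolding admissible_def mem_Collect_eq
  proof (intro conjI)
    show "\<delta> s \<noteq> 0" using \<rho>(1)[OF s] \<epsilon> by (simp add: \<delta>_def)
    show "(norm (\<delta> s))\<^sup>2 \<le> 5 / 27"
      using \<rho>[OF s] \<epsilon> by (simp add: norm_power[symmetric] sq[OF s] norm_mult)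
    have "- \<rho> s * cos (\<theta> s) < 4 / 27"
    proof (cases "0 \<le> s \<and> s \<le> 2 * pi")
      case True
      have "\<epsilon> * - cos (\<theta> s) \<le> \<epsilon> * 1" using \<epsilon> cos_ge_minus_one[of "\<theta> s"] by (intro mult_left_mono) auto
      then show ?thesis using mid[of s] True \<epsilon> by simp
    next
      case False
      then have "cos (\<theta> s) = 1" by (auto simp: \<theta>_def)
      then show ?thesis using \<rho>(1)[OF s] \<epsilon> by simp
    qed
    moreover have "Re (5 / 27 - (\<delta> s)\<^sup>2) = 5 / 27 - \<rho> s * cos (\<theta> s)"
      by (simp add: sq[OF s] Re_exp)
    ultimately show "Re (5 / 27 - (\<delta> s)\<^sup>2) < 1 / 3" by simp
  qed
  have cont: "continuous_on {t0..t3} \<delta>"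
    unfolding \<delta>_def \<rho>_def \<tau>_def \<theta>_def using t by (intro continuous_intros) auto
  have ends: "\<delta> t0 = base_root" "\<delta> t3 = - base_root"
  proof -
    have "\<tau> t0 = 0" "\<theta> t0 = 0" using t pi_gt_zero by (auto simp: \<tau>_def \<theta>_def min_def field_simps simp del: pi_gt_zero)
    then show "\<delta> t0 = base_root" by (simp add: \<delta>_def \<rho>_def base_root_def)
    have "\<tau> t3 = 0" "\<theta> t3 = 2 * pi" using t pi_gt_zero by (auto simp: \<tau>_def \<theta>_def min_def field_simps simp del: pi_gt_zero)
    then show "\<delta> t3 = - base_root" by (simp add: \<delta>_def \<rho>_def base_root_def)
  qed
  have le: "t0 \<le> t3" using t pi_gt_zero by linarith
  note mono = monodromy_along_branches[OF le cont admissible, of "\<lambda>s. surface_w (g45_loop \<epsilon> t0 t3 s)" j, OF _ _ j]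
  show "g45 \<epsilon> t0 t3 (plane_line j) = plane_line j"
    unfolding g45_def by (rule mono(1)) (simp_all add: loop)
  show "g45 \<epsilon> t0 t3 (branch_line j (branch base_root i)) = branch_line j (branch (- base_root) i)" if "i \<in> branch_indices"
  proof -
    have "monodromy (\<lambda>s. surface_w (g45_loop \<epsilon> t0 t3 s)) t0 t3 (branch_line j (branch (\<delta> t0) i)) =
        branch_line j (branch (\<delta> t3) i)"
      by (rule mono(2)) (simp_all add: loop that)
    then show ?thesis unfolding g45_def ends .
  qed
qed

section \<open>The lines on the Clebsch surface\<close>

lemma beta_plus_eq: "beta_plus = of_real golden"
  by (simp add: beta_plus_def golden_def)

lemma beta_minus_eq: "beta_minus = - of_real (golden - 1)"
  by (simp add: beta_minus_def golden_def field_simps)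

lemma beta_rules:
  "beta_plus = 1 - beta_minus" "beta_minus * beta_minus = 1 + beta_minus"
  "beta_minus * (beta_minus * z) = z + beta_minus * z"
proof -
  show "beta_plus = 1 - beta_minus" by (simp add: beta_plus_eq beta_minus_eq)
  have "(complex_of_real golden)\<^sup>2 = of_real golden + 1" unfolding of_real_power[symmetric] golden(1) by simp
  then show b: "beta_minus * beta_minus = 1 + beta_minus"
    by (simp add: beta_minus_eq power2_eq_square algebra_simps)
  show "beta_minus * (beta_minus * z) = z + beta_minus * z"
    unfolding mult.assoc[symmetric] b by (simp add: distrib_right)
qed

lemma beta_neq:
  "beta_minus \<noteq> 0" "beta_minus \<noteq> 1" "beta_minus \<noteq> - 1" "beta_plus \<noteq> 0" "beta_plus \<noteq> beta_minus"
  "beta_minus \<noteq> beta_plus" "beta_plus \<noteq> -1"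
  "1 + 2 * beta_minus \<noteq> 0" "1 + 3 * beta_minus \<noteq> 0"
proof -
  have r: "beta_minus = of_real (1 - golden)" "beta_plus = of_real golden" by (simp_all add: beta_minus_eq beta_plus_eq)
  show "beta_minus \<noteq> 0" "beta_minus \<noteq> 1" "beta_minus \<noteq> - 1" "beta_plus \<noteq> 0" "beta_plus \<noteq> beta_minus"
    "beta_minus \<noteq> beta_plus" "beta_plus \<noteq> -1"
    using golden(2,3) by (simp_all add: r complex_eq_iff)
  have "golden \<noteq> x" if "x\<^sup>2 \<noteq> x + 1" for x using golden(1) that by blast
  \<comment> \<open>The values \<open>3/2\<close> and \<open>4/3\<close> would make \<open>1 + 2 * \<beta>\<^sub>-\<close> and \<open>1 + 3 * \<beta>\<^sub>-\<close> vanish.\<close>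
  from this[of "3 / 2"] this[of "4 / 3"] have "golden \<noteq> 3 / 2" "golden \<noteq> 4 / 3"
    by (simp_all add: power2_eq_square)
  then have "1 + 2 * (1 - golden) \<noteq> 0" "1 + 3 * (1 - golden) \<noteq> 0" by auto
  then have "complex_of_real (1 + 2 * (1 - golden)) \<noteq> 0" "complex_of_real (1 + 3 * (1 - golden)) \<noteq> 0"
    by (simp_all only: of_real_eq_0_iff not_False_eq_True)
  then show "1 + 2 * beta_minus \<noteq> 0" "1 + 3 * beta_minus \<noteq> 0" by (simp_all add: r)
qed

lemma branch_line_base_root:
  "branch_line j (branch base_root (0, s)) = cyc_line j beta_plus (s * beta_plus) 0"
  "branch_line j (branch base_root (1, s)) = cyc_line j beta_minus (- s * beta_minus) 0"
  "branch_line j (branch base_root (- 1, s)) = cyc_line j 0 s 0"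
  "branch_line j (branch base_root (2, s)) = cyc_line j (- 1) 0 s"
  by (simp_all add: branch_line_def branch_base_root branch_base_root_2 beta_plus_eq beta_minus_eq algebra_simps)

lemma lines_on_clebsch:
  "lines_on clebsch = plane_line ` {1, 2, 3} \<union>
     (\<lambda>(j, i). branch_line j (branch base_root i)) ` ({1, 2, 3} \<times> branch_indices)"
proof -
  have "lines_on clebsch = lines_on (surface_w (5 / 27 - base_root\<^sup>2))" by (simp add: base_root_sq surface_w_0)
  also have "\<dots> = plane_line ` {1, 2, 3} \<union>
      (\<lambda>(j, c, v, e). cyc_line j c v e) ` ({1, 2, 3} \<times> branch base_root ` branch_indices)"
    using lines_on_surface_w[OF admissibleD(5)[OF base_root_admissible]] cross_params_eq_branches[OF base_root_admissible] by simp
  also have "{1, 2, 3} \<times> branch base_root ` branch_indices = (\<lambda>(j, i). (j, branch base_root i)) ` ({1, 2, 3} \<times> branch_indices)"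
    by auto
  also have "(\<lambda>(j, c, v, e). cyc_line j c v e) ` \<dots> =
      (\<lambda>(j, i). branch_line j (branch base_root i)) ` ({1, 2, 3} \<times> branch_indices)"
    by (simp only: image_image branch_line_def case_prod_unfold fst_conv snd_conv)
  finally show ?thesis .
qed

lemma clebsch_line_cases:
  assumes "l \<in> lines_on clebsch"
  obtains j where "j \<in> {1, 2, 3}" "l = plane_line j"
  | j s where "j \<in> {1, 2, 3}" "s \<in> {1, - 1}" "l = cyc_line j (- 1) 0 s"
  | j s where "j \<in> {1, 2, 3}" "s \<in> {1, - 1}" "l = cyc_line j beta_plus (s * beta_plus) 0"
  | j s where "j \<in> {1, 2, 3}" "s \<in> {1, - 1}" "l = cyc_line j 0 s 0"
  | j s where "j \<in> {1, 2, 3}" "s \<in> {1, - 1}" "l = cyc_line j beta_minus (s * beta_minus) 0"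
proof -
  consider (p) j where "j \<in> {1, 2, 3}" "l = plane_line j"
    | (b) j n s where "j \<in> {1, 2, 3}" "n \<in> {0, 1, - 1, 2}" "s \<in> {1, - 1}" "l = branch_line j (branch base_root (n, s))"
    using assms unfolding lines_on_clebsch branch_indices_def by blast
  then show ?thesis
  proof cases
    case p
    then show ?thesis using that(1) by blast
  next
    case b
    have "- s \<in> {1, - 1}" using b(3) by auto
    moreover have "n = 0 \<or> n = 1 \<or> n = - 1 \<or> n = 2" using b(2) by blast
    ultimately show ?thesis using b(1,3,4) that(2-5) by (elim disjE) (simp_all only: branch_line_base_root)
  qed
qed

lemma lines_on_clebschI:
  assumes "j \<in> {1, 2, 3}"
  shows "plane_line j \<in> lines_on clebsch"
    and "s \<in> {1, - 1} \<Longrightarrow> cyc_line j (- 1) 0 s \<in> lines_on clebsch"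
    and "s \<in> {1, - 1} \<Longrightarrow> cyc_line j beta_plus (s * beta_plus) 0 \<in> lines_on clebsch"
    and "s \<in> {1, - 1} \<Longrightarrow> cyc_line j 0 s 0 \<in> lines_on clebsch"
    and "s \<in> {1, - 1} \<Longrightarrow> cyc_line j beta_minus (s * beta_minus) 0 \<in> lines_on clebsch"
proof -
  show "plane_line j \<in> lines_on clebsch" using assms unfolding lines_on_clebsch by blast
  have *: "branch_line j (branch base_root (n, s)) \<in> lines_on clebsch" if "n \<in> {0, 1, - 1, 2}" "s \<in> {1, - 1}" for n s
  proof -
    have "(j, n, s) \<in> {1, 2, 3} \<times> branch_indices" using that assms unfolding branch_indices_def by (intro SigmaI)
    from imageI[OF this, of "\<lambda>(j, i). branch_line j (branch base_root i)"]
    show ?thesis unfolding lines_on_clebsch by simp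
  qed
  assume s: "s \<in> {1, - 1}"
  then have "- s \<in> {1, - 1}" by auto
  then show "cyc_line j (- 1) 0 s \<in> lines_on clebsch" "cyc_line j beta_plus (s * beta_plus) 0 \<in> lines_on clebsch"
    "cyc_line j 0 s 0 \<in> lines_on clebsch" "cyc_line j beta_minus (s * beta_minus) 0 \<in> lines_on clebsch"
    using *[of 2 s] *[of 0 s] *[of "- 1" s] *[of 1 "- s"] s by (simp_all only: branch_line_base_root) simp_all
qed

lemma card_lines_on_clebsch: "card (lines_on clebsch) = 27"
proof -
  have neq: "branch_line j p \<noteq> plane_line j'" if "j \<in> {1, 2, 3}" for j j' p
    using cyc_line_neq_plane_line[OF that] by (simp add: branch_line_def case_prod_unfold)
  have inj: "inj_on (\<lambda>(j, i). branch_line j (branch base_root i)) ({1, 2, 3} \<times> branch_indices)"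
  proof (rule inj_onI)
    fix a b
    assume ab: "a \<in> {1, 2, 3 :: 5} \<times> branch_indices" "b \<in> {1, 2, 3 :: 5} \<times> branch_indices"
      "(\<lambda>(j, i). branch_line j (branch base_root i)) a = (\<lambda>(j, i). branch_line j (branch base_root i)) b"
    obtain j i j' i' where *: "a = (j, i)" "b = (j', i')" "j \<in> {1, 2, 3}" "j' \<in> {1, 2, 3}"
        "i \<in> branch_indices" "i' \<in> branch_indices"
      using ab(1,2) by blast
    have "branch_line j (branch base_root i) = branch_line j' (branch base_root i')" using ab(3) * by simp
    then have "j = j' \<and> branch base_root i = branch base_root i'"
      using cyc_line_eq_iff[OF *(3,4)] by (auto simp: branch_line_def case_prod_unfold prod_eq_iff)
    then show "a = b" using inj_onD[OF branch_inj[OF base_root_admissible]] * by blast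
  qed
  have "inj_on plane_line {1, 2, 3}" by (rule inj_onI) (simp add: plane_line_eq_iff)
  then have "card (plane_line ` {1, 2, 3}) = 3" by (simp add: card_image)
  moreover have "card ((\<lambda>(j, i). branch_line j (branch base_root i)) ` ({1, 2, 3} \<times> branch_indices)) = 24"
    using inj by (simp add: card_image card_cartesian_product branch_indices_def)
  moreover have "plane_line ` {1, 2, 3} \<inter> (\<lambda>(j, i). branch_line j (branch base_root i)) ` ({1, 2, 3} \<times> branch_indices) = {}"
  proof (rule equals0I)
    fix l assume "l \<in> plane_line ` {1, 2, 3} \<inter> (\<lambda>(j, i). branch_line j (branch base_root i)) ` ({1, 2, 3} \<times> branch_indices)"
    then obtain j j' i where "j \<in> {1, 2, 3 :: 5}" "l = plane_line j'" "l = branch_line j (branch base_root i)" by auto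
    then show False using neq by metis
  qed
  ultimately show ?thesis
    unfolding lines_on_clebsch by (subst card_Un_disjoint) (auto simp: branch_indices_def)
qed

lemma g45_on_clebsch_lines:
  assumes \<epsilon>: "0 < \<epsilon>" "\<epsilon> < 4 / 27" and t: "t0 < 0" "2 * pi < t3"
    and j: "j \<in> {1, 2, 3}"
  shows "g45 \<epsilon> t0 t3 (plane_line j) = plane_line j"
    and "s \<in> {1, - 1} \<Longrightarrow> g45 \<epsilon> t0 t3 (cyc_line j (- 1) 0 s) = cyc_line j (- 1) 0 s"
    and "s \<in> {1, - 1} \<Longrightarrow>
      g45 \<epsilon> t0 t3 (cyc_line j beta_plus (s * beta_plus) 0) = cyc_line j beta_plus (s * beta_plus) 0"
    and "s \<in> {1, - 1} \<Longrightarrow> g45 \<epsilon> t0 t3 (cyc_line j 0 s 0) = cyc_line j beta_minus (- s * beta_minus) 0"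
    and "s \<in> {1, - 1} \<Longrightarrow> g45 \<epsilon> t0 t3 (cyc_line j beta_minus (s * beta_minus) 0) = cyc_line j 0 (- s) 0"
proof -
  show "g45 \<epsilon> t0 t3 (plane_line j) = plane_line j" using g45_eq(1)[OF assms] .
  have *: "g45 \<epsilon> t0 t3 (branch_line j (branch base_root (n, s))) =
      branch_line j (branch base_root (if n = 2 then 2 else - n, s))"
    if "n \<in> {0, 1, - 1, 2}" "s \<in> {1, - 1}" for n s
  proof -
    have "(n, s) \<in> branch_indices" using that unfolding branch_indices_def by (intro SigmaI)
    then show ?thesis
      using g45_eq(2)[OF assms, of "(n, s)"] unfolding branch_minus_base_root[OF that(1)] by blast
  qed
  assume s: "s \<in> {1, - 1}"
  then have ms: "- s \<in> {1, - 1}" by auto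
  show "g45 \<epsilon> t0 t3 (cyc_line j (- 1) 0 s) = cyc_line j (- 1) 0 s"
    using *[of 2 s] s by (simp add: branch_line_base_root)
  show "g45 \<epsilon> t0 t3 (cyc_line j beta_plus (s * beta_plus) 0) = cyc_line j beta_plus (s * beta_plus) 0"
    using *[of 0 s] s by (simp add: branch_line_base_root)
  show "g45 \<epsilon> t0 t3 (cyc_line j 0 s 0) = cyc_line j beta_minus (- s * beta_minus) 0"
    using *[of "- 1" s] s by (simp add: branch_line_base_root)
  show "g45 \<epsilon> t0 t3 (cyc_line j beta_minus (s * beta_minus) 0) = cyc_line j 0 (- s) 0"
    using *[of 1 "- s"] ms by (simp add: branch_line_base_root)
qed

section \<open>Names of the lines\<close>

lemma framesI_coords:
  assumes "x $ m \<noteq> 0" "y $ m = 0" "y $ n \<noteq> 0"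
  shows "(x, y) \<in> frames"
proof (rule framesI)
  fix a b assume *: "a *s x + b *s y = 0"
  have "a * x $ m + b * y $ m = 0" "a * x $ n + b * y $ n = 0"
    using arg_cong[OF *, of "\<lambda>v. v $ m"] arg_cong[OF *, of "\<lambda>v. v $ n"] by simp_all
  then show "a = 0 \<and> b = 0" using assms by simp
qed

lemma pspan_eq_plane_line:
  assumes "triple i j k"
  shows "pspan (ediff i j) (ediff 4 5) = plane_line k"
proof (rule pspan_eqI)
  show "plane_line k \<in> proj_lines" using assms by (intro plane_line_in_proj_lines) blast
  show "(ediff i j, ediff 4 5) \<in> frames"
    using assms by (intro framesI_coords[of _ i _ 4]; cases rule: triple_cases) (simp_all add: ediff_nth)
  show "ediff i j \<in> plane_line k" "ediff 4 5 \<in> plane_line k"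
    using assms by (cases rule: triple_cases; simp add: plane_line_def ediff_nth)+
qed

lemma cross_line_eq_cyc_line:
  assumes "triple i j k"
  shows "cross_line i j k c v e = cyc_line j c (if k = nxt j then v else - v) e"
  using assms
  by (cases rule: triple_cases) (auto simp: cyc_line_def prv_def nxt_def cross_line_swap[of 3 2 1]
      cross_line_swap[of 1 3 2] cross_line_swap[of 2 1 3])

lemma pspan_eq_cross_line_b:
  assumes "triple i j k" "p \<in> {4, 5}"
  shows "pspan (ediff i j) (ediff k p) = cyc_line k (- 1) 0 (if p = 4 then 1 else - 1)"
proof -
  have t: "triple i k j" using assms(1) by auto
  have "pspan (ediff i j) (ediff k p) = cross_line i k j (- 1) 0 (if p = 4 then 1 else - 1)"
  proof (rule pspan_eqI)
    show "cross_line i k j (- 1) 0 (if p = 4 then 1 else - 1) \<in> proj_lines"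
      using cross_line_in_proj_lines[OF t] .
    show "(ediff i j, ediff k p) \<in> frames"
      using assms by (intro framesI_coords[of _ i _ k]; cases rule: triple_cases) (auto simp: ediff_nth)
    show "ediff i j \<in> cross_line i k j (- 1) 0 (if p = 4 then 1 else - 1)"
      using assms by (cases rule: triple_cases) (auto simp: cross_line_def ediff_nth)
    show "ediff k p \<in> cross_line i k j (- 1) 0 (if p = 4 then 1 else - 1)"
      using assms by (cases rule: triple_cases) (auto simp: cross_line_def ediff_nth)
  qed
  then show ?thesis using cross_line_eq_cyc_line[OF t] by simp
qed

text \<open>
  Used with both roots \<open>b = \<beta>\<^sub>+\<close> and \<open>b = \<beta>\<^sub>-\<close> of the same equation: the first gives fixed lines, the second
  gives the lines that are exchanged.
\<close>

lemma pspan_eq_cross_line: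
  assumes t: "triple i j k" and b: "b\<^sup>2 = b + 1"
  shows "pspan (ediff i 4 + b *s ediff k j) (ediff k 5 + b *s ediff i j) = cross_line i j k b (- b) 0"
    and "pspan (ediff i 5 + b *s ediff k j) (ediff k 4 + b *s ediff i j) = cross_line i j k b b 0"
proof -
  have b': "b * b = 1 + b" using b by (simp add: power2_eq_square)
  show "pspan (ediff i 4 + b *s ediff k j) (ediff k 5 + b *s ediff i j) = cross_line i j k b (- b) 0"
  proof (rule pspan_eqI)
    show "cross_line i j k b (- b) 0 \<in> proj_lines" using cross_line_in_proj_lines[OF t] .
    show "(ediff i 4 + b *s ediff k j, ediff k 5 + b *s ediff i j) \<in> frames"
      using t by (intro framesI_coords[of _ 4 _ 5]; cases rule: triple_cases) (simp_all add: ediff_nth)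
    show "ediff i 4 + b *s ediff k j \<in> cross_line i j k b (- b) 0"
      "ediff k 5 + b *s ediff i j \<in> cross_line i j k b (- b) 0"
      using t by (cases rule: triple_cases; simp add: cross_line_def ediff_nth algebra_simps b')+
  qed
  show "pspan (ediff i 5 + b *s ediff k j) (ediff k 4 + b *s ediff i j) = cross_line i j k b b 0"
  proof (rule pspan_eqI)
    show "cross_line i j k b b 0 \<in> proj_lines" using cross_line_in_proj_lines[OF t] .
    show "(ediff i 5 + b *s ediff k j, ediff k 4 + b *s ediff i j) \<in> frames"
      using t by (intro framesI_coords[of _ 5 _ 4]; cases rule: triple_cases) (simp_all add: ediff_nth)
    show "ediff i 5 + b *s ediff k j \<in> cross_line i j k b b 0"
      "ediff k 4 + b *s ediff i j \<in> cross_line i j k b b 0"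
      using t by (cases rule: triple_cases; simp add: cross_line_def ediff_nth algebra_simps b')+
  qed
qed

lemma pspan_eq_cross_line':
  assumes t: "triple i j k"
  shows "pspan (ediff j i + beta_minus *s ediff k 5) (ediff k 4 + beta_minus *s ediff j 5) =
      cross_line i j k beta_plus (- beta_plus) 0"
    and "pspan (ediff j i + beta_minus *s ediff k 4) (ediff k 5 + beta_minus *s ediff j 4) =
      cross_line i j k beta_plus beta_plus 0"
proof -
  show "pspan (ediff j i + beta_minus *s ediff k 5) (ediff k 4 + beta_minus *s ediff j 5) =
      cross_line i j k beta_plus (- beta_plus) 0"
  proof (rule pspan_eqI)
    show "cross_line i j k beta_plus (- beta_plus) 0 \<in> proj_lines" using cross_line_in_proj_lines[OF t] .
    show "(ediff j i + beta_minus *s ediff k 5, ediff k 4 + beta_minus *s ediff j 5) \<in> frames"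
      using t by (intro framesI_coords[of _ i _ 4]; cases rule: triple_cases) (simp_all add: ediff_nth)
    show "ediff j i + beta_minus *s ediff k 5 \<in> cross_line i j k beta_plus (- beta_plus) 0"
      "ediff k 4 + beta_minus *s ediff j 5 \<in> cross_line i j k beta_plus (- beta_plus) 0"
      using t by (cases rule: triple_cases; simp add: cross_line_def ediff_nth algebra_simps beta_rules)+
  qed
  show "pspan (ediff j i + beta_minus *s ediff k 4) (ediff k 5 + beta_minus *s ediff j 4) =
      cross_line i j k beta_plus beta_plus 0"
  proof (rule pspan_eqI)
    show "cross_line i j k beta_plus beta_plus 0 \<in> proj_lines" using cross_line_in_proj_lines[OF t] .
    show "(ediff j i + beta_minus *s ediff k 4, ediff k 5 + beta_minus *s ediff j 4) \<in> frames"
      using t by (intro framesI_coords[of _ i _ 5]; cases rule: triple_cases) (simp_all add: ediff_nth)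
    show "ediff j i + beta_minus *s ediff k 4 \<in> cross_line i j k beta_plus beta_plus 0"
      "ediff k 5 + beta_minus *s ediff j 4 \<in> cross_line i j k beta_plus beta_plus 0"
      using t by (cases rule: triple_cases; simp add: cross_line_def ediff_nth algebra_simps beta_rules)+
  qed
qed

lemma beta_sq: "beta_plus\<^sup>2 = beta_plus + 1" "beta_minus\<^sup>2 = beta_minus + 1"
  by (simp_all add: beta_rules power2_eq_square algebra_simps)

lemma line4_eq:
  assumes t: "triple i j k"
  shows "line4 i 4 k 5 = cyc_line j 0 (if k = nxt j then 1 else - 1) 0"
proof -
  have "pspan (ediff i 4) (ediff k 5) = cross_line i j k 0 1 0"
  proof (rule pspan_eqI)
    show "cross_line i j k 0 1 0 \<in> proj_lines" using cross_line_in_proj_lines[OF t] .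
    show "(ediff i 4, ediff k 5) \<in> frames"
      using t by (intro framesI_coords[of _ 4 _ 5]; cases rule: triple_cases) (simp_all add: ediff_nth)
    show "ediff i 4 \<in> cross_line i j k 0 1 0" "ediff k 5 \<in> cross_line i j k 0 1 0"
      using t by (cases rule: triple_cases; simp add: cross_line_def ediff_nth)+
  qed
  then show ?thesis by (simp add: line4_def cross_line_eq_cyc_line[OF t])
qed

lemma line5_eq:
  assumes t: "triple i j k"
  shows "line5 i j k 4 5 = cyc_line j beta_minus ((if k = nxt j then - 1 else 1) * beta_minus) 0"
    and "pspan (ediff i 4 + beta_minus *s ediff k j) (ediff k 5 + beta_minus *s ediff i j) = line5 i j k 4 5"
proof -
  have eq: "line5 i j k 4 5 = cross_line i j k beta_minus (- beta_minus) 0"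
    unfolding line5_def
  proof (rule pspan_eqI)
    show "cross_line i j k beta_minus (- beta_minus) 0 \<in> proj_lines" using cross_line_in_proj_lines[OF t] .
    show "(ediff k i + beta_minus *s ediff 5 4, ediff 5 j + beta_minus *s ediff k 4) \<in> frames"
      using t by (intro framesI_coords[of _ i _ j]; cases rule: triple_cases) (simp_all add: ediff_nth)
    show "ediff k i + beta_minus *s ediff 5 4 \<in> cross_line i j k beta_minus (- beta_minus) 0"
      "ediff 5 j + beta_minus *s ediff k 4 \<in> cross_line i j k beta_minus (- beta_minus) 0"
      using t by (cases rule: triple_cases; simp add: cross_line_def ediff_nth algebra_simps beta_rules)+
  qed
  then show "line5 i j k 4 5 = cyc_line j beta_minus ((if k = nxt j then - 1 else 1) * beta_minus) 0"
    by (simp add: cross_line_eq_cyc_line[OF t])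
  show "pspan (ediff i 4 + beta_minus *s ediff k j) (ediff k 5 + beta_minus *s ediff i j) = line5 i j k 4 5"
    unfolding eq by (rule pspan_eq_cross_line[OF t beta_sq(2)])
qed

lemma cyc_lineI:
  assumes j: "j \<in> {1, 2, 3}" and "(x, y) \<in> frames" "x \<in> cyc_line j c v e" "y \<in> cyc_line j c v e"
  shows "pspan x y = cyc_line j c v e"
  using assms cross_line_in_proj_lines[OF triple_cyc[OF j]] unfolding cyc_line_def by (intro pspan_eqI)

lemma line5_fixed:
  "line5 2 1 4 3 5 = cyc_line 3 beta_plus beta_plus 0"
  "line5 1 2 4 3 5 = cyc_line 3 beta_plus (- beta_plus) 0"
  "line5 2 4 1 3 5 = cyc_line 2 beta_plus (- beta_plus) 0"
  "line5 1 3 4 2 5 = cyc_line 2 beta_plus beta_plus 0"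
  "line5 1 4 2 3 5 = cyc_line 1 beta_plus beta_plus 0"
  "line5 1 4 3 2 5 = cyc_line 1 beta_plus (- beta_plus) 0"
proof -
  show "line5 2 1 4 3 5 = cyc_line 3 beta_plus beta_plus 0"
    unfolding line5_def by (rule cyc_lineI, simp, rule framesI_coords[of _ 2 _ 5])
      (simp_all add: ediff_nth cyc_line_def cross_line_def prv_def nxt_def algebra_simps beta_rules)
  show "line5 1 2 4 3 5 = cyc_line 3 beta_plus (- beta_plus) 0"
    unfolding line5_def by (rule cyc_lineI, simp, rule framesI_coords[of _ 1 _ 5])
      (simp_all add: ediff_nth cyc_line_def cross_line_def prv_def nxt_def algebra_simps beta_rules)
  show "line5 2 4 1 3 5 = cyc_line 2 beta_plus (- beta_plus) 0"
    unfolding line5_def by (rule cyc_lineI, simp, rule framesI_coords[of _ 2 _ 5])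
      (simp_all add: ediff_nth cyc_line_def cross_line_def prv_def nxt_def algebra_simps beta_rules)
  show "line5 1 3 4 2 5 = cyc_line 2 beta_plus beta_plus 0"
    unfolding line5_def by (rule cyc_lineI, simp, rule framesI_coords[of _ 1 _ 5])
      (simp_all add: ediff_nth cyc_line_def cross_line_def prv_def nxt_def algebra_simps beta_rules)
  show "line5 1 4 2 3 5 = cyc_line 1 beta_plus beta_plus 0"
    unfolding line5_def by (rule cyc_lineI, simp, rule framesI_coords[of _ 1 _ 5])
      (simp_all add: ediff_nth cyc_line_def cross_line_def prv_def nxt_def algebra_simps beta_rules)
  show "line5 1 4 3 2 5 = cyc_line 1 beta_plus (- beta_plus) 0"
    unfolding line5_def by (rule cyc_lineI, simp, rule framesI_coords[of _ 1 _ 5])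
      (simp_all add: ediff_nth cyc_line_def cross_line_def prv_def nxt_def algebra_simps beta_rules)
qed

lemma line4_fixed:
  "line4 1 2 4 5 = plane_line 3" "line4 1 3 4 5 = plane_line 2" "line4 2 3 4 5 = plane_line 1"
  by (simp_all add: line4_def pspan_eq_plane_line insert_commute)

lemma line4_fixed':
  "line4 1 2 3 4 = cyc_line 3 (- 1) 0 1" "line4 1 2 3 5 = cyc_line 3 (- 1) 0 (- 1)"
  "line4 1 3 2 4 = cyc_line 2 (- 1) 0 1" "line4 1 3 2 5 = cyc_line 2 (- 1) 0 (- 1)"
  "line4 2 3 1 4 = cyc_line 1 (- 1) 0 1" "line4 2 3 1 5 = cyc_line 1 (- 1) 0 (- 1)"
  by (simp_all add: line4_def pspan_eq_cross_line_b insert_commute)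

lemma pspan_eq_cyc_line_plus:
  assumes t: "triple i j k" and "{p, q} = {4, 5}"
  shows "pspan (ediff i p + beta_plus *s ediff k j) (ediff k q + beta_plus *s ediff i j) =
     cyc_line j beta_plus ((if (k = nxt j) = (p = 4) then - 1 else 1) * beta_plus) 0"
    and "pspan (ediff j i + beta_minus *s ediff k q) (ediff k p + beta_minus *s ediff j q) =
     cyc_line j beta_plus ((if (k = nxt j) = (p = 4) then - 1 else 1) * beta_plus) 0"
proof -
  have "p = 4 \<and> q = 5 \<or> p = 5 \<and> q = 4" using assms(2) by (auto simp: doubleton_eq_iff)
  then show "pspan (ediff i p + beta_plus *s ediff k j) (ediff k q + beta_plus *s ediff i j) =
     cyc_line j beta_plus ((if (k = nxt j) = (p = 4) then - 1 else 1) * beta_plus) 0"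
    "pspan (ediff j i + beta_minus *s ediff k q) (ediff k p + beta_minus *s ediff j q) =
     cyc_line j beta_plus ((if (k = nxt j) = (p = 4) then - 1 else 1) * beta_plus) 0"
    by (elim disjE; simp add: pspan_eq_cross_line[OF t] pspan_eq_cross_line'[OF t] beta_sq cross_line_eq_cyc_line[OF t])+
qed

section \<open>Incidence and the double-six\<close>

text \<open>
  The twelve lines that move: the flag tells whether \<open>c = 0\<close> or \<open>c = \<beta>\<^sub>-\<close>.  Normalizing \<open>v\<close> to \<open>s\<close> or
  \<open>s * \<beta>\<^sub>-\<close> makes the incidences depend on the sign \<open>s\<close> in the same way for both.
\<close>

definition swapped_line :: "5 \<Rightarrow> bool \<Rightarrow> complex \<Rightarrow> line" where
  "swapped_line j m s = (if m then cyc_line j 0 s 0 else cyc_line j beta_minus (s * beta_minus) 0)"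

lemma meets_commute: "meets V W \<longleftrightarrow> meets W V"
  by (simp add: meets_def Int_commute)

lemma meets_iff:
  assumes "V \<in> proj_lines" "W \<in> proj_lines"
  shows "meets V W \<longleftrightarrow> (\<exists>x. x \<in> V \<and> x \<in> W \<and> x \<noteq> 0)"
proof -
  have "0 \<in> V" "0 \<in> W" using assms by (auto simp: proj_lines_def vec.subspace_0)
  then show ?thesis by (auto simp: meets_def)
qed

text \<open>
  If the common point has \<open>x\<^sub>4 + x\<^sub>5 \<noteq> 0\<close> then \<open>c = c'\<close>; otherwise it is the point of both lines in the plane
  \<open>x\<^sub>4 + x\<^sub>5 = 0\<close>, which determines \<open>v\<close>.  Conversely, the lines then share \<open>cross_pt\<close> or \<open>cross_dir\<close>.
\<close>

lemma meets_cross_line_same: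
  assumes t: "triple i j k"
  shows "meets (cross_line i j k c v 0) (cross_line i j k c' v' 0) \<longleftrightarrow> c = c' \<or> v = v'"
proof -
  let ?V = "cross_line i j k c v 0" and ?W = "cross_line i j k c' v' 0"
  have "(\<exists>x. x \<in> ?V \<and> x \<in> ?W \<and> x \<noteq> 0) \<longleftrightarrow> c = c' \<or> v = v'"
  proof
    assume "\<exists>x. x \<in> ?V \<and> x \<in> ?W \<and> x \<noteq> 0"
    then obtain x where x: "x \<in> ?V" "x \<in> ?W" "x \<noteq> 0" by blast
    have "v = v'" if "c \<noteq> c'"
    proof -
      have "(c - c') * (x $ 4 + x $ 5) = 0" using x(1,2) by (simp add: cross_line_def algebra_simps)
      then have s: "x $ 4 + x $ 5 = 0" using that by simp
      have "x $ 4 - x $ 5 = v * (x $ k - x $ i)" "x $ 4 - x $ 5 = v' * (x $ k - x $ i)"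
        using x(1,2) s by (simp_all add: cross_line_def)
      then have "(v - v') * (x $ k - x $ i) = 0" by algebra
      moreover have "x $ k - x $ i \<noteq> 0"
      proof
        assume d: "x $ k - x $ i = 0"
        have *: "x $ 4 - x $ 5 = 0" "x $ j = 0" "x $ 1 + x $ 2 + x $ 3 = 0"
          using x(1) s d by (auto simp: cross_line_def add.assoc)
        have "2 * x $ 4 = 0" "2 * x $ 5 = 0" using s *(1) by algebra+
        then have 45: "x $ 4 = 0" "x $ 5 = 0" by simp_all
        have "x $ i + x $ j + x $ k = 0" using *(3) triple_sum[OF t, of "\<lambda>n. x $ n"] by simp
        then have "2 * x $ i = 0" using d *(2) by algebra
        then have "x $ i = 0" "x $ k = 0" using d by simp_all
        then have "x = 0" using *(2) 45 by - (rule triple_cases[OF t], simp_all add: cvec_eq_iff)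
        then show False using x(3) by simp
      qed
      ultimately show ?thesis by simp
    qed
    then show "c = c' \<or> v = v'" by blast
  next
    have nz: "cross_dir i k v \<noteq> 0" "cross_pt j c 0 \<noteq> 0"
      using framesD[OF cross_frame[OF t, of v c 0], of 1 0] framesD[OF cross_frame[OF t, of v c 0], of 0 1] by auto
    assume "c = c' \<or> v = v'"
    then show "\<exists>x. x \<in> ?V \<and> x \<in> ?W \<and> x \<noteq> 0"
      using nz cross_dir_in[OF t, of v c 0] cross_dir_in[OF t, of v' c' 0]
        cross_pt_in[OF t, of c 0 v] cross_pt_in[OF t, of c' 0 v'] by metis
  qed
  then show ?thesis using meets_iff cross_line_in_proj_lines[OF t] by simp
qed

text \<open>
  On a common point, scaled to \<open>x\<^sub>4 + x\<^sub>5 = 1\<close>, the values of \<open>x\<^sub>j\<close>, \<open>x\<^sub>k\<close> and hence \<open>x\<^sub>i\<close> are prescribed, and the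
  condition says that the two lines also prescribe the same value of \<open>x\<^sub>4 - x\<^sub>5\<close>.
\<close>

lemma meets_cross_line_next:
  assumes t: "triple i j k"
  shows "meets (cross_line i j k c v 0) (cross_line j k i c' v' 0) \<longleftrightarrow>
    v * (1 + c + 2 * c') + v' * (1 + 2 * c + c') = 0"
proof -
  let ?V = "cross_line i j k c v 0" and ?W = "cross_line j k i c' v' 0"
  have t': "triple j k i" using t by auto
  have "(\<exists>x. x \<in> ?V \<and> x \<in> ?W \<and> x \<noteq> 0) \<longleftrightarrow> v * (1 + c + 2 * c') + v' * (1 + 2 * c + c') = 0"
  proof
    assume "\<exists>x. x \<in> ?V \<and> x \<in> ?W \<and> x \<noteq> 0"
    then obtain x where x: "x \<in> ?V" "x \<in> ?W" "x \<noteq> 0" by blast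
    define s where "s = x $ 4 + x $ 5"
    have sum: "x $ i + x $ j + x $ k + s = 0"
      using x(1) triple_sum[OF t, of "\<lambda>n. x $ n"] unfolding cross_line_def mem_Collect_eq s_def by (metis add.assoc)
    have *: "x $ j = c * s" "x $ k = c' * s" "x $ 4 - x $ 5 = v * (x $ k - x $ i)"
        "x $ 4 - x $ 5 = v' * (x $ i - x $ j)"
      using x(1,2) by (auto simp: cross_line_def s_def)
    have "s * (v * (1 + c + 2 * c') + v' * (1 + 2 * c + c')) = 0" using sum * by algebra
    moreover have "s \<noteq> 0"
    proof
      assume s: "s = 0"
      have jk: "x $ j = 0" "x $ k = 0" using *(1,2) s by simp_all
      then have "x $ i = 0" using sum s by simp
      have "2 * x $ 4 = 0" "2 * x $ 5 = 0" using s *(3) jk \<open>x $ i = 0\<close> unfolding s_def by algebra+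
      then have "x = 0" using jk \<open>x $ i = 0\<close> by - (rule triple_cases[OF t], simp_all add: cvec_eq_iff)
      then show False using x(3) by simp
    qed
    ultimately show "v * (1 + c + 2 * c') + v' * (1 + 2 * c + c') = 0" by simp
  next
    assume *: "v * (1 + c + 2 * c') + v' * (1 + 2 * c + c') = 0"
    \<comment> \<open>The common value of \<open>x\<^sub>4 - x\<^sub>5\<close> prescribed by the two lines.\<close>
    define D where "D = v * (1 + c + 2 * c')"
    have D': "D = v' * (- 1 - 2 * c - c')" unfolding D_def using * by algebra
    define x :: cvec where "x = (\<chi> n. if n = j then c else if n = k then c' else if n = i then - (1 + c + c')
      else if n = 4 then (1 + D) / 2 else (1 - D) / 2)"
    have "i \<noteq> j" "i \<noteq> k" "j \<noteq> k" "i \<noteq> 4" "i \<noteq> 5" "j \<noteq> 4" "j \<noteq> 5" "k \<noteq> 4" "k \<noteq> 5"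
      using t by (cases rule: triple_cases; simp)+
    then have nth: "x $ j = c" "x $ k = c'" "x $ i = - (1 + c + c')" "x $ 4 = (1 + D) / 2" "x $ 5 = (1 - D) / 2"
      by (simp_all add: x_def)
    have s: "x $ 4 + x $ 5 = 1" "x $ 4 - x $ 5 = D" unfolding nth by (simp_all add: field_simps)
    have sum: "x $ 1 + x $ 2 + x $ 3 + x $ 4 + x $ 5 = 0"
      using triple_sum[OF t, of "\<lambda>n. x $ n"] s(1) nth(1-3) by algebra
    have "x \<in> ?V" unfolding cross_line_def mem_Collect_eq s using sum by (simp add: nth D_def algebra_simps)
    moreover have "x \<in> ?W" unfolding cross_line_def mem_Collect_eq s using sum by (simp add: nth D' algebra_simps)
    moreover have "x \<noteq> 0" using s(1) by auto
    ultimately show "\<exists>x. x \<in> ?V \<and> x \<in> ?W \<and> x \<noteq> 0" by blast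
  qed
  then show ?thesis using meets_iff cross_line_in_proj_lines[OF t] cross_line_in_proj_lines[OF t'] by simp
qed

lemma swapped_line_in_proj_lines: "j \<in> {1, 2, 3} \<Longrightarrow> swapped_line j m s \<in> proj_lines"
  using cross_line_in_proj_lines[OF triple_cyc] by (simp add: swapped_line_def cyc_line_def)

lemma swapped_line_eq_iff:
  assumes "j \<in> {1, 2, 3}" "j' \<in> {1, 2, 3}"
  shows "swapped_line j m s = swapped_line j' m' s' \<longleftrightarrow> j = j' \<and> m = m' \<and> s = s'"
  using beta_neq(1) by (auto simp: swapped_line_def cyc_line_eq_iff[OF assms])

text \<open>
  For different \<open>j\<close> the condition of \<open>meets_cross_line_next\<close> becomes \<open>(s + s') * r = 0\<close> with a factor \<open>r \<noteq> 0\<close> that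
  depends only on the two flags; this uses \<open>\<beta>\<^sub>-\<^sup>2 = \<beta>\<^sub>- + 1\<close>.
\<close>

lemma meets_swapped_line:
  assumes j: "j \<in> {1, 2, 3}" "j' \<in> {1, 2, 3}" and s: "s \<in> {1, - 1}" "s' \<in> {1, - 1}"
  shows "meets (swapped_line j m s) (swapped_line j' m' s') \<longleftrightarrow> (if j = j' then m = m' else s \<noteq> s')"
proof -
  have nxt: "meets (swapped_line j m s) (swapped_line (nxt j) m' s') \<longleftrightarrow> s \<noteq> s'"
    if j: "j \<in> {1, 2, 3}" and s: "s \<in> {1, - 1}" "s' \<in> {1, - 1}" for j m s m' s'
  proof -
    have c: "prv (nxt j) = j" "nxt (nxt j) = prv j" using j by (auto simp: prv_def nxt_def)
    have "s \<noteq> s' \<longleftrightarrow> s + s' = 0" using s by auto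
    moreover have "1 * s * (1 + 2 * beta_minus) + 1 * (s' * beta_minus) * (1 + beta_minus) = (s + s') * (1 + 2 * beta_minus)"
      by (simp add: algebra_simps beta_rules)
    moreover have "(s * beta_minus) * (1 + beta_minus) + s' * (1 + 2 * beta_minus) = (s + s') * (1 + 2 * beta_minus)"
      by (simp add: algebra_simps beta_rules)
    moreover have "(s * beta_minus) * (1 + beta_minus + 2 * beta_minus) + (s' * beta_minus) * (1 + 2 * beta_minus + beta_minus)
        = (s + s') * (beta_minus * (1 + 3 * beta_minus))"
      by (simp add: algebra_simps)
    ultimately show ?thesis
      using meets_cross_line_next[OF triple_cyc[OF j]] beta_neq(1,8,9) unfolding swapped_line_def cyc_line_def c
      by (cases m; cases m') (simp_all only: if_True if_False mult_eq_0_iff, simp_all)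
  qed
  consider "j' = j" | "j' = nxt j" "j \<noteq> j'" | "j = nxt j'" "j \<noteq> j'"
    using j by (auto simp: nxt_def)
  then show ?thesis
  proof cases
    case 1
    have "s * beta_minus = s' * beta_minus \<longleftrightarrow> s = s'" using beta_neq(1) by simp
    moreover have b: "- beta_minus \<noteq> 1" using beta_neq(3) by (metis minus_minus)
    moreover have "s \<noteq> s' * beta_minus" "s * beta_minus \<noteq> s'" 
      using s beta_neq(2,3) b by auto
    ultimately show ?thesis
      unfolding 1 swapped_line_def cyc_line_def
      using meets_cross_line_same[OF triple_cyc[OF j(1)]] beta_neq(1) by (cases m; cases m') simp_all
  next
    case 2
    then show ?thesis using nxt[OF j(1) s] by simp
  next
    case 3
    then show ?thesis using nxt[OF j(2) s(2,1)] by (subst meets_commute) auto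
  qed
qed

section \<open>The symmetric group\<close>

text \<open>
  A permutation of \<open>{1, 2, 3}\<close> is even iff \<open>(\<sigma> 1, \<sigma> 2, \<sigma> 3)\<close> is in cyclic order.
\<close>

lemma permutes_123:
  assumes "\<sigma> permutes {1, 2, 3 :: 5}"
  shows "triple (\<sigma> 1) (\<sigma> 2) (\<sigma> 3)" "evenperm \<sigma> \<longleftrightarrow> \<sigma> 3 = nxt (\<sigma> 2)"
proof -
  have "\<sigma> ` {1, 2, 3} = {1, 2, 3}" using permutes_image[OF assms] .
  then show t: "triple (\<sigma> 1) (\<sigma> 2) (\<sigma> 3)" by simp
  have 45: "\<sigma> 4 = 4" "\<sigma> 5 = 5" using assms by (auto intro: permutes_not_in)
  have eqI: "\<sigma> = \<tau>" if "\<sigma> 1 = \<tau> 1" "\<sigma> 2 = \<tau> 2" "\<sigma> 3 = \<tau> 3" "\<tau> 4 = 4" "\<tau> 5 = 5" for \<tau>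
  proof
    fix x show "\<sigma> x = \<tau> x"
      using UNIV_I[of x] that 45 unfolding UNIV_5 by (auto simp: 45)
  qed
  have ev: "evenperm (Transposition.transpose a b \<circ> Transposition.transpose c d)" if "a \<noteq> b" "c \<noteq> d" for a b c d :: 5
    using that by (simp add: evenperm_comp permutation_swap_id evenperm_swap)
  have od: "\<not> evenperm (Transposition.transpose a b)" if "a \<noteq> b" for a b :: 5
    using that by (simp add: evenperm_swap)
  from t show "evenperm \<sigma> \<longleftrightarrow> \<sigma> 3 = nxt (\<sigma> 2)"
  proof (cases rule: triple_cases)
    case 1
    then have "\<sigma> = id" by (intro eqI) auto
    then show ?thesis using 1 by (simp add: nxt_def)
  next
    case 2
    then have "\<sigma> = Transposition.transpose 1 2 \<circ> Transposition.transpose 2 3" by (intro eqI) (auto simp: Transposition.transpose_def)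
    then show ?thesis using 2 ev[of 1 2 2 3] by (simp add: nxt_def)
  next
    case 3
    then have "\<sigma> = Transposition.transpose 2 3 \<circ> Transposition.transpose 1 2" by (intro eqI) (auto simp: Transposition.transpose_def)
    then show ?thesis using 3 ev[of 2 3 1 2] by (simp add: nxt_def)
  next
    case 4
    then have "\<sigma> = Transposition.transpose 1 3" by (intro eqI) (auto simp: Transposition.transpose_def)
    then show ?thesis using 4 od[of 1 3] by (simp add: nxt_def)
  next
    case 5
    then have "\<sigma> = Transposition.transpose 2 3" by (intro eqI) (auto simp: Transposition.transpose_def)
    then show ?thesis using 5 od[of 2 3] by (simp add: nxt_def)
  next
    case 6
    then have "\<sigma> = Transposition.transpose 1 2" by (intro eqI) (auto simp: Transposition.transpose_def)
    then show ?thesis using 6 od[of 1 2] by (simp add: nxt_def)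
  qed
qed

lemma S3_bij:
  "bij_betw (\<lambda>\<sigma>. (\<sigma> 2, evenperm \<sigma>)) {\<sigma>. \<sigma> permutes {1, 2, 3 :: 5}} ({1, 2, 3} \<times> UNIV)"
proof -
  let ?f = "\<lambda>\<sigma> :: 5 \<Rightarrow> 5. (\<sigma> 2, evenperm \<sigma>)" and ?S = "{\<sigma>. \<sigma> permutes {1, 2, 3 :: 5}}"
  have inj: "inj_on ?f ?S"
  proof (rule inj_onI)
    fix \<sigma> \<tau> assume *: "\<sigma> \<in> ?S" "\<tau> \<in> ?S" "?f \<sigma> = ?f \<tau>"
    have t: "triple (\<sigma> 1) (\<sigma> 2) (\<sigma> 3)" "triple (\<tau> 1) (\<tau> 2) (\<tau> 3)"
      and e: "(\<sigma> 3 = nxt (\<sigma> 2)) = (\<tau> 3 = nxt (\<tau> 2))" "\<sigma> 2 = \<tau> 2"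
      using permutes_123[of \<sigma>] permutes_123[of \<tau>] * by auto
    have 13: "\<sigma> 1 = \<tau> 1 \<and> \<sigma> 3 = \<tau> 3"
      using e by - (rule triple_cases[OF t(1)]; rule triple_cases[OF t(2)]; simp add: nxt_def)
    have 45: "\<sigma> 4 = 4" "\<sigma> 5 = 5" "\<tau> 4 = 4" "\<tau> 5 = 5" using *(1,2) by (auto intro: permutes_not_in)
    show "\<sigma> = \<tau>"
    proof
      fix x show "\<sigma> x = \<tau> x" using UNIV_I[of x] 13 45 e(2) unfolding UNIV_5 by auto
    qed
  qed
  have "card ?S = fact 3" by (rule card_permutations) simp_all
  then have "card (?f ` ?S) = 6" using card_image[OF inj] by (simp add: fact_numeral)
  moreover have "card ({1, 2, 3 :: 5} \<times> (UNIV :: bool set)) = 6" by (simp add: card_cartesian_product)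
  moreover have "?f ` ?S \<subseteq> {1, 2, 3} \<times> UNIV" using permutes_in_image by fastforce
  ultimately have "?f ` ?S = {1, 2, 3} \<times> UNIV" by (intro card_subset_eq) auto
  with inj show ?thesis by (simp add: bij_betw_def)
qed

definition sign_of :: "bool \<Rightarrow> complex" where "sign_of b = (if b then 1 else - 1)"

lemma sign_of: "sign_of b \<in> {1, - 1}" "sign_of b = sign_of b' \<longleftrightarrow> b = b'" "- sign_of b = sign_of (\<not> b)"
  by (auto simp: sign_of_def)

lemma MN_eq:
  assumes "\<sigma> permutes {1, 2, 3 :: 5}"
  shows "line4 (\<sigma> 1) 4 (\<sigma> 3) 5 = swapped_line (\<sigma> 2) True (sign_of (evenperm \<sigma>))"
    and "line5 (\<sigma> 1) (\<sigma> 2) (\<sigma> 3) 4 5 = swapped_line (\<sigma> 2) False (sign_of (\<not> evenperm \<sigma>))"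
  using line4_eq[OF permutes_123(1)[OF assms]] line5_eq(1)[OF permutes_123(1)[OF assms]] permutes_123(2)[OF assms]
  by (simp_all add: swapped_line_def sign_of_def)

text \<open>
  The sides are the two signs.  A line of one side misses exactly the line of the other side with the same
  \<open>j\<close> and the opposite flag, so these two are given the same number.
\<close>

lemma double_six_sides_swapped_lines:
  "double_six_sides ((\<lambda>(j, m). swapped_line j m 1) ` ({1, 2, 3} \<times> UNIV)) ((\<lambda>(j, m). swapped_line j m (- 1)) ` ({1, 2, 3} \<times> UNIV))"
proof -
  let ?I = "{1, 2, 3 :: 5} \<times> (UNIV :: bool set)"
  have "card ?I = 6" by (simp add: card_cartesian_product)
  then obtain h where h: "bij_betw h {1..6 :: nat} ?I"
    using ex_bij_betw_nat_finite_1[of ?I] by auto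
  define a where "a n = swapped_line (fst (h n)) (snd (h n)) 1" for n
  define b where "b n = swapped_line (fst (h n)) (\<not> snd (h n)) (- 1)" for n
  have hI: "fst (h n) \<in> {1, 2, 3}" if "n \<in> {1..6}" for n
    using bij_betwE[OF h] that by (cases "h n") force
  have hinj: "h n = h n' \<longleftrightarrow> n = n'" if "n \<in> {1..6}" "n' \<in> {1..6}" for n n'
    using h that by (auto simp: bij_betw_def inj_on_def)
  have A: "bij_betw (\<lambda>(j, m). swapped_line j m 1) ?I ((\<lambda>(j, m). swapped_line j m 1) ` ?I)"
    by (intro inj_on_imp_bij_betw inj_onI) (auto simp: swapped_line_eq_iff)
  have B: "bij_betw (\<lambda>(j, m). swapped_line j (\<not> m) (- 1)) ?I ((\<lambda>(j, m). swapped_line j m (- 1)) ` ?I)"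
  proof -
    have "(\<lambda>(j, m). swapped_line j m (- 1)) ` ?I = (\<lambda>(j, m). swapped_line j (\<not> m) (- 1)) ` ?I"
    proof -
      have "?I \<subseteq> (\<lambda>(j, m). (j, \<not> m)) ` ?I"
      proof
        fix x assume x: "x \<in> ?I"
        then have "(fst x, \<not> snd x) \<in> ?I" by (simp only: mem_Times_iff fst_conv UNIV_I snd_conv simp_thms)
        from imageI[OF this, of "\<lambda>(j, m). (j, \<not> m)"] show "x \<in> (\<lambda>(j, m). (j, \<not> m)) ` ?I" by simp
      qed
      moreover have "(\<lambda>(j, m). (j, \<not> m)) ` ?I \<subseteq> ?I" by auto
      ultimately have "(\<lambda>(j, m). (j, \<not> m)) ` ?I = ?I" by blast
      then have "(\<lambda>(j, m). swapped_line j m (- 1)) ` (\<lambda>(j, m). (j, \<not> m)) ` ?I = (\<lambda>(j, m). swapped_line j m (- 1)) ` ?I"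
        by (rule arg_cong)
      then show ?thesis by (simp only: image_image case_prod_unfold fst_conv snd_conv)
    qed
    moreover have "inj_on (\<lambda>(j, m). swapped_line j (\<not> m) (- 1)) ?I" by (intro inj_onI) (auto simp: swapped_line_eq_iff)
    ultimately show ?thesis by (metis inj_on_imp_bij_betw)
  qed
  show ?thesis unfolding double_six_sides_def
  proof (intro conjI; (rule exI[of _ a], rule exI[of _ b], intro conjI)?)
    show "bij_betw a {1..6} ((\<lambda>(j, m). swapped_line j m 1) ` ?I)"
      using bij_betw_trans[OF h A] by (simp add: a_def[abs_def] o_def case_prod_unfold)
    show "bij_betw b {1..6} ((\<lambda>(j, m). swapped_line j m (- 1)) ` ?I)"
      using bij_betw_trans[OF h B] by (simp add: b_def[abs_def] o_def case_prod_unfold)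
    show "(\<lambda>(j, m). swapped_line j m 1) ` ?I \<union> (\<lambda>(j, m). swapped_line j m (- 1)) ` ?I \<subseteq> proj_lines"
      using swapped_line_in_proj_lines by auto
    have "(\<lambda>(j, m). swapped_line j m 1) ` ?I \<inter> (\<lambda>(j, m). swapped_line j m (- 1)) ` ?I = {}"
      by (auto simp: swapped_line_eq_iff)
    moreover have "card ((\<lambda>(j, m). swapped_line j m 1) ` ?I) = 6" "card ((\<lambda>(j, m). swapped_line j m (- 1)) ` ?I) = 6"
      using bij_betw_same_card[OF A] bij_betw_same_card[OF B] \<open>card ?I = 6\<close> by simp_all
    ultimately show "card ((\<lambda>(j, m). swapped_line j m 1) ` ?I \<union> (\<lambda>(j, m). swapped_line j m (- 1)) ` ?I) = 12"
      by (subst card_Un_disjoint) auto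
    have pm: "1 \<in> {1, - 1 :: complex}" "- 1 \<in> {1, - 1 :: complex}" "(1 :: complex) \<noteq> - 1" by auto
    have aa: "meets (a n) (a n') \<longleftrightarrow> h n = h n'" and bb: "meets (b n) (b n') \<longleftrightarrow> h n = h n'"
      and ab: "meets (a n) (b n') \<longleftrightarrow> h n \<noteq> h n'" if "n \<in> {1..6}" "n' \<in> {1..6}" for n n'
      unfolding a_def b_def meets_swapped_line[OF hI[OF that(1)] hI[OF that(2)] pm(1) pm(1)]
        meets_swapped_line[OF hI[OF that(1)] hI[OF that(2)] pm(2) pm(2)]
        meets_swapped_line[OF hI[OF that(1)] hI[OF that(2)] pm(1) pm(2)]
      using pm(3) by (auto simp: prod_eq_iff)
    show "\<forall>n\<in>{1..6}. \<forall>n'\<in>{1..6}. n \<noteq> n' \<longrightarrow> \<not> meets (a n) (a n') \<and> \<not> meets (b n) (b n')"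
      using hinj aa bb by blast
    show "\<forall>n\<in>{1..6}. \<forall>n'\<in>{1..6}. meets (a n) (b n') \<longleftrightarrow> n \<noteq> n'"
      using hinj ab by blast
  qed
qed

lemma double_six_sides_disjoint:
  assumes "double_six_sides A B"
  shows "A \<inter> B = {}"
proof -
  obtain a b :: "nat \<Rightarrow> line" where ab: "bij_betw a {1..6} A" "bij_betw b {1..6} B"
    using assms unfolding double_six_sides_def by blast
  have "card A = 6" "card B = 6" "finite A" "finite B"
    using bij_betw_same_card[OF ab(1)] bij_betw_same_card[OF ab(2)]
      bij_betw_finite[OF ab(1)] bij_betw_finite[OF ab(2)] by simp_all
  moreover have "card (A \<union> B) = 12" using assms by (simp add: double_six_sides_def)
  ultimately have "card (A \<inter> B) = 0" using card_Un_Int[of A B] by simp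
  with \<open>finite A\<close> show ?thesis by simp
qed

lemma double_six_sides_opposite:
  assumes ds: "double_six_sides A B" and xy: "x \<in> A \<union> B" "y \<in> A \<union> B" "x \<noteq> y" "meets x y"
  shows "x \<in> A \<longleftrightarrow> y \<notin> A"
proof -
  obtain a b :: "nat \<Rightarrow> line" where ab: "bij_betw a {1..6} A" "bij_betw b {1..6} B"
      "\<And>i j. i \<in> {1..6} \<Longrightarrow> j \<in> {1..6} \<Longrightarrow> i \<noteq> j \<Longrightarrow> \<not> meets (a i) (a j) \<and> \<not> meets (b i) (b j)"
    using ds unfolding double_six_sides_def by blast
  have A: "A = a ` {1..6}" and B: "B = b ` {1..6}" using ab(1,2) by (auto simp: bij_betw_def)
  have "\<not> (x \<in> A \<and> y \<in> A)"
  proof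
    assume "x \<in> A \<and> y \<in> A"
    then obtain i j where "i \<in> {1..6}" "j \<in> {1..6}" "x = a i" "y = a j" unfolding A by blast
    then show False using ab(3)[of i j] xy(3,4) by auto
  qed
  moreover have "\<not> (x \<in> B \<and> y \<in> B)"
  proof
    assume "x \<in> B \<and> y \<in> B"
    then obtain i j where "i \<in> {1..6}" "j \<in> {1..6}" "x = b i" "y = b j" unfolding B by blast
    then show False using ab(3)[of i j] xy(3,4) by auto
  qed
  ultimately show ?thesis using xy(1,2) by blast
qed

section \<open>The fixed lines\<close>

abbreviation (input) idx :: "5 set" where "idx \<equiv> {1, 2, 3}"

abbreviation (input) line_b :: "5 \<Rightarrow> complex \<Rightarrow> line" where
  "line_b j s \<equiv> cyc_line j (- 1) 0 s"

abbreviation (input) line_c :: "5 \<Rightarrow> complex \<Rightarrow> line" where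
  "line_c j s \<equiv> cyc_line j beta_plus (s * beta_plus) 0"

abbreviation (input) spans_a :: "line set" where
  "spans_a \<equiv> {l. \<exists>i j k. triple i j k \<and> l = pspan (ediff i j) (ediff 4 5)}"

abbreviation (input) spans_b :: "line set" where
  "spans_b \<equiv> {l. \<exists>i j k p q. triple i j k \<and> {p, q} = {4, 5 :: 5} \<and> l = pspan (ediff i j) (ediff k p)}"

abbreviation (input) spans_c :: "line set" where
  "spans_c \<equiv> {l. \<exists>i j k p q. triple i j k \<and> {p, q} = {4, 5 :: 5} \<and>
     l = pspan (ediff i p + beta_plus *s ediff k j) (ediff k q + beta_plus *s ediff i j)}"

lemma eq_doubleton_45: "{p, q} = {4, 5 :: 5} \<longleftrightarrow> p = 4 \<and> q = 5 \<or> p = 5 \<and> q = 4"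
  by (auto simp: doubleton_eq_iff)

lemma exists_triple:
  assumes "k \<in> idx" shows "\<exists>i j. triple i j k"
  using triple_cyc[OF assms] by (intro exI[of _ "prv k"] exI[of _ "nxt k"]) auto

lemma spans_a_eq: "spans_a = plane_line ` idx"
proof
  show "spans_a \<subseteq> plane_line ` idx"
  proof
    fix l assume "l \<in> spans_a"
    then obtain i j k where *: "triple i j k" "l = pspan (ediff i j) (ediff 4 5)" by blast
    then have "k \<in> idx" by blast
    then show "l \<in> plane_line ` idx" using * pspan_eq_plane_line by blast
  qed
  show "plane_line ` idx \<subseteq> spans_a"
  proof (rule image_subsetI, rule CollectI)
    fix k assume "k \<in> idx"
    then show "\<exists>i j k'. triple i j k' \<and> plane_line k = pspan (ediff i j) (ediff 4 5)"
      using exists_triple pspan_eq_plane_line by metis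
  qed
qed

lemma spans_b_eq: "spans_b = (\<lambda>(j, s). line_b j s) ` (idx \<times> {1, - 1})"
proof
  show "spans_b \<subseteq> (\<lambda>(j, s). line_b j s) ` (idx \<times> {1, - 1})"
  proof
    fix l assume "l \<in> spans_b"
    then obtain i j k p where *: "triple i j k" "p \<in> {4, 5}" "l = pspan (ediff i j) (ediff k p)"
      by (auto simp: eq_doubleton_45)
    then have "l = line_b k (if p = 4 then 1 else - 1)" "k \<in> idx"
      using pspan_eq_cross_line_b[OF *(1,2)] by auto
    then show "l \<in> (\<lambda>(j, s). line_b j s) ` (idx \<times> {1, - 1})"
      by (intro image_eqI[of _ _ "(k, if p = 4 then 1 else - 1)"]) auto
  qed
  show "(\<lambda>(j, s). line_b j s) ` (idx \<times> {1, - 1}) \<subseteq> spans_b"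
  proof clarify
    fix k s assume k: "k \<in> idx" and s: "s \<in> {1, - 1 :: complex}"
    obtain i j where t: "triple i j k" using exists_triple[OF k] by blast
    define p q :: 5 where "p = (if s = 1 then 4 else 5)" and "q = (if s = 1 then 5 else 4)"
    have pq': "{p, q} = {4, 5}" "p \<in> {4, 5}" by (auto simp: p_def q_def)
    have "(if p = 4 then 1 else - 1) = s" using s by (auto simp: p_def)
    then have "line_b k s = pspan (ediff i j) (ediff k p)"
      using pspan_eq_cross_line_b[OF t pq'(2)] by simp
    then show "\<exists>i j k' p q. triple i j k' \<and> {p, q} = {4, 5 :: 5} \<and> line_b k s = pspan (ediff i j) (ediff k' p)"
      using t pq'(1) by blast
  qed
qed

lemma spans_c_eq: "spans_c = (\<lambda>(j, s). line_c j s) ` (idx \<times> {1, - 1})"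
proof
  show "spans_c \<subseteq> (\<lambda>(j, s). line_c j s) ` (idx \<times> {1, - 1})"
  proof
    fix l assume "l \<in> spans_c"
    then obtain i j k p q where *: "triple i j k" "{p, q} = {4, 5}"
        "l = pspan (ediff i p + beta_plus *s ediff k j) (ediff k q + beta_plus *s ediff i j)"
      by blast
    then have "l = (\<lambda>(j, s). line_c j s) (j, if (k = nxt j) = (p = 4) then - 1 else 1)" "j \<in> idx"
      using pspan_eq_cyc_line_plus(1)[OF *(1,2)] by auto
    then show "l \<in> (\<lambda>(j, s). line_c j s) ` (idx \<times> {1, - 1})"
      by (intro image_eqI[of _ _ "(j, if (k = nxt j) = (p = 4) then - 1 else 1)"]) auto
  qed
  show "(\<lambda>(j, s). line_c j s) ` (idx \<times> {1, - 1}) \<subseteq> spans_c"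
  proof clarify
    fix j s assume j: "j \<in> idx" and s: "s \<in> {1, - 1 :: complex}"
    define p q :: 5 where "p = (if s = 1 then 5 else 4)" and "q = (if s = 1 then 4 else 5)"
    have pq': "{p, q} = {4, 5}" by (auto simp: p_def q_def)
    have "line_c j s =
        pspan (ediff (prv j) p + beta_plus *s ediff (nxt j) j) (ediff (nxt j) q + beta_plus *s ediff (prv j) j)"
      using pspan_eq_cyc_line_plus(1)[OF triple_cyc[OF j] pq'] s by (auto simp: p_def)
    then show "\<exists>i j' k p q. triple i j' k \<and> {p, q} = {4, 5 :: 5} \<and> line_c j s =
        pspan (ediff i p + beta_plus *s ediff k j') (ediff k q + beta_plus *s ediff i j')"
      using triple_cyc[OF j] pq' by blast
  qed
qed

lemma image_signed_indices:
  fixes f :: "5 \<Rightarrow> complex \<Rightarrow> line"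
  shows "(\<lambda>(j, s). f j s) ` (idx \<times> {1, - 1}) = {f 1 1, f 1 (- 1), f 2 1, f 2 (- 1), f 3 1, f 3 (- 1)}"
  by auto

lemma card_image_signed_indices:
  fixes f :: "5 \<Rightarrow> complex \<Rightarrow> line"
  assumes "\<And>j s j' s'. j \<in> idx \<Longrightarrow> j' \<in> idx \<Longrightarrow> f j s = f j' s' \<Longrightarrow> j = j' \<and> s = s'"
  shows "card ((\<lambda>(j, s). f j s) ` (idx \<times> {1, - 1})) = 6"
proof -
  have "inj_on (\<lambda>(j, s). f j s) (idx \<times> {1, - 1})"
  proof (rule inj_onI)
    fix x y assume "x \<in> idx \<times> {1, - 1}" "y \<in> idx \<times> {1, - 1}" "(\<lambda>(j, s). f j s) x = (\<lambda>(j, s). f j s) y"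
    then show "x = y" using assms[of "fst x" "fst y" "snd x" "snd y"]
      by (simp only: case_prod_unfold mem_Times_iff prod_eq_iff)
  qed
  then show ?thesis by (simp add: card_image card_cartesian_product)
qed

lemma card_spans: "card spans_a = 3" "card spans_b = 6" "card spans_c = 6"
proof -
  show "card spans_a = 3"
    unfolding spans_a_eq by (subst card_image) (auto intro!: inj_onI simp: plane_line_eq_iff)
  show "card spans_b = 6"
    unfolding spans_b_eq by (rule card_image_signed_indices) (simp add: cyc_line_eq_iff)
  show "card spans_c = 6"
    unfolding spans_c_eq by (rule card_image_signed_indices) (simp add: cyc_line_eq_iff beta_neq(4))
qed

lemma spans_lists:
  "spans_a = {line4 1 2 4 5, line4 1 3 4 5, line4 2 3 4 5}"
  "spans_b = {line4 1 2 3 4, line4 1 2 3 5, line4 1 3 2 4, line4 1 3 2 5, line4 2 3 1 4, line4 2 3 1 5}"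
  "spans_c = {line5 2 1 4 3 5, line5 1 2 4 3 5, line5 2 4 1 3 5, line5 1 3 4 2 5, line5 1 4 2 3 5, line5 1 4 3 2 5}"
  unfolding spans_a_eq spans_b_eq spans_c_eq image_signed_indices line4_fixed line4_fixed' line5_fixed by auto

text \<open>
  The plane lines do not depend on \<open>w\<close>, and the branches with \<open>n = 0\<close> and with \<open>c = -1\<close> are unchanged when \<open>d\<close>
  changes sign; on the other lines \<open>c\<close> changes between \<open>0\<close> and \<open>\<beta>\<^sub>-\<close>.
\<close>

lemma fixed_lines:
  assumes \<epsilon>: "0 < \<epsilon>" "\<epsilon> < 4 / 27" and t: "t0 < 0" "2 * pi < t3"
  shows "{l \<in> lines_on clebsch. g45 \<epsilon> t0 t3 l = l} = spans_a \<union> spans_b \<union> spans_c"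
proof
  note g45 = g45_on_clebsch_lines[OF \<epsilon> t]
  show "{l \<in> lines_on clebsch. g45 \<epsilon> t0 t3 l = l} \<subseteq> spans_a \<union> spans_b \<union> spans_c"
  proof (rule subsetI)
    fix l assume "l \<in> {l \<in> lines_on clebsch. g45 \<epsilon> t0 t3 l = l}"
    then have l: "l \<in> lines_on clebsch" "g45 \<epsilon> t0 t3 l = l" by (simp_all only: mem_Collect_eq)
    from l(1) show "l \<in> spans_a \<union> spans_b \<union> spans_c"
    proof (cases rule: clebsch_line_cases)
      case (1 j)
      have "l \<in> spans_a" unfolding spans_a_eq 1(2) using 1(1) by (rule imageI)
      then show ?thesis by (intro UnI1)
    next
      case (2 j s)
      then have "(j, s) \<in> idx \<times> {1, - 1}" by (intro SigmaI)
      from imageI[OF this, of "\<lambda>(j, s). line_b j s"] have "l \<in> spans_b" unfolding spans_b_eq 2(3) by simp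
      then show ?thesis by (rule UnI1[OF UnI2])
    next
      case (3 j s)
      then have "(j, s) \<in> idx \<times> {1, - 1}" by (intro SigmaI)
      from imageI[OF this, of "\<lambda>(j, s). line_c j s"] have "l \<in> spans_c" unfolding spans_c_eq 3(3) by simp
      then show ?thesis by (rule UnI2)
    next
      case (4 j s)
      then show ?thesis using l(2) g45(4)[OF 4(1,2)] cyc_line_eq_iff[OF 4(1) 4(1)] beta_neq(1) by simp
    next
      case (5 j s)
      then show ?thesis using l(2) g45(5)[OF 5(1,2)] cyc_line_eq_iff[OF 5(1) 5(1)] beta_neq(1) by simp
    qed
  qed
  show "spans_a \<union> spans_b \<union> spans_c \<subseteq> {l \<in> lines_on clebsch. g45 \<epsilon> t0 t3 l = l}"
    unfolding spans_a_eq spans_b_eq spans_c_eq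
  proof (intro Un_least)
    have inc: "(\<lambda>(j, s). f j s) ` (idx \<times> {1, - 1}) \<subseteq> {l \<in> lines_on clebsch. g45 \<epsilon> t0 t3 l = l}"
      if "\<And>j s. j \<in> idx \<Longrightarrow> s \<in> {1, - 1} \<Longrightarrow> f j s \<in> lines_on clebsch \<and> g45 \<epsilon> t0 t3 (f j s) = f j s"
      for f :: "5 \<Rightarrow> complex \<Rightarrow> line"
      using that by (intro image_subsetI) (simp only: case_prod_unfold mem_Times_iff mem_Collect_eq)
    show "plane_line ` idx \<subseteq> {l \<in> lines_on clebsch. g45 \<epsilon> t0 t3 l = l}"
      using g45(1) lines_on_clebschI(1) by (intro image_subsetI CollectI conjI)
    show "(\<lambda>(j, s). line_b j s) ` (idx \<times> {1, - 1}) \<subseteq> {l \<in> lines_on clebsch. g45 \<epsilon> t0 t3 l = l}"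
      by (rule inc) (intro conjI g45(2) lines_on_clebschI(2))
    show "(\<lambda>(j, s). line_c j s) ` (idx \<times> {1, - 1}) \<subseteq> {l \<in> lines_on clebsch. g45 \<epsilon> t0 t3 l = l}"
      by (rule inc) (intro conjI g45(3) lines_on_clebschI(3))
  qed
qed

lemma card_fixed_lines: "card (spans_a \<union> spans_b \<union> spans_c) = 15"
proof -
  have fin: "finite spans_a" "finite spans_b" "finite spans_c" unfolding spans_a_eq spans_b_eq spans_c_eq by simp_all
  have plane: "plane_line ` idx \<inter> (\<lambda>(j, s). f j s) ` (idx \<times> {1, - 1}) = {}"
    if "\<And>j s k. j \<in> idx \<Longrightarrow> f j s \<noteq> plane_line k" for f :: "5 \<Rightarrow> complex \<Rightarrow> line"
  proof (rule equals0I)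
    fix l assume "l \<in> plane_line ` idx \<inter> (\<lambda>(j, s). f j s) ` (idx \<times> {1, - 1})"
    then obtain k j s where "j \<in> idx" "l = plane_line k" "l = f j s" by (auto simp del: insert_iff)
    then show False using that by metis
  qed
  have "spans_a \<inter> spans_b = {}" unfolding spans_a_eq spans_b_eq by (rule plane) (rule cyc_line_neq_plane_line)
  moreover have "(spans_a \<union> spans_b) \<inter> spans_c = {}"
  proof -
    have "spans_a \<inter> spans_c = {}" unfolding spans_a_eq spans_c_eq by (rule plane) (rule cyc_line_neq_plane_line)
    moreover have "spans_b \<inter> spans_c = {}"
      
    proof (rule equals0I)
      fix l assume "l \<in> spans_b \<inter> spans_c"
      then obtain j s j' s' where "j \<in> idx" "j' \<in> idx" "l = line_b j s"
          "l = cyc_line j' beta_plus (s' * beta_plus) 0"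
        unfolding spans_b_eq spans_c_eq by blast
      then show False using cyc_line_eq_iff[of j j'] beta_neq(7) by metis
    qed
    ultimately show ?thesis by (simp only: Int_Un_distrib2 Un_empty)
  qed
  ultimately have "card (spans_a \<union> spans_b \<union> spans_c) = card spans_a + card spans_b + card spans_c"
    using card_Un_disjoint[OF fin(1,2)] card_Un_disjoint[OF finite_UnI[OF fin(1,2)] fin(3)] by argo
  also have "\<dots> = 15" unfolding card_spans(1) card_spans(2) card_spans(3) by simp
  finally show ?thesis .
qed

section \<open>The exchanged pairs and the double-six\<close>

abbreviation (input) S3 :: "(5 \<Rightarrow> 5) set" where "S3 \<equiv> {\<sigma>. \<sigma> permutes {1, 2, 3}}"

abbreviation (input) line_M :: "(5 \<Rightarrow> 5) \<Rightarrow> line" where "line_M \<sigma> \<equiv> line4 (\<sigma> 1) 4 (\<sigma> 3) 5"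

abbreviation (input) line_N :: "(5 \<Rightarrow> 5) \<Rightarrow> line" where "line_N \<sigma> \<equiv> line5 (\<sigma> 1) (\<sigma> 2) (\<sigma> 3) 4 5"

abbreviation (input) swapped_lines :: "line set" where "swapped_lines \<equiv> \<Union>\<sigma>\<in>S3. {line_M \<sigma>, line_N \<sigma>}"

definition orient :: "(5 \<Rightarrow> 5) \<Rightarrow> complex" where "orient \<sigma> = sign_of (evenperm \<sigma>)"

lemma
  assumes "\<sigma> \<in> S3"
  shows line_M_eq: "line_M \<sigma> = swapped_line (\<sigma> 2) True (orient \<sigma>)"
    and line_N_eq: "line_N \<sigma> = swapped_line (\<sigma> 2) False (- orient \<sigma>)"
    and S3_middle: "\<sigma> 2 \<in> idx"
    and orient_sign: "orient \<sigma> \<in> {1, - 1}" "- orient \<sigma> \<in> {1, - 1}"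
proof -
  have p: "\<sigma> permutes {1, 2, 3}" using assms by simp
  show "line_M \<sigma> = swapped_line (\<sigma> 2) True (orient \<sigma>)" "line_N \<sigma> = swapped_line (\<sigma> 2) False (- orient \<sigma>)"
    using MN_eq[OF p] by (simp_all add: orient_def sign_of)
  show "\<sigma> 2 \<in> idx" using permutes_123(1)[OF p] by blast
  show "orient \<sigma> \<in> {1, - 1}" "- orient \<sigma> \<in> {1, - 1}" by (auto simp: orient_def sign_of_def)
qed

lemma exists_S3:
  assumes "j \<in> idx" "s \<in> {1, - 1}"
  shows "\<exists>\<sigma>\<in>S3. \<sigma> 2 = j \<and> orient \<sigma> = s"
proof -
  have "(j, s = 1) \<in> (\<lambda>\<sigma>. (\<sigma> 2, evenperm \<sigma>)) ` S3"
    using S3_bij assms(1) unfolding bij_betw_def by blast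
  then obtain \<sigma> where "\<sigma> \<in> S3" "\<sigma> 2 = j" "evenperm \<sigma> = (s = 1)" by auto
  then show ?thesis using assms(2) by (intro bexI[of _ \<sigma>]) (auto simp: orient_def sign_of_def)
qed

lemma S3_eqI:
  assumes "\<sigma> \<in> S3" "\<tau> \<in> S3" "\<sigma> 2 = \<tau> 2" "orient \<sigma> = orient \<tau>"
  shows "\<sigma> = \<tau>"
  using inj_onD[OF bij_betw_imp_inj_on[OF S3_bij], of \<sigma> \<tau>] assms by (auto simp: orient_def sign_of(2))

definition side :: "complex \<Rightarrow> line set" where
  "side s = (\<lambda>(j, m). swapped_line j m s) ` (idx \<times> UNIV)"

lemma swapped_lines_eq: "swapped_lines = side 1 \<union> side (- 1)"
proof
  have AB: "swapped_line j m s \<in> side 1 \<union> side (- 1)" if "j \<in> idx" "s \<in> {1, - 1}" for j m s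
  proof -
    have "(j, m) \<in> idx \<times> UNIV" using that(1) by (intro SigmaI UNIV_I)
    from imageI[OF this, of "\<lambda>(j, m). swapped_line j m 1"] imageI[OF this, of "\<lambda>(j, m). swapped_line j m (- 1)"]
    have "swapped_line j m 1 \<in> side 1" "swapped_line j m (- 1) \<in> side (- 1)"
      unfolding side_def by simp_all
    moreover have "s = 1 \<or> s = - 1" using that(2) by blast
    ultimately show ?thesis by (elim disjE) (simp_all only: Un_iff simp_thms)
  qed
  show "swapped_lines \<subseteq> side 1 \<union> side (- 1)"
  proof (rule UN_least)
    fix \<sigma> assume \<sigma>: "\<sigma> \<in> S3"
    show "{line_M \<sigma>, line_N \<sigma>} \<subseteq> side 1 \<union> side (- 1)"
      unfolding line_M_eq[OF \<sigma>] line_N_eq[OF \<sigma>] using AB[OF S3_middle[OF \<sigma>] orient_sign(1)[OF \<sigma>]] AB[OF S3_middle[OF \<sigma>] orient_sign(2)[OF \<sigma>]]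
      by (simp only: insert_subset empty_subsetI simp_thms)
  qed
  have "swapped_line j m s \<in> swapped_lines" if js: "j \<in> idx" "s \<in> {1, - 1}" for j m s
  proof -
    have ms: "- s \<in> {1, - 1}" using js(2) by auto
    obtain \<sigma> where \<sigma>: "\<sigma> \<in> S3" "\<sigma> 2 = j" "orient \<sigma> = (if m then s else - s)"
      using exists_S3[OF js(1), of "if m then s else - s"] js(2) ms by (cases m) auto
    then have "swapped_line j m s \<in> {line_M \<sigma>, line_N \<sigma>}" using line_M_eq[of \<sigma>] line_N_eq[of \<sigma>] by (cases m) simp_all
    then show ?thesis using \<sigma>(1) by blast
  qed
  then show "side 1 \<union> side (- 1) \<subseteq> swapped_lines"
    unfolding side_def
    by (intro Un_least image_subsetI) (simp_all only: case_prod_unfold mem_Times_iff insert_iff simp_thms)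
qed

text \<open>
  Two meeting lines are on opposite sides, whatever the sides are.  Each line \<open>line_N \<sigma>\<close> meets each
  \<open>line_N \<tau>\<close> of opposite parity, so that the parity decides the side of \<open>line_N \<sigma>\<close>.  And \<open>line_M \<sigma>\<close> meets
  \<open>line_N \<tau>\<close> for another \<open>\<tau>\<close> of the same parity as \<open>\<sigma>\<close>, so that it is opposite to \<open>line_N \<sigma>\<close>.
\<close>

lemma sides_unique:
  assumes AB: "double_six_sides A B" "swapped_lines = A \<union> B"
  shows "(\<forall>\<sigma>\<in>S3. (line_M \<sigma> \<in> A \<and> line_N \<sigma> \<in> B) \<or> (line_M \<sigma> \<in> B \<and> line_N \<sigma> \<in> A)) \<and>
    ((line_N ` {\<sigma> \<in> S3. evenperm \<sigma>} \<subseteq> A \<and> line_N ` (S3 - {\<sigma> \<in> S3. evenperm \<sigma>}) \<subseteq> B) \<or>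
     (line_N ` {\<sigma> \<in> S3. evenperm \<sigma>} \<subseteq> B \<and> line_N ` (S3 - {\<sigma> \<in> S3. evenperm \<sigma>}) \<subseteq> A))"
proof -
  have disj: "A \<inter> B = {}" by (rule double_six_sides_disjoint[OF AB(1)])
  have MD: "line_M \<sigma> \<in> swapped_lines" and ND: "line_N \<sigma> \<in> swapped_lines" if "\<sigma> \<in> S3" for \<sigma> using that by blast+
  have NN: "line_N \<sigma> \<in> A \<longleftrightarrow> line_N \<tau> \<notin> A" if st: "\<sigma> \<in> S3" "\<tau> \<in> S3" "orient \<sigma> \<noteq> orient \<tau>" for \<sigma> \<tau>
  proof (rule double_six_sides_opposite[OF AB(1)])
    show "line_N \<sigma> \<noteq> line_N \<tau>" "meets (line_N \<sigma>) (line_N \<tau>)"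
      unfolding line_N_eq[OF st(1)] line_N_eq[OF st(2)] swapped_line_eq_iff[OF S3_middle[OF st(1)] S3_middle[OF st(2)]]
        meets_swapped_line[OF S3_middle[OF st(1)] S3_middle[OF st(2)] orient_sign(2)[OF st(1)] orient_sign(2)[OF st(2)]]
      using st(3) by simp_all
  qed (use ND[OF st(1)] ND[OF st(2)] AB(2) in simp_all)
  have MN: "line_M \<sigma> \<in> A \<longleftrightarrow> line_N \<tau> \<notin> A"
    if st: "\<sigma> \<in> S3" "\<tau> \<in> S3" "orient \<sigma> = orient \<tau>" "\<sigma> 2 \<noteq> \<tau> 2" for \<sigma> \<tau>
  proof (rule double_six_sides_opposite[OF AB(1)])
    have "orient \<sigma> \<noteq> - orient \<tau>" using orient_sign(1)[OF st(1)] st(3) by auto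
    then show "line_M \<sigma> \<noteq> line_N \<tau>" "meets (line_M \<sigma>) (line_N \<tau>)"
      unfolding line_M_eq[OF st(1)] line_N_eq[OF st(2)] swapped_line_eq_iff[OF S3_middle[OF st(1)] S3_middle[OF st(2)]]
        meets_swapped_line[OF S3_middle[OF st(1)] S3_middle[OF st(2)] orient_sign(1)[OF st(1)] orient_sign(2)[OF st(2)]]
      using st(4) by simp_all
  qed (use MD[OF st(1)] ND[OF st(2)] AB(2) in simp_all)
  have NN': "line_N \<sigma> \<in> A \<longleftrightarrow> line_N \<tau> \<in> A" if st: "\<sigma> \<in> S3" "\<tau> \<in> S3" "orient \<sigma> = orient \<tau>" for \<sigma> \<tau>
  proof -
    obtain \<rho> where \<rho>: "\<rho> \<in> S3" "orient \<rho> = - orient \<sigma>"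
      using exists_S3[OF S3_middle[OF st(1)] orient_sign(2)[OF st(1)]] by blast
    have "orient \<sigma> \<noteq> - orient \<sigma>" using orient_sign(1)[OF st(1)] by auto
    then show ?thesis using NN[OF st(1) \<rho>(1)] NN[OF st(2) \<rho>(1)] \<rho>(2) st(3) by simp
  qed
  have MN': "line_M \<sigma> \<in> A \<longleftrightarrow> line_N \<sigma> \<notin> A" if s: "\<sigma> \<in> S3" for \<sigma>
  proof -
    obtain j where j: "j \<in> idx" "\<sigma> 2 \<noteq> j" using that[of 1] that[of 2] by (cases "\<sigma> 2 = 1") simp_all
    obtain \<tau> where \<tau>: "\<tau> \<in> S3" "\<tau> 2 = j" "orient \<tau> = orient \<sigma>"
      using exists_S3[OF j(1) orient_sign(1)[OF s]] by blast
    then show ?thesis using MN[OF s \<tau>(1)] NN'[OF s \<tau>(1)] j(2) by simp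
  qed
  have inB: "x \<in> B \<longleftrightarrow> x \<notin> A" if "x \<in> swapped_lines" for x using that AB(2) disj by blast
  have ev: "evenperm \<sigma> \<longleftrightarrow> orient \<sigma> = 1" for \<sigma> by (simp add: orient_def sign_of_def)
  have one: "orient \<sigma> = - 1" if "\<sigma> \<in> S3" "\<not> evenperm \<sigma>" for \<sigma> using that by (simp add: orient_def sign_of_def)
  obtain e where e: "e \<in> S3" "orient e = 1" using exists_S3[of 1 1] by auto
  have even: "line_N \<sigma> \<in> A \<longleftrightarrow> line_N e \<in> A" if "\<sigma> \<in> S3" "evenperm \<sigma>" for \<sigma>
    using NN'[OF that(1) e(1)] that(2) ev e(2) by simp
  have odd: "line_N \<sigma> \<in> A \<longleftrightarrow> line_N e \<notin> A" if "\<sigma> \<in> S3" "\<not> evenperm \<sigma>" for \<sigma>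
    using NN[OF that(1) e(1)] one[OF that] e(2) by simp
  have 1: "\<forall>\<sigma>\<in>S3. (line_M \<sigma> \<in> A \<and> line_N \<sigma> \<in> B) \<or> (line_M \<sigma> \<in> B \<and> line_N \<sigma> \<in> A)"
    using MN' inB[OF MD] inB[OF ND] by metis
  show ?thesis
  proof (cases "line_N e \<in> A")
    case True
    then have "line_N ` {\<sigma> \<in> S3. evenperm \<sigma>} \<subseteq> A \<and> line_N ` (S3 - {\<sigma> \<in> S3. evenperm \<sigma>}) \<subseteq> B"
      using even odd inB[OF ND] by (intro conjI image_subsetI) simp_all
    then show ?thesis by (intro conjI[OF 1] disjI1)
  next
    case False
    then have "line_N ` {\<sigma> \<in> S3. evenperm \<sigma>} \<subseteq> B \<and> line_N ` (S3 - {\<sigma> \<in> S3. evenperm \<sigma>}) \<subseteq> A"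
      using even odd inB[OF ND] by (intro conjI image_subsetI) simp_all
    then show ?thesis by (intro conjI[OF 1] disjI2)
  qed
qed

lemma card_pairs: "card ((\<lambda>\<sigma>. {line_M \<sigma>, line_N \<sigma>}) ` S3) = 6"
proof -
  have "inj_on (\<lambda>\<sigma>. {line_M \<sigma>, line_N \<sigma>}) S3"
  proof (rule inj_onI)
    fix \<sigma> \<tau> assume st: "\<sigma> \<in> S3" "\<tau> \<in> S3" "{line_M \<sigma>, line_N \<sigma>} = {line_M \<tau>, line_N \<tau>}"
    then have "line_M \<sigma> = line_M \<tau> \<or> line_M \<sigma> = line_N \<tau>" by blast
    then have "\<sigma> 2 = \<tau> 2 \<and> orient \<sigma> = orient \<tau>"
      using line_M_eq[OF st(1)] line_M_eq[OF st(2)] line_N_eq[OF st(2)] swapped_line_eq_iff[OF S3_middle[OF st(1)] S3_middle[OF st(2)]] by simp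
    then show "\<sigma> = \<tau>" using S3_eqI st by blast
  qed
  then have "card ((\<lambda>\<sigma>. {line_M \<sigma>, line_N \<sigma>}) ` S3) = card S3" by (rule card_image)
  also have "\<dots> = 6" using bij_betw_same_card[OF S3_bij] by (simp add: card_cartesian_product)
  finally show ?thesis .
qed

lemma swapped_lines_on_clebsch: "swapped_lines \<subseteq> lines_on clebsch"
proof -
  have "swapped_line j m s \<in> lines_on clebsch" if "j \<in> idx" "s \<in> {1, - 1}" for j m s
    using lines_on_clebschI(4,5)[OF that] by (simp add: swapped_line_def)
  then show ?thesis
    unfolding swapped_lines_eq side_def
    by (intro Un_least image_subsetI) (simp_all only: case_prod_unfold mem_Times_iff insert_iff simp_thms)
qed

lemma exchanged_pairs:
  assumes \<epsilon>: "0 < \<epsilon>" "\<epsilon> < 4 / 27" and t: "t0 < 0" "2 * pi < t3" and \<sigma>: "\<sigma> \<in> S3"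
  shows "line_M \<sigma> \<noteq> line_N \<sigma>" "g45 \<epsilon> t0 t3 (line_M \<sigma>) = line_N \<sigma>" "g45 \<epsilon> t0 t3 (line_N \<sigma>) = line_M \<sigma>"
proof -
  note g45 = g45_on_clebsch_lines[OF \<epsilon> t]
  show "line_M \<sigma> \<noteq> line_N \<sigma>" unfolding line_M_eq[OF \<sigma>] line_N_eq[OF \<sigma>] by (simp add: swapped_line_eq_iff[OF S3_middle[OF \<sigma>] S3_middle[OF \<sigma>]])
  show "g45 \<epsilon> t0 t3 (line_M \<sigma>) = line_N \<sigma>" "g45 \<epsilon> t0 t3 (line_N \<sigma>) = line_M \<sigma>"
    unfolding line_M_eq[OF \<sigma>] line_N_eq[OF \<sigma>] swapped_line_def if_True if_False
    using g45(4)[OF S3_middle[OF \<sigma>] orient_sign(1)[OF \<sigma>]] g45(5)[OF S3_middle[OF \<sigma>] orient_sign(2)[OF \<sigma>]] by simp_all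
qed

section \<open>The monodromy of the loop\<close>

theorem theorem5p6:
  shows "\<forall>\<^sub>F \<epsilon> in at_right (0::real). \<forall>t0 t3 :: real. t0 < 0 \<and> 2 * pi < t3 \<longrightarrow>
    (let g = g45 \<epsilon> t0 t3;
         ijk = (\<lambda>i j k. {i, j, k} = {1, 2, 3 :: 5});
         pq = (\<lambda>p q. {p, q} = {4, 5 :: 5});
         Fixed = {l \<in> lines_on clebsch. g l = l};
         Fa = {l. \<exists>i j k. ijk i j k \<and> l = pspan (ediff i j) (ediff 4 5)};
         Fb = {l. \<exists>i j k p q. ijk i j k \<and> pq p q \<and> l = pspan (ediff i j) (ediff k p)};
         Fc = {l. \<exists>i j k p q. ijk i j k \<and> pq p q \<and>
                  l = pspan (ediff i p + beta_plus *s ediff k j) (ediff k q + beta_plus *s ediff i j)};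
         S3 = {\<sigma> :: 5 \<Rightarrow> 5. \<sigma> permutes {1, 2, 3}};
         A3 = {\<sigma> \<in> S3. evenperm \<sigma>};
         M = (\<lambda>\<sigma> :: 5 \<Rightarrow> 5. line4 (\<sigma> 1) 4 (\<sigma> 3) 5);
         N = (\<lambda>\<sigma> :: 5 \<Rightarrow> 5. line5 (\<sigma> 1) (\<sigma> 2) (\<sigma> 3) 4 5);
         D = (\<Union>\<sigma>\<in>S3. {M \<sigma>, N \<sigma>})
     in card (lines_on clebsch) = 27
      \<and> \<comment> \<open>the fixed lines\<close>
        card Fixed = 15 \<and> Fixed = Fa \<union> Fb \<union> Fc
      \<and> card Fa = 3 \<and> Fa = {line4 1 2 4 5, line4 1 3 4 5, line4 2 3 4 5}
      \<and> card Fb = 6 \<and> Fb = {line4 1 2 3 4, line4 1 2 3 5, line4 1 3 2 4,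
                             line4 1 3 2 5, line4 2 3 1 4, line4 2 3 1 5}
      \<and> card Fc = 6 \<and> Fc = {line5 2 1 4 3 5, line5 1 2 4 3 5, line5 2 4 1 3 5,
                             line5 1 3 4 2 5, line5 1 4 2 3 5, line5 1 4 3 2 5}
      \<and> (\<forall>i j k p q. ijk i j k \<and> pq p q \<longrightarrow>
           pspan (ediff i p + beta_plus *s ediff k j) (ediff k q + beta_plus *s ediff i j) =
           pspan (ediff j i + beta_minus *s ediff k q) (ediff k p + beta_minus *s ediff j q))
      \<and> \<comment> \<open>the exchanged pairs\<close>
        card ((\<lambda>\<sigma>. {M \<sigma>, N \<sigma>}) ` S3) = 6 \<and> card D = 12 \<and> D \<subseteq> lines_on clebsch
      \<and> (\<forall>\<sigma>\<in>S3. M \<sigma> \<noteq> N \<sigma> \<and> g (M \<sigma>) = N \<sigma> \<and> g (N \<sigma>) = M \<sigma>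
           \<and> M \<sigma> = pspan (ediff (\<sigma> 1) 4) (ediff (\<sigma> 3) 5)
           \<and> N \<sigma> = pspan (ediff (\<sigma> 1) 4 + beta_minus *s ediff (\<sigma> 3) (\<sigma> 2))
                          (ediff (\<sigma> 3) 5 + beta_minus *s ediff (\<sigma> 1) (\<sigma> 2)))
      \<and> \<comment> \<open>the double-six\<close>
        double_six D
      \<and> (\<forall>A B. double_six_sides A B \<and> D = A \<union> B \<longrightarrow>
           (\<forall>\<sigma>\<in>S3. (M \<sigma> \<in> A \<and> N \<sigma> \<in> B) \<or> (M \<sigma> \<in> B \<and> N \<sigma> \<in> A))
           \<and> ((N ` A3 \<subseteq> A \<and> N ` (S3 - A3) \<subseteq> B) \<or> (N ` A3 \<subseteq> B \<and> N ` (S3 - A3) \<subseteq> A))))"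
proof (rule eventually_at_rightI[of 0 "4 / 27"], intro allI impI, goal_cases)
  case (1 \<epsilon> t0 t3)
  then have \<epsilon>: "0 < \<epsilon>" "\<epsilon> < 4 / 27" and t: "t0 < 0" "2 * pi < t3" by auto
  have two_spans: "\<forall>i j k p q. triple i j k \<and> {p, q} = {4, 5 :: 5} \<longrightarrow>
      pspan (ediff i p + beta_plus *s ediff k j) (ediff k q + beta_plus *s ediff i j) =
      pspan (ediff j i + beta_minus *s ediff k q) (ediff k p + beta_minus *s ediff j q)"
    using pspan_eq_cyc_line_plus by metis
  have exchanged: "\<forall>\<sigma>\<in>S3. line_M \<sigma> \<noteq> line_N \<sigma> \<and> g45 \<epsilon> t0 t3 (line_M \<sigma>) = line_N \<sigma>
      \<and> g45 \<epsilon> t0 t3 (line_N \<sigma>) = line_M \<sigma>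
      \<and> line_M \<sigma> = pspan (ediff (\<sigma> 1) 4) (ediff (\<sigma> 3) 5)
      \<and> line_N \<sigma> = pspan (ediff (\<sigma> 1) 4 + beta_minus *s ediff (\<sigma> 3) (\<sigma> 2))
                     (ediff (\<sigma> 3) 5 + beta_minus *s ediff (\<sigma> 1) (\<sigma> 2))"
  proof (rule ballI, intro conjI)
    fix \<sigma> assume \<sigma>: "\<sigma> \<in> S3"
    show "line_M \<sigma> = pspan (ediff (\<sigma> 1) 4) (ediff (\<sigma> 3) 5)" by (rule line4_def)
    show "line_N \<sigma> = pspan (ediff (\<sigma> 1) 4 + beta_minus *s ediff (\<sigma> 3) (\<sigma> 2))
                     (ediff (\<sigma> 3) 5 + beta_minus *s ediff (\<sigma> 1) (\<sigma> 2))"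
      using line5_eq(2)[OF permutes_123(1)[of \<sigma>]] \<sigma> by simp
  qed (rule exchanged_pairs[OF \<epsilon> t], assumption)+
  have card_fixed: "card {l \<in> lines_on clebsch. g45 \<epsilon> t0 t3 l = l} = 15"
    unfolding fixed_lines[OF \<epsilon> t] by (rule card_fixed_lines)
  have "double_six_sides (side 1) (side (- 1))"
    unfolding side_def by (rule double_six_sides_swapped_lines)
  then have six: "double_six swapped_lines" "card swapped_lines = 12"
    unfolding swapped_lines_eq by (auto simp: double_six_def double_six_sides_def)
  have sides: "\<forall>A B. double_six_sides A B \<and> swapped_lines = A \<union> B \<longrightarrow>
      (\<forall>\<sigma>\<in>S3. (line_M \<sigma> \<in> A \<and> line_N \<sigma> \<in> B) \<or> (line_M \<sigma> \<in> B \<and> line_N \<sigma> \<in> A)) \<and>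
      ((line_N ` {\<sigma> \<in> S3. evenperm \<sigma>} \<subseteq> A \<and> line_N ` (S3 - {\<sigma> \<in> S3. evenperm \<sigma>}) \<subseteq> B) \<or>
       (line_N ` {\<sigma> \<in> S3. evenperm \<sigma>} \<subseteq> B \<and> line_N ` (S3 - {\<sigma> \<in> S3. evenperm \<sigma>}) \<subseteq> A))"
    by (intro allI impI; elim conjE; rule sides_unique; assumption)
  show ?case
    unfolding Let_def
    by (intro conjI card_lines_on_clebsch card_fixed fixed_lines[OF \<epsilon> t] card_spans spans_lists
        two_spans card_pairs six swapped_lines_on_clebsch exchanged sides)
qed simp

end
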